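(* Let $n\ge 2$, $1\le d\le n-1$ and $c=n-d$. (1) For any partition $\lambda\in\mathrm{Sh}(d,c)$ and $t\in\mathbb R$, the value of $s_\lambda$ on $u_{>0}(t)$ is given by $$s_\lambda(u_{>0}(t))=t^{|\lambda|}\,\frac{\prod_{(i,j)\in\lambda}\sin\left((d-i+j)\frac{\pi}{n}\right)}{\prod_{(i,j)\in\lambda}\sin\left(\mathrm{hl}(i,j)\frac{\pi}{n}\right)}.$$ The value of $q$ is given by $q(u_{>0}(t))=t^n$. (2) The map $u_{>0}:\mathbb R\to\mathcal V_{d,n}(\mathbb R)$ restricts to give homeomorphisms (for the standard Hausdorff topology) $$\mathbb R_{\ge 0}\to\mathcal V_{d,n}(\mathbb R_{\ge 0})\quad\text{and}\quad \mathbb R_{>0}\to\mathcal V_{d,n}(\mathbb R_{>0}).$$ So the $u_{>0}(t)$ for $t\in\mathbb R_{\ge 0}$ are precisely all the totally nonnegative elements in $\mathcal V_{d,n}$. (3) An element $u\in\mathcal V_{d,n}$ lies in $\mathcal V_{d,n}(\mathbb R_{\ge 0})$ if and only if $s_\lambda(u)\in\mathbb R_{\ge 0}$ for all $\lambda\in\mathrm{Sh}(d,c)$. It lies in $\mathcal V_{d,n}(\mathbb R_{>0})$ if and only if $s_\lambda(u)\in\mathbb R_{>0}$ for all $\lambda\in\mathrm{Sh}(d,c)$.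
   Context: The variety $\mathcal V_{d,n}$: Let $B^-\subset GL_n(\mathbb C)$ be the invertible lower-triangular matrices, $U^+\subset GL_n(\mathbb C)$ the unipotent upper-triangular matrices, $e_i$ the $n\times n$ matrix with unique nonzero entry $1$ in position $(i,i+1)$, $e=\sum_{i=1}^{n-1}e_i$, and $(U^+)^e=\{u\in U^+: ueu^{-1}=e\}$; this consists of the upper-triangular unipotent Toeplitz matrices $u$ with $(i,j)$ entry $x_{j-i}(u)$ ($x_0=1$, $x_k=0$ for $k<0$). Let $W\subset GL_n(\mathbb C)$ be the group of permutation matrices, $s_k$ the adjacent transposition $(k,k+1)$, $w_0$ the order-reversing permutation; for $K\subset\{1,\dots,n-1\}$ let $w_K$ be the longest element of $\langle s_k:k\in K\rangle$ and $w^K=w_0w_K$; let $\{\hat d\}=\{1,\dots,n-1\}\setminus\{d\}$. Then $\mathcal V_{d,n}:=(U^+)^e\cap\overline{B^-w^{\{\hat d\}}B^-}$ (closure in $GL_n(\mathbb C)$). On $\mathcal V_{d,n}$ one has $x_{d+1}=\dots=x_{n-1}=0$. Positive parts: A matrix is totally nonnegative if all its minors are nonnegative real numbers. $U^+(\mathbb R_{\ge0})$ is the set of totally nonnegative matrices in $U^+$. $\mathcal V_{d,n}(\mathbb R)=\mathcal V_{d,n}\cap GL_n(\mathbb R)$, $\mathcal V_{d,n}(\mathbb R_{\ge0})=\mathcal V_{d,n}(\mathbb R)\cap U^+(\mathbb R_{\ge 0})$, and $\mathcal V_{d,n}(\mathbb R_{>0})=\mathcal V_{d,n}(\mathbb R_{\ge0})\cap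 B^-w^{\{\hat d\}}B^-$. The map $u_{>0}$: For $z_1,\dots,z_d\in\mathbb C$ let $u_n(z_1,\dots,z_d)$ be the $n\times n$ upper-triangular unipotent Toeplitz matrix with $(i,i+j)$ entry $E_j(z_1,\dots,z_d)$ for $1\le j\le d$ (elementary symmetric polynomial) and $0$ for $j>d$. Let $\zeta=\exp(2\pi\sqrt{-1}/n)$, $\zeta^a:=\exp(2\pi\sqrt{-1}\,a/n)$, and $I_0=(-\frac{d-1}2,-\frac{d-1}2+1,\dots,\frac{d-1}2)$. Then $u_{>0}(t):=u_n(t\zeta^{I_0})=u_n(t\zeta^{-\frac{d-1}2},\dots,t\zeta^{\frac{d-1}2})$ for $t\in\mathbb R$; it lies in $\mathcal V_{d,n}(\mathbb R)$. Partitions and functions: $\mathrm{Sh}(d,c)$ is the set of partitions $\lambda=(\lambda_1\ge\dots\ge\lambda_d\ge0)$ with $\lambda_1\le c$; $|\lambda|=\sum\lambda_i$; $\lambda^t=(\lambda^t_1,\dots,\lambda^t_c)$ is the conjugate partition; $(i,j)\in\lambda$ means $j\le\lambda_i$ and $i\le\lambda_j^t$ with $i,j\ge1$; the hook length is $\mathrm{hl}(i,j)=\lambda_i+\lambda^t_j-i-j+1$. For $u\in\mathcal V_{d,n}$ set $s_\lambda(u)=\det\left(x_{\lambda^t_i+j-i}(u)\right)_{i,j=1,\dots,c}$ and $q(u)=(-1)^{d+1}\det\left(x_{i-j+1}(u)\right)_{i,j=1,\dots,n}$, where $x_0=1$ and $x_k=0$ for $k\notin\{0,\dots,d\}$. 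*)

theory Defs
  imports
    "HOL-Analysis.Function_Topology"
    "HOL-Library.Nonpos_Ints"
    "HOL-Algebra.Sym_Groups"
    "HOL-Algebra.Generated_Groups"
    "HOL-Combinatorics.Transposition"
    "Jordan_Normal_Form.Determinant"
    "Jordan_Normal_Form.DL_Submatrix"
begin

(* Matrices are complex n x n matrices with indices 0..n-1, so the entry in position (i, j) of the
   1-based mathematical notation is A $$ (i - 1, j - 1).  Permutations act on {1..n}, and partitions
   and Young diagrams are 1-based. *)

definition GL :: "nat \<Rightarrow> complex mat set" where
  "GL n = {A \<in> carrier_mat n n. invertible_mat A}"

definition Bminus :: "nat \<Rightarrow> complex mat set" where
  "Bminus n = {A \<in> GL n. \<forall>i<n. \<forall>j<n. i < j \<longrightarrow> A $$ (i, j) = 0}"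

definition Uplus :: "nat \<Rightarrow> complex mat set" where
  "Uplus n = {A \<in> carrier_mat n n. upper_triangular A \<and> (\<forall>i<n. A $$ (i, i) = 1)}"

definition e_mat :: "nat \<Rightarrow> complex mat" where
  "e_mat n = mat n n (\<lambda>(i, j). if j = Suc i then 1 else 0)"

definition Uplus_e :: "nat \<Rightarrow> complex mat set" where
  "Uplus_e n = {u \<in> Uplus n. \<exists>v \<in> carrier_mat n n.
     inverts_mat u v \<and> inverts_mat v u \<and> u * e_mat n * v = e_mat n}"

definition adj_transp :: "nat \<Rightarrow> nat \<Rightarrow> nat" where
  "adj_transp k = Transposition.transpose k (Suc k)"

definition word_perm :: "nat list \<Rightarrow> nat \<Rightarrow> nat" where
  "word_perm ks = foldr (\<lambda>k v. adj_transp k \<circ> v) ks id"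

definition coxeter_length :: "nat \<Rightarrow> (nat \<Rightarrow> nat) \<Rightarrow> nat" where
  "coxeter_length n w = (LEAST l. \<exists>ks. set ks \<subseteq> {1..n - 1} \<and> length ks = l \<and> w = word_perm ks)"

definition longest_elt :: "nat \<Rightarrow> nat set \<Rightarrow> nat \<Rightarrow> nat" where
  "longest_elt n K =
     arg_max (coxeter_length n) (\<lambda>w. w \<in> generate (sym_group n) (adj_transp ` K))"

definition w0 :: "nat \<Rightarrow> nat \<Rightarrow> nat" where
  "w0 n i = (if i \<in> {1..n} then n + 1 - i else i)"

definition w_upper :: "nat \<Rightarrow> nat set \<Rightarrow> nat \<Rightarrow> nat" where
  "w_upper n K = w0 n \<circ> longest_elt n K"

(* The homomorphic convention: the matrix of w sends the basis vector e_j to e_(w j). *)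
definition perm_mat :: "nat \<Rightarrow> (nat \<Rightarrow> nat) \<Rightarrow> complex mat" where
  "perm_mat n w = mat n n (\<lambda>(i, j). if w (Suc j) = Suc i then 1 else 0)"

definition Bruhat_cell :: "nat \<Rightarrow> (nat \<Rightarrow> nat) \<Rightarrow> complex mat set" where
  "Bruhat_cell n w = {b * perm_mat n w * b' | b b'. b \<in> Bminus n \<and> b' \<in> Bminus n}"

inductive_set poly_fun :: "nat \<Rightarrow> (complex mat \<Rightarrow> complex) set" for n :: nat where
  const: "(\<lambda>A. c) \<in> poly_fun n"
| entry: "i < n \<Longrightarrow> j < n \<Longrightarrow> (\<lambda>A. A $$ (i, j)) \<in> poly_fun n"
| add: "p \<in> poly_fun n \<Longrightarrow> q \<in> poly_fun n \<Longrightarrow> (\<lambda>A. p A + q A) \<in> poly_fun n"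
| mult: "p \<in> poly_fun n \<Longrightarrow> q \<in> poly_fun n \<Longrightarrow> (\<lambda>A. p A * q A) \<in> poly_fun n"

(* Zariski closure in GL n.  The regular functions on GL n also include 1 / det, but clearing
   this unit does not change zero sets, so polynomials in the entries suffice.  (For a double coset
   of the lower Borel subgroup this agrees with the closure in the Hausdorff topology.) *)
definition closure_GL :: "nat \<Rightarrow> complex mat set \<Rightarrow> complex mat set" where
  "closure_GL n S = {g \<in> GL n. \<forall>p \<in> poly_fun n. (\<forall>h \<in> S. p h = 0) \<longrightarrow> p g = 0}"

definition cell :: "nat \<Rightarrow> nat \<Rightarrow> complex mat set" where
  "cell d n = Bruhat_cell n (w_upper n ({1..n - 1} - {d}))"

definition V :: "nat \<Rightarrow> nat \<Rightarrow> complex mat set" where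
  "V d n = Uplus_e n \<inter> closure_GL n (cell d n)"

definition V_real :: "nat \<Rightarrow> nat \<Rightarrow> complex mat set" where
  "V_real d n = V d n \<inter> {A. \<forall>i<n. \<forall>j<n. A $$ (i, j) \<in> \<real>}"

definition totally_nonneg :: "nat \<Rightarrow> complex mat \<Rightarrow> bool" where
  "totally_nonneg n A \<longleftrightarrow> (\<forall>I J. I \<subseteq> {..<n} \<and> J \<subseteq> {..<n} \<and> card I = card J \<longrightarrow>
     det (submatrix A I J) \<in> \<real>\<^sub>\<ge>\<^sub>0)"

definition Uplus_nonneg :: "nat \<Rightarrow> complex mat set" where
  "Uplus_nonneg n = {A \<in> Uplus n. totally_nonneg n A}"

definition V_nonneg :: "nat \<Rightarrow> nat \<Rightarrow> complex mat set" where
  "V_nonneg d n = V_real d n \<inter> Uplus_nonneg n"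

definition V_pos :: "nat \<Rightarrow> nat \<Rightarrow> complex mat set" where
  "V_pos d n = V_nonneg d n \<inter> cell d n"

(* The Hausdorff topology on n x n matrices, transported from the product of n^2 copies of the
   complex plane. *)
definition mat_topology :: "nat \<Rightarrow> complex mat topology" where
  "mat_topology n = pullback_topology (carrier_mat n n)
     (\<lambda>A. restrict (\<lambda>ij. A $$ ij) ({..<n} \<times> {..<n}))
     (product_topology (\<lambda>_. euclidean) ({..<n} \<times> {..<n}))"

(* The elementary symmetric polynomial E_j in the d variables z 0, ..., z (d - 1). *)
definition esym :: "nat \<Rightarrow> (nat \<Rightarrow> complex) \<Rightarrow> nat \<Rightarrow> complex" where
  "esym d z j = (\<Sum>S | S \<subseteq> {..<d} \<and> card S = j. \<Prod>k\<in>S. z k)"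

definition u_toeplitz :: "nat \<Rightarrow> nat \<Rightarrow> (nat \<Rightarrow> complex) \<Rightarrow> complex mat" where
  "u_toeplitz n d z = mat n n (\<lambda>(i, j).
     if i = j then 1 else if i < j \<and> j - i \<le> d then esym d z (j - i) else 0)"

definition zeta_pow :: "nat \<Rightarrow> real \<Rightarrow> complex" where
  "zeta_pow n a = exp (2 * of_real pi * \<i> * of_real a / of_nat n)"

definition u_pos :: "nat \<Rightarrow> nat \<Rightarrow> real \<Rightarrow> complex mat" where
  "u_pos d n t = u_toeplitz n d (\<lambda>k. of_real t * zeta_pow n (- (real d - 1) / 2 + real k))"

(* A partition with at most d parts is a function of the index i in {1..d}, extended by 0. *)
definition Sh :: "nat \<Rightarrow> nat \<Rightarrow> (nat \<Rightarrow> nat) set" where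
  "Sh d c = {l. (\<forall>i j. 1 \<le> i \<and> i \<le> j \<and> j \<le> d \<longrightarrow> l j \<le> l i) \<and> l 1 \<le> c \<and> (\<forall>i. i \<notin> {1..d} \<longrightarrow> l i = 0)}"

definition part_size :: "nat \<Rightarrow> (nat \<Rightarrow> nat) \<Rightarrow> nat" where
  "part_size d l = (\<Sum>i = 1..d. l i)"

definition conjugate_part :: "nat \<Rightarrow> (nat \<Rightarrow> nat) \<Rightarrow> nat \<Rightarrow> nat" where
  "conjugate_part d l j = card {i \<in> {1..d}. j \<le> l i}"

definition diagram :: "nat \<Rightarrow> (nat \<Rightarrow> nat) \<Rightarrow> (nat \<times> nat) set" where
  "diagram d l = {(i, j). 1 \<le> i \<and> 1 \<le> j \<and> j \<le> l i \<and> i \<le> conjugate_part d l j}"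

definition hook_length :: "nat \<Rightarrow> (nat \<Rightarrow> nat) \<Rightarrow> nat \<Rightarrow> nat \<Rightarrow> int" where
  "hook_length d l i j = int (l i) + int (conjugate_part d l j) - int i - int j + 1"

definition x_coord :: "nat \<Rightarrow> complex mat \<Rightarrow> int \<Rightarrow> complex" where
  "x_coord d u k = (if k = 0 then 1 else if 1 \<le> k \<and> k \<le> int d then u $$ (0, nat k) else 0)"

(* In the next two determinants the 1-based row and column indices are Suc i and Suc j; only in the
   term of the conjugate partition does the shift not cancel. *)
definition schur :: "nat \<Rightarrow> nat \<Rightarrow> (nat \<Rightarrow> nat) \<Rightarrow> complex mat \<Rightarrow> complex" where
  "schur d c l u = det (mat c c (\<lambda>(i, j).
     x_coord d u (int (conjugate_part d l (Suc i)) + int j - int i)))"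

definition q_fun :: "nat \<Rightarrow> nat \<Rightarrow> complex mat \<Rightarrow> complex" where
  "q_fun d n u = (- 1) ^ (d + 1) * det (mat n n (\<lambda>(i, j). x_coord d u (int i - int j + 1)))"

end

theory Submission
  imports Defs
begin

text \<open>
  A unipotent Toeplitz matrix \<open>u\<close> is a polynomial \<open>p\<close> modulo \<open>X^n\<close>. Vanishing of entries of \<open>u\<close> and of its
  inverse on the Bruhat cell shows that for \<open>u\<close> in \<open>V\<close> one has \<open>p r = 1 + \<kappa> X^n\<close> with \<open>degree p \<le> d\<close> and
  \<open>degree r \<le> c\<close>; so \<open>p\<close> is \<open>1\<close> or a product over \<open>d\<close> distinct roots of \<open>1 + \<kappa> X^n\<close>. Conversely, for
  \<open>\<kappa> \<noteq> 0\<close> an explicit block factorisation puts \<open>u\<close> into the cell.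

  The elementary symmetric functions of \<open>t \<zeta>^I\<close> are sine analogues of binomial coefficients. The Jacobi--Trudi
  determinant in them reduces to a Vandermonde determinant, which gives the hook formula, and the Toeplitz
  matrix is a product of nonnegative bidiagonal matrices, hence totally nonnegative.

  The functions \<open>s_\<lambda>\<close> are the maximal minors of the top \<open>c\<close> rows of \<open>u\<close>. If they are nonnegative, so is
  \<open>x_d h_c = (- 1)^c \<kappa>\<close>, which determines \<open>t \<ge> 0\<close>. If \<open>t > 0\<close> and \<open>p\<close> were different from the
  polynomial of \<open>u_pos d n t\<close>, then a weighted Gram determinant of the top \<open>c\<close> rows of the two matrices would
  vanish; but by Cauchy--Binet it is a sum of nonnegative terms, the first of which is positive.
\<close>

section \<open>Minors and the Cauchy--Binet formula\<close>

text \<open>The roots of \<open>p\<close> are in general complex, so splitting \<open>p\<close> into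
  linear factors gives no nonnegative matrices. The bidiagonal factors used for total nonnegativity
  therefore have entries that vary along the superdiagonal, and the size \<open>n\<close> enters
  their construction through sin (n * \<theta>) = 0.

  The uniqueness argument is an orthogonality. For a fixed nonzero \<kappa>, different choices of
  \<open>d\<close> among the \<open>n\<close> roots give orthogonal vectors of maximal minors, while
  a vector with positive entries is never orthogonal to a nonzero nonnegative one. The weights
  compensate for roots whose modulus is not 1.

  From the closure only vanishing conditions are extracted: polynomials that vanish on the cell,
  namely entries of the matrix and of its adjugate. They already give p r = 1 + \<kappa> X^n.
  Membership of \<open>u_pos d n t\<close> is proved by the block factorisation, except at t = 0,
  where \<kappa> = 0 and the factorisation breaks down; there a limit of nonzero parameters is
  taken.\<close>

lemma pick_strict_mono_image:
  assumes "strict_mono_on {..<k} g" "j < k"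
  shows "pick (g ` {..<k}) j = g j"
proof -
  have inj: "inj_on g {..<k}"
    using assms(1) by (rule strict_mono_on_imp_inj_on)
  have "g i < g j \<longleftrightarrow> i < j" if "i < k" for i
    using strict_mono_on_less[OF assms(1)] that assms(2) by auto
  then have "{a \<in> g ` {..<k}. a < g j} = g ` {i\<in>{..<k}. i < j}"
    by blast
  moreover have "{i\<in>{..<k}. i < j} = {..<j}" using assms(2) by auto
  ultimately have "{a \<in> g ` {..<k}. a < g j} = g ` {..<j}" by simp
  moreover have "card (g ` {..<j}) = j"
    using card_image[OF inj_on_subset[OF inj, of "{..<j}"]] assms(2) by simp
  moreover have "g j \<in> g ` {..<k}" using assms(2) by auto
  ultimately show ?thesis
    using pick_card_in_set[of "g j" "g ` {..<k}"] by simp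
qed

lemma pick_strict_mono_on: "strict_mono_on {..<card K} (pick K)"
  by (auto simp: strict_mono_on_def intro: pick_mono_le)

lemma pick_image: assumes "finite K" shows "pick K ` {..<card K} = K"
proof (rule card_subset_eq[OF assms])
  show "pick K ` {..<card K} \<subseteq> K" by (auto intro: pick_in_set_le)
  show "card (pick K ` {..<card K}) = card K"
    by (subst card_image) (use pick_strict_mono_on strict_mono_on_imp_inj_on in auto)
qed

text \<open>Multilinearity in the rows expands the left side into a sum over all maps
  \<open>f\<close> from rows to {..<n}. A map that is not injective repeats a row of
  \<open>B\<close>; the injective maps with image \<open>K\<close> are the rearrangements of
  \<open>pick K\<close> and together contribute the product of two minors.\<close>

lemma cauchy_binet:
  fixes a :: "nat \<Rightarrow> nat \<Rightarrow> 'a :: comm_ring_1"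
  shows "det (mat k k (\<lambda>(i,j). \<Sum>m<n. a i m * b m j)) =
    (\<Sum>K | K \<subseteq> {..<n} \<and> card K = k.
       det (mat k k (\<lambda>(i,j). a i (pick K j))) * det (mat k k (\<lambda>(i,j). b (pick K i) j)))"
proof -
  define F where "F = {f. (\<forall>i\<in>{0..<k}. f i \<in> {0..<n}) \<and> (\<forall>i. i \<notin> {0..<k} \<longrightarrow> f i = i)}"
  define B where "B = mat n k (\<lambda>(i,j). b i j)"
  define G where "G f = det (mat\<^sub>r k k (\<lambda>i. a i (f i) \<cdot>\<^sub>v row B (f i)))" for f
  have finF: "finite F" unfolding F_def by (rule finite_bounded_functions) auto
  have B: "B \<in> carrier_mat n k" unfolding B_def by auto
  have eq: "mat k k (\<lambda>(i,j). \<Sum>m<n. a i m * b m j) = mat k n (\<lambda>(i,j). a i j) * B"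
    unfolding B_def
    by (rule eq_matI) (auto simp: scalar_prod_def atLeast0LessThan)
  have "det (mat k k (\<lambda>(i,j). \<Sum>m<n. a i m * b m j)) =
     det (mat\<^sub>r k k (\<lambda> i. finsum_vec TYPE('a) k (\<lambda>m. mat k n (\<lambda>(i,j). a i j) $$ (i,m) \<cdot>\<^sub>v row B m) {0 ..< n}))"
    unfolding eq by (subst mat_mul_finsum_alt[OF _ B, of _ k]) auto
  also have "\<dots> = (\<Sum>f\<in>F. det (mat\<^sub>r k k (\<lambda>i. mat k n (\<lambda>(i,j). a i j) $$ (i,f i) \<cdot>\<^sub>v row B (f i))))"
    unfolding F_def by (rule det_linear_rows_sum) (use B in auto)
  also have "\<dots> = (\<Sum>f\<in>F. G f)"
    unfolding G_def
    by (intro sum.cong refl arg_cong[of _ _ det] eq_rowI) (use B in \<open>auto simp: F_def\<close>)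
  also have "\<dots> = (\<Sum>f\<in>{f\<in>F. inj_on f {0..<k}}. G f)"
  proof (rule sum.mono_neutral_right)
    show "\<forall>f\<in>F - {f \<in> F. inj_on f {0..<k}}. G f = 0"
    proof
      fix f assume f: "f \<in> F - {f \<in> F. inj_on f {0..<k}}"
      then obtain i j where ij: "f i = f j" "i \<noteq> j" "i < k" "j < k"
        unfolding inj_on_def by auto
      have "det (mat\<^sub>r k k (\<lambda>i. row B (f i))) = 0"
        by (rule det_identical_rows[OF _ ij(2-4)]) (use ij in auto)
      thus "G f = 0" unfolding G_def
        by (subst det_rows_mul) (use B in auto)
    qed
  qed (use finF in simp_all)
  also have "\<dots> = (\<Sum>K | K \<subseteq> {..<n} \<and> card K = k. \<Sum>f\<in>{f\<in>{f\<in>F. inj_on f {0..<k}}. f ` {0..<k} = K}. G f)"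
  proof (rule sum.group[symmetric])
    show "finite {f \<in> F. inj_on f {0..<k}}" using finF by simp
    show "finite {K. K \<subseteq> {..<n} \<and> card K = k}" by (rule finite_subset[of _ "Pow {..<n}"]) auto
  qed (auto simp: F_def card_image)
  also have "\<dots> = (\<Sum>K | K \<subseteq> {..<n} \<and> card K = k.
       det (mat k k (\<lambda>(i,j). a i (pick K j))) * det (mat k k (\<lambda>(i,j). b (pick K i) j)))"
  proof (rule sum.cong[OF refl])
    fix K assume "K \<in> {K. K \<subseteq> {..<n} \<and> card K = k}"
    then have K: "K \<subseteq> {..<n}" "card K = k" by auto
    have finK: "finite K" using K(1) finite_subset by blast
    \<comment> \<open>Outside {..<k} the value is \<open>i\<close>, to match the default that
      \<open>F\<close> prescribes there.\<close>
    define h where "h p = (\<lambda>i. if i < k then pick K (p i) else i)" for p :: "nat \<Rightarrow> nat"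
    define S where "S = {f\<in>{f\<in>F. inj_on f {0..<k}}. f ` {0..<k} = K}"
    have pinj: "inj_on (pick K) {..<k}"
      using pick_strict_mono_on[of K] K strict_mono_on_imp_inj_on by auto
    have pim: "pick K ` {..<k} = K" using pick_image[OF finK] K by auto
    have bij: "bij_betw h {p. p permutes {0..<k}} S"
      unfolding bij_betw_def
    proof
      show "inj_on h {p. p permutes {0..<k}}"
      proof (rule inj_onI, rule ext)
        fix p q i assume pq: "p \<in> {p. p permutes {0..<k}}" "q \<in> {p. p permutes {0..<k}}" "h p = h q"
        show "p i = q i"
        proof (cases "i < k")
          case True
          then have "pick K (p i) = pick K (q i)" using fun_cong[OF pq(3), of i] by (simp add: h_def)
          moreover have "p i < k" "q i < k" using True pq permutes_in_image by fastforce+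
          ultimately show ?thesis using pinj by (auto dest: inj_onD)
        next
          case False
          then show ?thesis using pq by (auto simp: permutes_def)
        qed
      qed
      show "h ` {p. p permutes {0..<k}} = S"
      proof
        show "h ` {p. p permutes {0..<k}} \<subseteq> S"
        proof
          fix f assume "f \<in> h ` {p. p permutes {0..<k}}"
          then obtain p where p: "p permutes {0..<k}" "f = h p" by auto
          have lt: "p i < k" if "i < k" for i using that p permutes_in_image by fastforce
          have im: "f ` {0..<k} = pick K ` p ` {0..<k}" unfolding p(2) h_def by (auto simp: image_image)
          also have "p ` {0..<k} = {..<k}" using permutes_image[OF p(1)] by auto
          finally have im: "f ` {0..<k} = K" using pim by simp
          have "inj_on (\<lambda>i. pick K (p i)) {0..<k}"
            using comp_inj_on[of p "{0..<k}" "pick K"] permutes_inj_on[OF p(1)] permutes_image[OF p(1)] pinj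
            by (auto simp: o_def atLeast0LessThan)
          then have "inj_on f {0..<k}" unfolding p(2) h_def inj_on_def by auto
          moreover have "f \<in> F" using im K(1) unfolding F_def p(2) by (auto simp: h_def)
          ultimately show "f \<in> S" using im by (auto simp: S_def)
        qed
        show "S \<subseteq> h ` {p. p permutes {0..<k}}"
        proof
          fix f assume f: "f \<in> S"
          define p where "p i = (if i < k then the_inv_into {..<k} (pick K) (f i) else i)" for i
          have fi: "inj_on f {0..<k}" "f ` {0..<k} = K" using f by (auto simp: S_def)
          have pv: "pick K (p i) = f i \<and> p i < k" if "i < k" for i
          proof -
            have "f i \<in> pick K ` {..<k}" using fi(2) that pim by auto
            from f_the_inv_into_f[OF pinj this] the_inv_into_into[OF pinj this subset_refl]
            show ?thesis using that by (simp add: p_def)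
          qed
          have "inj_on p {0..<k}"
          proof (rule inj_onI)
            fix i j assume ij: "i \<in> {0..<k}" "j \<in> {0..<k}" "p i = p j"
            then have "f i = f j" using pv by (metis atLeastLessThan_iff)
            then show "i = j" using ij fi(1) by (auto dest: inj_onD)
          qed
          then have "p permutes {0..<k}"
            by (rule inj_on_nat_permutes) (use pv in \<open>auto simp: p_def\<close>)
          moreover have "h p = f"
            using f pv by (auto simp: h_def S_def F_def fun_eq_iff)
          ultimately show "f \<in> h ` {p. p permutes {0..<k}}" by auto
        qed
      qed
    qed
    define BK where "BK = mat k k (\<lambda>(i,j). b (pick K i) j)"
    have BK: "BK \<in> carrier_mat k k" by (auto simp: BK_def)
    have "(\<Sum>f\<in>S. G f) = (\<Sum>p | p permutes {0..<k}. G (h p))"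
      by (rule sum.reindex_bij_betw[OF bij, symmetric])
    also have "\<dots> = (\<Sum>p | p permutes {0..<k}. signof p * (\<Prod>i=0..<k. a i (pick K (p i))) * det BK)"
    proof (rule sum.cong[OF refl])
      fix p assume "p \<in> {p. p permutes {0..<k}}"
      then have p: "p permutes {0..<k}" by auto
      have lt: "p i < k" if "i < k" for i using that p permutes_in_image by fastforce
      have ltn: "pick K j < n" if "j < k" for j
        using pim K(1) that by blast
      have "G (h p) = (\<Prod>i=0..<k. a i (h p i)) * det (mat\<^sub>r k k (\<lambda>i. row B (h p i)))"
        unfolding G_def by (rule det_rows_mul) (use B in auto)
      also have "mat\<^sub>r k k (\<lambda>i. row B (h p i)) = mat k k (\<lambda>(i,j). BK $$ (p i, j))"
      proof (rule eq_rowI)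
        fix i assume "i < dim_row (mat k k (\<lambda>(i,j). BK $$ (p i, j)))"
        then have "i < k" by simp
        then show "row (mat\<^sub>r k k (\<lambda>i. row B (h p i))) i = row (mat k k (\<lambda>(i,j). BK $$ (p i, j))) i"
          using lt[of i] ltn[of "p i"] by (intro eq_vecI) (simp_all add: h_def B_def BK_def)
      qed simp_all
      also have "det \<dots> = signof p * det BK"
        by (rule det_permute_rows[OF BK p])
      also have "(\<Prod>i=0..<k. a i (h p i)) = (\<Prod>i=0..<k. a i (pick K (p i)))"
        by (intro prod.cong) (auto simp: h_def)
      finally show "G (h p) = signof p * (\<Prod>i=0..<k. a i (pick K (p i))) * det BK" by simp
    qed
    also have "\<dots> = det (mat k k (\<lambda>(i,j). a i (pick K j))) * det BK"
    proof -
      have "det (mat k k (\<lambda>(i,j). a i (pick K j))) =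
          (\<Sum>p | p permutes {0..<k}. signof p * (\<Prod>i=0..<k. a i (pick K (p i))))"
        by (subst det_def'[of _ k]) (auto intro!: sum.cong prod.cong simp: permutes_in_image)
      then show ?thesis by (simp add: sum_distrib_right)
    qed
    finally show "(\<Sum>f\<in>S. G f) = det (mat k k (\<lambda>(i,j). a i (pick K j))) * det (mat k k (\<lambda>(i,j). b (pick K i) j))"
      by (simp add: BK_def)
  qed
  finally show ?thesis .
qed

text \<open>Increasing index functions replace index sets: they restrict to smaller sizes, which
  suits expansion along the last row or column, and \<open>pick K\<close> from Cauchy-Binet can be
  inserted directly.\<close>

definition minors_nonneg :: "nat \<Rightarrow> complex mat \<Rightarrow> bool" where
  "minors_nonneg n A \<longleftrightarrow> (\<forall>k f g. strict_mono_on {..<k} f \<and> strict_mono_on {..<k} g \<and>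
     f ` {..<k} \<subseteq> {..<n} \<and> g ` {..<k} \<subseteq> {..<n} \<longrightarrow>
     det (mat k k (\<lambda>(i,j). A $$ (f i, g j))) \<in> \<real>\<^sub>\<ge>\<^sub>0)"

lemma totally_nonneg_iff_minors:
  assumes A: "A \<in> carrier_mat n n"
  shows "totally_nonneg n A \<longleftrightarrow> minors_nonneg n A"
proof
  assume t: "totally_nonneg n A"
  show "minors_nonneg n A"
    unfolding minors_nonneg_def
  proof (intro allI impI, elim conjE)
    fix k and f g :: "nat \<Rightarrow> nat"
    assume f: "strict_mono_on {..<k} f" and g: "strict_mono_on {..<k} g"
      and fi: "f ` {..<k} \<subseteq> {..<n}" and gi: "g ` {..<k} \<subseteq> {..<n}"
    have c: "card (f ` {..<k}) = k" "card (g ` {..<k}) = k"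
      using f g strict_mono_on_imp_inj_on[of "{..<k}" f] strict_mono_on_imp_inj_on[of "{..<k}" g] by (simp_all add: card_image)
    have e: "{i. i < dim_row A \<and> i \<in> f ` {..<k}} = f ` {..<k}"
      "{i. i < dim_col A \<and> i \<in> g ` {..<k}} = g ` {..<k}"
      using fi gi A by auto
    have "submatrix A (f ` {..<k}) (g ` {..<k}) = mat k k (\<lambda>(i,j). A $$ (f i, g j))"
      unfolding submatrix_def e c
      by (rule eq_matI) (auto simp: pick_strict_mono_image[OF f] pick_strict_mono_image[OF g])
    then show "det (mat k k (\<lambda>(i,j). A $$ (f i, g j))) \<in> \<real>\<^sub>\<ge>\<^sub>0"
      using t fi gi c unfolding totally_nonneg_def by metis
  qed
next
  assume m: "minors_nonneg n A"
  show "totally_nonneg n A"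
    unfolding totally_nonneg_def
  proof (intro allI impI, elim conjE)
    fix I J assume I: "I \<subseteq> {..<n}" and J: "J \<subseteq> {..<n}" and c: "card I = card J"
    have e: "{i. i < dim_row A \<and> i \<in> I} = I" "{i. i < dim_col A \<and> i \<in> J} = J"
      using A I J by auto
    have fin: "finite I" "finite J" using I J finite_subset by blast+
    have "det (mat (card I) (card I) (\<lambda>(i,j). A $$ (pick I i, pick J j))) \<in> \<real>\<^sub>\<ge>\<^sub>0"
      using m[unfolded minors_nonneg_def, rule_format, of "card I" "pick I" "pick J"]
        pick_strict_mono_on[of I] pick_strict_mono_on[of J] pick_image[of I] pick_image[of J] fin c I J by auto
    then show "det (submatrix A I J) \<in> \<real>\<^sub>\<ge>\<^sub>0"
      unfolding submatrix_def e c by simp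
  qed
qed

lemma sum_nonneg_Reals_I:
  "(\<And>x. x \<in> A \<Longrightarrow> f x \<in> \<real>\<^sub>\<ge>\<^sub>0) \<Longrightarrow> sum f A \<in> \<real>\<^sub>\<ge>\<^sub>0"
  by (induction A rule: infinite_finite_induct) auto

lemma minors_nonneg_mult:
  assumes A: "A \<in> carrier_mat n n" and B: "B \<in> carrier_mat n n"
    and mA: "minors_nonneg n A" and mB: "minors_nonneg n B"
  shows "minors_nonneg n (A * B)"
  unfolding minors_nonneg_def
proof (intro allI impI, elim conjE)
  fix k and f g :: "nat \<Rightarrow> nat"
  assume f: "strict_mono_on {..<k} f" and g: "strict_mono_on {..<k} g"
    and fi: "f ` {..<k} \<subseteq> {..<n}" and gi: "g ` {..<k} \<subseteq> {..<n}"
  have "mat k k (\<lambda>(i,j). (A * B) $$ (f i, g j)) =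
      mat k k (\<lambda>(i,j). \<Sum>m<n. A $$ (f i, m) * B $$ (m, g j))"
  proof (rule eq_matI)
    fix i j assume ij: "i < dim_row (mat k k (\<lambda>(i,j). \<Sum>m<n. A $$ (f i, m) * B $$ (m, g j)))"
      "j < dim_col (mat k k (\<lambda>(i,j). \<Sum>m<n. A $$ (f i, m) * B $$ (m, g j)))"
    then have "f i < n" "g j < n" using fi gi by auto
    then show "mat k k (\<lambda>(i,j). (A * B) $$ (f i, g j)) $$ (i, j) =
      mat k k (\<lambda>(i,j). \<Sum>m<n. A $$ (f i, m) * B $$ (m, g j)) $$ (i, j)"
      using ij A B by (auto simp: scalar_prod_def atLeast0LessThan)
  qed auto
  then have "det (mat k k (\<lambda>(i,j). (A * B) $$ (f i, g j))) =
    (\<Sum>K | K \<subseteq> {..<n} \<and> card K = k.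
       det (mat k k (\<lambda>(i,j). A $$ (f i, pick K j))) * det (mat k k (\<lambda>(i,j). B $$ (pick K i, g j))))"
    using cauchy_binet[where k = k and n = n and a = "\<lambda>i m. A $$ (f i, m)" and b = "\<lambda>m j. B $$ (m, g j)"] by simp
  also have "\<dots> \<in> \<real>\<^sub>\<ge>\<^sub>0"
  proof (rule sum_nonneg_Reals_I)
    fix K assume "K \<in> {K. K \<subseteq> {..<n} \<and> card K = k}"
    then have K: "K \<subseteq> {..<n}" "card K = k" by auto
    then have "strict_mono_on {..<k} (pick K)" "pick K ` {..<k} \<subseteq> {..<n}"
      using pick_strict_mono_on[of K] pick_image[of K] finite_subset[of K] by auto
    then show "det (mat k k (\<lambda>(i,j). A $$ (f i, pick K j))) * det (mat k k (\<lambda>(i,j). B $$ (pick K i, g j))) \<in> \<real>\<^sub>\<ge>\<^sub>0"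
      using mA mB f g fi gi unfolding minors_nonneg_def by (intro nonneg_Reals_mult_I) blast+
  qed
  finally show "det (mat k k (\<lambda>(i,j). (A * B) $$ (f i, g j))) \<in> \<real>\<^sub>\<ge>\<^sub>0" .
qed

section \<open>Total nonnegativity of binomial Toeplitz matrices\<close>

definition bidiag :: "nat \<Rightarrow> (nat \<Rightarrow> complex) \<Rightarrow> complex mat" where
  "bidiag n b = mat n n (\<lambda>(i,j). if i = j then 1 else if j = Suc i then b i else 0)"

lemma mat_delete_last: "mat_delete (mat (Suc k) (Suc k) F) k k = mat k k F"
  by (rule eq_matI) (auto simp: mat_delete_def)

text \<open>In any submatrix the last row (if \<open>g k \<le> f k\<close>) or the last column (if
  \<open>g k > f k\<close>) vanishes except for its corner entry. Hence every minor is a product of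
  entries.\<close>

lemma minors_nonneg_bidiag:
  assumes b: "\<And>i. b i \<in> \<real>\<^sub>\<ge>\<^sub>0"
  shows "minors_nonneg n (bidiag n b)"
proof -
  define E where "E i j = (if i = j then 1 else if j = Suc i then b i else 0)" for i j
  have key: "det (mat k k (\<lambda>(i,j). E (f i) (g j))) \<in> \<real>\<^sub>\<ge>\<^sub>0"
    if "strict_mono_on {..<k} f" "strict_mono_on {..<k} g" for k and f g :: "nat \<Rightarrow> nat"
    using that
  proof (induction k)
    case 0
    then show ?case by simp
  next
    case (Suc k)
    have f: "f i < f k" and g: "g i < g k" if "i < k" for i
      using strict_mono_onD[OF Suc.prems(1), of i k] strict_mono_onD[OF Suc.prems(2), of i k] that by auto
    have IH: "det (mat k k (\<lambda>(i,j). E (f i) (g j))) \<in> \<real>\<^sub>\<ge>\<^sub>0"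
      by (rule Suc.IH) (use Suc.prems in \<open>auto simp: strict_mono_on_def\<close>)
    define A where "A = mat (Suc k) (Suc k) (\<lambda>(i,j). E (f i) (g j))"
    have A: "A \<in> carrier_mat (Suc k) (Suc k)" by (simp add: A_def)
    have cof: "cofactor A k k = det (mat k k (\<lambda>(i,j). E (f i) (g j)))"
      by (simp add: cofactor_def A_def mat_delete_last)
    have row: "det A = E (f k) (g k) * cofactor A k k" if "g k \<le> f k"
    proof -
      have "det A = (\<Sum>j<Suc k. A $$ (k,j) * cofactor A k j)"
        by (rule laplace_expansion_row[OF A]) simp
      moreover have "A $$ (k,j) = 0" if "j < k" for j
        using g[OF that] \<open>g k \<le> f k\<close> that by (auto simp: A_def E_def)
      ultimately show ?thesis by (simp add: A_def)
    qed
    have col: "det A = E (f k) (g k) * cofactor A k k" if "g k > f k"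
    proof -
      have "det A = (\<Sum>i<Suc k. A $$ (i,k) * cofactor A i k)"
        by (rule laplace_expansion_column[OF A]) simp
      moreover have "A $$ (i,k) = 0" if "i < k" for i
        using f[OF that] \<open>g k > f k\<close> that by (auto simp: A_def E_def)
      ultimately show ?thesis by (simp add: A_def)
    qed
    have "det A = E (f k) (g k) * cofactor A k k"
      using row col by (cases "g k \<le> f k") auto
    moreover have "E (f k) (g k) \<in> \<real>\<^sub>\<ge>\<^sub>0" using b by (simp add: E_def)
    ultimately show ?case using IH unfolding A_def[symmetric] cof by simp
  qed
  show ?thesis
    unfolding minors_nonneg_def
  proof (intro allI impI, elim conjE)
    fix k and f g :: "nat \<Rightarrow> nat"
    assume f: "strict_mono_on {..<k} f" and g: "strict_mono_on {..<k} g"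
      and fi: "f ` {..<k} \<subseteq> {..<n}" and gi: "g ` {..<k} \<subseteq> {..<n}"
    have "mat k k (\<lambda>(i,j). bidiag n b $$ (f i, g j)) = mat k k (\<lambda>(i,j). E (f i) (g j))"
    proof (rule eq_matI)
      fix i j assume ij: "i < dim_row (mat k k (\<lambda>(i,j). E (f i) (g j)))"
        "j < dim_col (mat k k (\<lambda>(i,j). E (f i) (g j)))"
      then have "f i < n" "g j < n" using fi gi by auto
      then show "mat k k (\<lambda>(i,j). bidiag n b $$ (f i, g j)) $$ (i,j) = mat k k (\<lambda>(i,j). E (f i) (g j)) $$ (i,j)"
        using ij by (simp add: bidiag_def E_def)
    qed auto
    then show "det (mat k k (\<lambda>(i,j). bidiag n b $$ (f i, g j))) \<in> \<real>\<^sub>\<ge>\<^sub>0"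
      using key[OF f g] by simp
  qed
qed

text \<open>The symmetric Gaussian binomial coefficient at q = exp (2 i \<theta>): each integer m
  becomes sin (m * \<theta>), the common denominators sin \<theta> cancelling. The subtraction is
  real, so for \<open>j > k\<close> the factor at \<open>s = k\<close> is zero.\<close>

definition sin_binomial :: "real \<Rightarrow> nat \<Rightarrow> nat \<Rightarrow> real" where
  "sin_binomial \<theta> k j = (\<Prod>s<j. sin ((real k - real s) * \<theta>) / sin ((real s + 1) * \<theta>))"

lemma sin_binomial_0 [simp]: "sin_binomial \<theta> k 0 = 1"
  by (simp add: sin_binomial_def)

lemma sin_binomial_Suc:
  "sin_binomial \<theta> k (Suc j) = sin_binomial \<theta> k j * (sin ((real k - real j) * \<theta>) / sin ((real j + 1) * \<theta>))"
  by (simp add: sin_binomial_def)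

lemma sin_binomial_eq_0: "k < j \<Longrightarrow> sin_binomial \<theta> k j = 0"
  unfolding sin_binomial_def by (rule prod_zero) (auto intro: bexI[of _ k])

text \<open>Analogue of (k + 1 - j) C(k + 1, j) = (k + 1) C(k, j). Passing from \<open>j\<close> to
  \<open>j + 1\<close> multiplies both sides by the same quotient, so no denominator has to be
  nonzero.\<close>

lemma sin_binomial_absorb_comp:
  "sin ((real (Suc k) - real j) * \<theta>) * sin_binomial \<theta> (Suc k) j = sin (real (Suc k) * \<theta>) * sin_binomial \<theta> k j"
proof (induction j)
  case (Suc j)
  have e: "real (Suc k) - real (Suc j) = real k - real j" by simp
  show ?case
    unfolding sin_binomial_Suc e using Suc.IH by (simp add: mult_ac)
qed simp

lemma sin_binomial_absorb:
  "sin ((real j + 1) * \<theta>) \<noteq> 0 \<Longrightarrow>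
   sin ((real j + 1) * \<theta>) * sin_binomial \<theta> (Suc k) (Suc j) = sin (real (Suc k) * \<theta>) * sin_binomial \<theta> k j"
  unfolding sin_binomial_Suc using sin_binomial_absorb_comp[of k j \<theta>] by (simp add: mult_ac)

text \<open>Sine form of (a - j)(b + j) + j(b + j - a) = a b. It plays the part of Pascal's rule in
  the bidiagonal factorisation.\<close>

lemma sin_product_identity:
  fixes a b j \<theta> :: real
  shows "sin ((a - j) * \<theta>) * sin ((b + j) * \<theta>) + sin (j * \<theta>) * sin ((b + j - a) * \<theta>)
     = sin (a * \<theta>) * sin (b * \<theta>)"
proof -
  have *: "sin x * sin y = (cos (x - y) - cos (x + y)) / 2" for x y :: real
    by (simp add: cos_diff cos_add)
  have 1: "cos ((a - j) * \<theta> - (b + j) * \<theta>) = cos (j * \<theta> + (b + j - a) * \<theta>)"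
    by (subst cos_minus[symmetric]) (simp add: algebra_simps)
  have 2: "(a - j) * \<theta> + (b + j) * \<theta> = a * \<theta> + b * \<theta>"
    "j * \<theta> - (b + j - a) * \<theta> = a * \<theta> - b * \<theta>"
    by (simp_all add: algebra_simps)
  show ?thesis unfolding * 1 2 by (simp add: field_simps)
qed

lemma sin_pi_frac_pos: assumes "0 < x" "x < real n" shows "0 < sin (x * (pi / real n))"
proof (rule sin_gt_zero)
  show "0 < x * (pi / real n)" using assms by simp
  have "x * (pi / real n) < real n * (pi / real n)"
    by (rule mult_strict_right_mono) (use assms in auto)
  then show "x * (pi / real n) < pi" using assms by simp
qed

context
  fixes d c n :: nat and \<theta> :: real
  assumes d: "1 \<le> d" and c: "1 \<le> c" and n: "n = d + c" and \<theta>: "\<theta> = pi / real n"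
begin

private abbreviation (input) S :: "real \<Rightarrow> real" where "S x \<equiv> sin (x * \<theta>)"

private lemma S_pos: "0 < x \<Longrightarrow> x < real n \<Longrightarrow> 0 < S x"
  unfolding \<theta> by (rule sin_pi_frac_pos)

private lemma S_n: "S (real n) = 0"
  using d by (simp add: \<theta> n)

text \<open>
  The Toeplitz matrix of \<open>sin_binomial \<theta> d\<close> is the product \<open>L 1 * \<dots> * L d\<close> of the bidiagonal matrices with
  superdiagonals \<open>factor k\<close>, and \<open>prefix k\<close> gives the entries of \<open>L 1 * \<dots> * L k\<close>.
\<close>

private definition prefix :: "nat \<Rightarrow> nat \<Rightarrow> nat \<Rightarrow> real" where
  "prefix k i m =
    (if m < i then 0
     else if k + c < m + 1 then (if i = m then 1 else 0)
     else if m + 1 \<le> k then sin_binomial \<theta> d (m - i)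
     else sin_binomial \<theta> k (m - i) * (\<Prod>s<d - k. S (real m + 1 + real s) / S (real i + 1 + real s)))"

text \<open>The window leaves \<open>c\<close> nonzero entries in each of the \<open>d\<close>
  factors, hence \<open>d * c\<close> in all, which is the length of the permutation of the cell.
  Inside the window both sine arguments lie strictly between 0 and \<pi>.\<close>

private definition factor :: "nat \<Rightarrow> nat \<Rightarrow> real" where
  "factor k i = (if k \<le> i + 1 \<and> i + 1 < k + c
     then S (real i + 2 + real d - 2 * real k) / S (real i + 1) else 0)"

private lemma prefix_diag: "k \<le> d \<Longrightarrow> prefix k i i = 1"
proof -
  assume k: "k \<le> d"
  have "(\<Prod>s<d - k. S (real i + 1 + real s) / S (real i + 1 + real s)) = 1" if "\<not> k + c < i + 1"
  proof (rule prod.neutral, rule ballI)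
    fix s assume "s \<in> {..<d - k}"
    then have "real i + 1 + real s < real n" using that k n by (simp add: of_nat_less_iff[symmetric] del: of_nat_less_iff)
    then have "S (real i + 1 + real s) > 0" by (intro S_pos) auto
    then show "S (real i + 1 + real s) / S (real i + 1 + real s) = 1" by simp
  qed
  then show ?thesis by (simp add: prefix_def)
qed

text \<open>Makes the formula for a column in progress agree with that for a finished column at the
  border \<open>m = k\<close> of the cases in \<open>prefix\<close>.\<close>

private lemma sin_binomial_extend:
  "i \<le> m \<Longrightarrow> m + e \<le> d \<Longrightarrow>
   sin_binomial \<theta> (m + e) (m - i) = sin_binomial \<theta> m (m - i) * (\<Prod>s<e. S (real m + 1 + real s) / S (real i + 1 + real s))"
proof (induction e)
  case (Suc e)
  have "S (real i + 1 + real e) > 0"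
    by (rule S_pos) (use Suc.prems n c in auto)
  moreover have "S (real i + 1 + real e) * sin_binomial \<theta> (Suc (m + e)) (m - i)
      = S (real m + 1 + real e) * sin_binomial \<theta> (m + e) (m - i)"
    using sin_binomial_absorb_comp[of "m + e" "m - i" \<theta>] Suc.prems by (simp add: algebra_simps of_nat_diff)
  ultimately show ?case using Suc by (simp add: field_simps)
qed simp

text \<open>Right multiplication by a bidiagonal matrix changes column \<open>m\<close> only by a
  multiple of column \<open>m - 1\<close>. The three cases are columns not yet reached, columns
  already finished, and columns in the window of the new factor; only the last needs the sine
  identity.\<close>

private lemma prefix_rec:
  assumes k: "Suc k \<le> d" and i: "i < m" and m: "m < n"
  shows "prefix (Suc k) i m = prefix k i m + prefix k i (m - 1) * factor (Suc k) (m - 1)"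
proof -
  consider "Suc k + c < m + 1" | "m + 1 \<le> Suc k" | "Suc k \<le> m" "m \<le> k + c"
    using k by linarith
  then show ?thesis
  proof cases
    case 1
    then show ?thesis using i by (auto simp: prefix_def factor_def)
  next
    case 2
    have f: "factor (Suc k) (m - 1) = 0" using 2 i by (auto simp: factor_def)
    have "prefix k i m = sin_binomial \<theta> d (m - i)"
    proof (cases "m + 1 \<le> k")
      case True
      then show ?thesis using i by (simp add: prefix_def)
    next
      case False
      then have "m = k" using 2 by simp
      then show ?thesis using i c k sin_binomial_extend[of i m "d - k"] by (simp add: prefix_def)
    qed
    then show ?thesis unfolding f using 2 i by (simp add: prefix_def)
  next
    case 3
    define e where "e = d - Suc k"
    have e: "d = Suc k + e" "d - k = Suc e" using k by (auto simp: e_def)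
    define Q where "Q = (\<Prod>s<e. S (real m + 1 + real s) / S (real i + 1 + real s))"
    define j where "j = m - Suc i"
    have j: "m - i = Suc j" "m - 1 - i = j" "m = i + j + 1" using i by (auto simp: j_def)
    have D: "S (real i + 1 + real e) > 0"
      by (rule S_pos) (use 3 i n e in \<open>auto simp flip: of_nat_add of_nat_Suc\<close>)
    have Sm: "S (real m) > 0" using i m by (intro S_pos) auto
    have Sk: "S (real k + 1) > 0" by (rule S_pos) (use k n c in auto)
    have Sj: "S (real j + 1) > 0" by (rule S_pos) (use j m in auto)
    have p1: "prefix (Suc k) i m = sin_binomial \<theta> (Suc k) (Suc j) * Q"
      using 3 i by (simp add: prefix_def j(1) Q_def e_def)
    have p2: "prefix k i m = sin_binomial \<theta> k (Suc j) * Q * (S (real m + 1 + real e) / S (real i + 1 + real e))"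
    proof (cases "m + 1 \<le> k + c")
      case True
      then show ?thesis using 3 i by (simp add: prefix_def j(1) Q_def e(2))
    \<comment> \<open>Here \<open>m = k + c\<close>, a column that is still that of the identity
      matrix. The general formula gives the same value 0, because its last sine is sin (n *
      \<theta>).\<close>
    next
      case False
      then have "m + 1 + e = n" using 3 e n by simp
      then have "real m + 1 + real e = real n" by linarith
      then have "S (real m + 1 + real e) = 0" using S_n by simp
      then show ?thesis using False i by (simp add: prefix_def)
    qed
    have p3: "prefix k i (m - 1) = sin_binomial \<theta> k j * (S (real m) * Q / S (real i + 1 + real e))"
    proof -
      have "(\<Prod>s<Suc e. S (real m + real s) / S (real i + 1 + real s)) =
          (\<Prod>s<Suc e. S (real m + real s)) / ((\<Prod>s<e. S (real i + 1 + real s)) * S (real i + 1 + real e))"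
        by (simp add: prod_dividef)
      also have "(\<Prod>s<Suc e. S (real m + real s)) = S (real m) * (\<Prod>s<e. S (real m + 1 + real s))"
        by (subst prod.lessThan_Suc_shift) (simp add: algebra_simps)
      also have "\<dots> / ((\<Prod>s<e. S (real i + 1 + real s)) * S (real i + 1 + real e)) = S (real m) * Q / S (real i + 1 + real e)"
        by (simp add: Q_def prod_dividef)
      finally have "(\<Prod>s<Suc e. S (real m + real s) / S (real i + 1 + real s)) = S (real m) * Q / S (real i + 1 + real e)" .
      moreover have "real (m - 1) + 1 = real m" using i by (simp add: of_nat_diff)
      moreover have "\<not> m - 1 < i" "\<not> k + c < m - 1 + 1" "\<not> m - 1 + 1 \<le> k" using 3 i by auto
      ultimately show ?thesis unfolding prefix_def j(2) e(2) by (simp del: prod.lessThan_Suc)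
    qed
    have p4: "factor (Suc k) (m - 1) = S (real m + real e - real k) / S (real m)"
    proof -
      have "real (m - 1) + 2 + real d - 2 * real (Suc k) = real m + real e - real k" "real (m - 1) + 1 = real m"
        using i e(1) by (simp_all add: of_nat_diff)
      moreover have "Suc k \<le> m - 1 + 1" "m - 1 + 1 < Suc k + c" using 3 by auto
      ultimately show ?thesis unfolding factor_def by (simp only: if_True simp_thms)
    qed
    \<comment> \<open>The factor \<open>S (real k + 1)\<close> turns both binomials on the right
      into multiples of \<open>sin_binomial \<theta> (Suc k) (Suc j)\<close>, and what remains is
      \<open>sin_product_identity\<close>.\<close>
    have "S (real k + 1) * (sin_binomial \<theta> (Suc k) (Suc j) * S (real i + 1 + real e)) =
      S (real k + 1) * (sin_binomial \<theta> k (Suc j) * S (real m + 1 + real e) + sin_binomial \<theta> k j * S (real m + real e - real k))"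
    proof -
      have a1: "S (real k + 1) * sin_binomial \<theta> k (Suc j) = S (real k - real j) * sin_binomial \<theta> (Suc k) (Suc j)"
        using sin_binomial_absorb_comp[of k "Suc j" \<theta>] by (simp add: algebra_simps)
      have a2: "S (real k + 1) * sin_binomial \<theta> k j = S (real j + 1) * sin_binomial \<theta> (Suc k) (Suc j)"
        using sin_binomial_absorb[of j \<theta> k] Sj by (simp add: algebra_simps)
      have "S (real k + 1) * S (real i + 1 + real e) =
         S (real k - real j) * S (real m + 1 + real e) + S (real j + 1) * S (real m + real e - real k)"
        using sin_product_identity[of "real k + 1" "real j + 1" \<theta> "real i + 1 + real e"]
        by (simp add: j(3) algebra_simps)
      moreover have "x * (s * y) = x * (p * b + q * e)"
        if "x * y = a * b + c * e" "x * p = a * s" "x * q = c * s" for x y a b c e p q s :: real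
      proof -
        have "x * (s * y) = s * (x * y)" by simp
        also have "\<dots> = (a * s) * b + (c * s) * e" using that(1) by (simp add: algebra_simps)
        also have "\<dots> = x * (p * b + q * e)" using that(2,3) by (simp add: algebra_simps)
        finally show ?thesis .
      qed
      ultimately show ?thesis using a1 a2 by blast
    qed
    then have "sin_binomial \<theta> (Suc k) (Suc j) * S (real i + 1 + real e) =
      sin_binomial \<theta> k (Suc j) * S (real m + 1 + real e) + sin_binomial \<theta> k j * S (real m + real e - real k)"
      using Sk by simp
    then have "sin_binomial \<theta> (Suc k) (Suc j) =
      (sin_binomial \<theta> k (Suc j) * S (real m + 1 + real e) + sin_binomial \<theta> k j * S (real m + real e - real k)) / S (real i + 1 + real e)"
      using D by (simp add: field_simps)
    then show ?thesis unfolding p1 p2 p3 p4 using Sm D by (simp add: field_simps)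
  qed
qed

private lemma factor_nonneg: "k \<le> d \<Longrightarrow> 1 \<le> k \<Longrightarrow> 0 \<le> factor k i"
proof -
  assume k: "k \<le> d" "1 \<le> k"
  have "0 < S (real i + 2 + real d - 2 * real k) \<and> 0 < S (real i + 1)" if "k \<le> i + 1" "i + 1 < k + c"
    using that k n by (auto intro!: S_pos)
  then show ?thesis by (auto simp: factor_def)
qed

text \<open>For nonzero \<open>t\<close> the powers of \<open>t\<close> come from conjugation by a
  diagonal matrix, which only multiplies the superdiagonals of the factors by \<open>t\<close>.
  Written out in entries, the induction step is also valid at t = 0.\<close>

private lemma prefix_minors_nonneg:
  assumes "0 \<le> t" "k \<le> d"
  shows "minors_nonneg n (mat n n (\<lambda>(i,m). complex_of_real (t ^ (m - i) * prefix k i m)))"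
  using assms(2)
proof (induction k)
  case 0
  have "mat n n (\<lambda>(i,m). complex_of_real (t ^ (m - i) * prefix 0 i m)) = bidiag n (\<lambda>_. 0)"
  proof (rule eq_matI)
    fix i m assume "i < dim_row (bidiag n (\<lambda>_. 0))" "m < dim_col (bidiag n (\<lambda>_. 0))"
    moreover have "prefix 0 i i = 1" by (rule prefix_diag) simp
    moreover have "prefix 0 i m = 0" if "i \<noteq> m"
      using that by (auto simp: prefix_def sin_binomial_eq_0)
    ultimately show "mat n n (\<lambda>(i,m). complex_of_real (t ^ (m - i) * prefix 0 i m)) $$ (i,m) = bidiag n (\<lambda>_. 0) $$ (i,m)"
      by (auto simp: bidiag_def)
  qed (auto simp: bidiag_def)
  then show ?case using minors_nonneg_bidiag[of "\<lambda>_. 0" n] by simp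
next
  case (Suc k)
  define M where "M k = mat n n (\<lambda>(i,m). complex_of_real (t ^ (m - i) * prefix k i m))" for k
  define L where "L = bidiag n (\<lambda>i. complex_of_real (t * factor (Suc k) i))"
  have "M (Suc k) = M k * L"
  proof (rule eq_matI)
    fix i m assume "i < dim_row (M k * L)" "m < dim_col (M k * L)"
    then have im: "i < n" "m < n" by (auto simp: M_def L_def bidiag_def)
    have "(M k * L) $$ (i,m) = (\<Sum>l<n. M k $$ (i,l) * L $$ (l,m))"
      using im by (auto simp: M_def L_def bidiag_def scalar_prod_def atLeast0LessThan)
    also have "\<dots> = (\<Sum>l<n. (if l = m then M k $$ (i,m) else 0) +
        (if l = m - 1 then if m = 0 then 0 else M k $$ (i,m - 1) * of_real (t * factor (Suc k) (m - 1)) else 0))"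
      by (rule sum.cong) (use im in \<open>auto simp: L_def bidiag_def\<close>)
    also have "\<dots> = M k $$ (i,m) + (if m = 0 then 0 else M k $$ (i,m - 1) * of_real (t * factor (Suc k) (m - 1)))"
      unfolding sum.distrib using im by simp
    also have "\<dots> = M (Suc k) $$ (i,m)"
    proof (cases "i < m")
      case True
      then have "m - i = Suc (m - 1 - i)" by simp
      then show ?thesis
        using im prefix_rec[OF Suc.prems True im(2)] True by (simp add: M_def algebra_simps)
    next
      case False
      then have z: "m = 0 \<or> prefix k i (m - 1) = 0" by (auto simp: prefix_def)
      show ?thesis
      proof (cases "m = i")
        case True
        then show ?thesis using im z Suc.prems prefix_diag[of k i] prefix_diag[of "Suc k" i]
          by (auto simp: M_def)
      next
        case neq: False
        then have "prefix k i m = 0" "prefix (Suc k) i m = 0" using False by (auto simp: prefix_def)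
        then show ?thesis using im z by (auto simp: M_def)
      qed
    qed
    finally show "M (Suc k) $$ (i,m) = (M k * L) $$ (i,m)" by simp
  qed (auto simp: M_def L_def bidiag_def)
  moreover have "minors_nonneg n (M k)" using Suc unfolding M_def by simp
  moreover have "minors_nonneg n L"
    unfolding L_def
    by (rule minors_nonneg_bidiag) (use assms factor_nonneg[of "Suc k"] Suc.prems in simp)
  ultimately have "minors_nonneg n (M (Suc k))"
    using minors_nonneg_mult[of "M k" n L] by (simp add: M_def L_def bidiag_def)
  then show ?case by (simp add: M_def)
qed

lemma sin_binomial_toeplitz_minors_nonneg:
  assumes "0 \<le> t"
  shows "minors_nonneg n (mat n n (\<lambda>(i,m). if i \<le> m then complex_of_real (t ^ (m - i) * sin_binomial \<theta> d (m - i)) else 0))"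
proof -
  have "mat n n (\<lambda>(i,m). if i \<le> m then complex_of_real (t ^ (m - i) * sin_binomial \<theta> d (m - i)) else 0)
     = mat n n (\<lambda>(i,m). complex_of_real (t ^ (m - i) * prefix d i m))"
    by (rule eq_matI) (auto simp: prefix_def n)
  then show ?thesis using prefix_minors_nonneg[OF assms, of d] by simp
qed

end

section \<open>Longest elements of maximal parabolic subgroups\<close>

definition inversions :: "nat \<Rightarrow> (nat \<Rightarrow> nat) \<Rightarrow> (nat \<times> nat) set" where
  "inversions n w = {(i,j). i \<in> {1..n} \<and> j \<in> {1..n} \<and> i < j \<and> w j < w i}"

text \<open>Stabiliser of the first block, to be identified with the parabolic subgroup generated by
  the adjacent transpositions other than the \<open>d\<close>-th. That the second block is preserved
  follows by counting.\<close>

definition block_perm :: "nat \<Rightarrow> nat \<Rightarrow> (nat \<Rightarrow> nat) \<Rightarrow> bool" where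
  "block_perm d n w \<longleftrightarrow> w permutes {1..n} \<and> (\<forall>i\<in>{1..d}. w i \<in> {1..d})"

definition block_reversal :: "nat \<Rightarrow> nat \<Rightarrow> nat \<Rightarrow> nat" where
  "block_reversal d n i = (if i \<in> {1..d} then d + 1 - i else if i \<in> {d<..n} then n + d + 1 - i else i)"

lemma finite_inversions [simp]: "finite (inversions n w)"
  by (rule finite_subset[of _ "{1..n} \<times> {1..n}"]) (auto simp: inversions_def)

lemma adj_transp_apply: "adj_transp k x = (if x = k then Suc k else if x = Suc k then k else x)"
  by (simp add: adj_transp_def transpose_def)

lemma adj_transp_involutory [simp]: "adj_transp k (adj_transp k x) = x"
  by (simp add: adj_transp_apply)

lemma adj_transp_comp: "adj_transp k \<circ> adj_transp k = id"
  by (simp add: fun_eq_iff)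

lemma adj_transp_permutes: "k \<in> {1..n - 1} \<Longrightarrow> adj_transp k permutes {1..n}"
  unfolding adj_transp_def by (rule permutes_swap_id) auto

lemma word_perm_Nil [simp]: "word_perm [] = id"
  by (simp add: word_perm_def)

lemma word_perm_Cons [simp]: "word_perm (k # ks) = adj_transp k \<circ> word_perm ks"
  by (simp add: word_perm_def)

lemma inj_word_perm: "inj (word_perm ks)"
proof (induction ks)
  case (Cons k ks)
  have "inj (adj_transp k)" by (rule inj_on_inverseI) (rule adj_transp_involutory)
  then show ?case using Cons by (simp only: word_perm_Cons inj_compose)
qed (simp add: inj_on_id)

text \<open>A further adjacent transposition on the left swaps the values \<open>k\<close> and
  \<open>k + 1\<close>, so the only pair that can become inverted is the pair of positions
  \<open>(a, b)\<close> of these two values.\<close>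

lemma card_inversions_word_perm: "card (inversions n (word_perm ks)) \<le> length ks"
proof (induction ks)
  case Nil
  have "inversions n (word_perm []) = {}" by (auto simp: inversions_def)
  then show ?case by (simp only: card.empty le0)
next
  case (Cons k ks)
  define w where "w = word_perm ks"
  have inj: "inj w" by (simp add: w_def inj_word_perm)
  define a b where "a = (THE i. w i = k)" and "b = (THE i. w i = Suc k)"
  have a: "i = a" if "w i = k" for i
    unfolding a_def using that inj by (intro the_equality[symmetric]) (auto simp: inj_def)
  have b: "i = b" if "w i = Suc k" for i
    unfolding b_def using that inj by (intro the_equality[symmetric]) (auto simp: inj_def)
  have "inversions n (adj_transp k \<circ> w) \<subseteq> insert (a, b) (inversions n w)"
  proof (clarsimp simp: inversions_def)
    fix i j assume ij: "i < j" "adj_transp k (w j) < adj_transp k (w i)" and ne: "i = a \<longrightarrow> j \<noteq> b"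
    have "w i \<noteq> w j" using ij(1) inj by (auto dest: injD)
    then show "w j < w i" using ij(2) ne a[of i] b[of j]
      by (auto simp: adj_transp_apply split: if_splits)
  qed
  then have "card (inversions n (adj_transp k \<circ> w)) \<le> card (insert (a, b) (inversions n w))"
    by (intro card_mono) auto
  also have "\<dots> \<le> Suc (card (inversions n w))" by (rule card_insert_le_m1) auto
  also have "\<dots> \<le> length (k # ks)" using Cons by (simp add: w_def)
  finally show ?case by (simp only: word_perm_Cons w_def)
qed

lemma strict_mono_on_endo_eq:
  fixes f :: "nat \<Rightarrow> nat"
  assumes mono: "\<And>i j. i \<in> {1..m} \<Longrightarrow> j \<in> {1..m} \<Longrightarrow> i < j \<Longrightarrow> f i < f j"
    and range: "\<And>i. i \<in> {1..m} \<Longrightarrow> f i \<in> {1..m}" and i: "i \<in> {1..m}"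
  shows "f i = i"
proof (rule antisym)
  have "j \<in> {1..m} \<Longrightarrow> j \<le> f j" for j
  proof (induction j)
    case (Suc j)
    show ?case
    proof (cases "j = 0")
      case True
      then show ?thesis using range[of "Suc j"] Suc.prems by simp
    next
      case False
      then have "j \<le> f j" using Suc by simp
      also have "f j < f (Suc j)" using False Suc.prems by (intro mono) auto
      finally show ?thesis by simp
    qed
  qed simp
  then show "i \<le> f i" using i by simp
  have "e < m \<Longrightarrow> f (m - e) \<le> m - e" for e
  proof (induction e)
    case 0
    then show ?case using range[of m] by simp
  next
    case (Suc e)
    have "f (m - Suc e) < f (m - e)" using Suc.prems by (intro mono) auto
    then show ?case using Suc by simp
  qed
  from this[of "m - i"] show "f i \<le> i" using i by simp
qed

context
  fixes d n :: nat
  assumes d: "1 \<le> d" "d < n"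
begin

private definition K :: "nat set" where "K = {1..n - 1} - {d}"

private lemma K_iff: "k \<in> K \<longleftrightarrow> 1 \<le> k \<and> k \<le> n - 1 \<and> k \<noteq> d"
  by (auto simp: K_def)

lemma block_perm_upper:
  assumes w: "block_perm d n w" and i: "i \<in> {d<..n}"
  shows "w i \<in> {d<..n}"
proof -
  have p: "w permutes {1..n}" using w by (simp add: block_perm_def)
  have "w ` {1..d} = {1..d}"
  proof (rule card_subset_eq)
    show "card (w ` {1..d}) = card {1..d}"
      by (rule card_image) (rule permutes_inj_on[OF p])
  qed (use w in \<open>auto simp: block_perm_def\<close>)
  then have "w i \<notin> {1..d}"
    using i permutes_inj[OF p] by (metis atLeastAtMost_iff greaterThanAtMost_iff image_iff injD leD)
  moreover have "w i \<in> {1..n}" using permutes_in_image[OF p, of i] i by auto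
  ultimately show ?thesis by auto
qed

private lemma block_perm_adj_transp: "k \<in> K \<Longrightarrow> block_perm d n (adj_transp k)"
  using adj_transp_permutes[of k n] d by (auto simp: block_perm_def adj_transp_apply K_iff)

lemma block_perm_comp: "block_perm d n v \<Longrightarrow> block_perm d n w \<Longrightarrow> block_perm d n (v \<circ> w)"
  by (auto simp: block_perm_def intro: permutes_compose)

text \<open>\<open>k\<close> is a descent of the inverse of \<open>w\<close>. The inverse respects
  both blocks, which excludes \<open>k = d\<close>; swapping the values \<open>k\<close> and
  \<open>k + 1\<close> then destroys one inversion and creates none.\<close>

private lemma block_perm_descent:
  assumes w: "block_perm d n w" and ne: "inversions n w \<noteq> {}"
  obtains k where "k \<in> K" "card (inversions n (adj_transp k \<circ> w)) < card (inversions n w)"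
proof -
  have p: "w permutes {1..n}" using w by (simp add: block_perm_def)
  define v where "v = Hilbert_Choice.inv w"
  have vw: "v (w i) = i" "w (v i) = i" for i
    using permutes_inverses[OF p] by (auto simp: v_def)
  have vp: "v permutes {1..n}" using permutes_inv[OF p] by (simp add: v_def)
  have "\<exists>k\<in>{1..n - 1}. v (Suc k) < v k"
  proof (rule ccontr)
    assume "\<not> ?thesis"
    then have v_Suc: "v k \<le> v (Suc k)" if "1 \<le> k" "k < n" for k using that by force
    have le: "v i \<le> v (i + e)" if "1 \<le> i" "i + e \<le> n" for i e
      using that
    proof (induction e)
      case (Suc e)
      then show ?case using v_Suc[of "i + e"] by simp
    qed simp
    from ne obtain i j where ij: "i \<in> {1..n}" "j \<in> {1..n}" "i < j" "w j < w i"
      by (auto simp: inversions_def)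
    moreover have "1 \<le> w j" "w i \<le> n"
      using ij permutes_in_image[OF p, of i] permutes_in_image[OF p, of j] by auto
    ultimately have "v (w j) \<le> v (w i)"
      using le[of "w j" "w i - w j"] by simp
    then show False using ij by (simp add: vw)
  qed
  then obtain k where k: "k \<in> {1..n - 1}" "v (Suc k) < v k" by blast
  have "k \<noteq> d"
  proof
    assume "k = d"
    have "v (Suc d) \<in> {1..n}" "v d \<in> {1..n}"
      using permutes_in_image[OF vp] d by auto
    moreover have "v (Suc d) \<notin> {1..d}"
      using w vw(2)[of "Suc d"] unfolding block_perm_def by force
    moreover have "v d \<notin> {d<..n}"
      using block_perm_upper[OF w] vw(2)[of d] by force
    ultimately show False using k \<open>k = d\<close> by auto
  qed
  then have kK: "k \<in> K" using k by (simp add: K_iff)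
  have "inversions n (adj_transp k \<circ> w) \<subset> inversions n w"
  proof
    show "inversions n (adj_transp k \<circ> w) \<subseteq> inversions n w"
    proof (clarsimp simp: inversions_def)
      fix i j assume ij: "i < j" "adj_transp k (w j) < adj_transp k (w i)"
      have "w i \<noteq> w j" using ij(1) vw(1)[of i] vw(1)[of j] by auto
      moreover have "\<not> (w i = k \<and> w j = Suc k)"
        using k(2) ij(1) vw(1)[of i] vw(1)[of j] by auto
      ultimately show "w j < w i" using ij(2)
        by (auto simp: adj_transp_apply split: if_splits)
    qed
    have "v (Suc k) \<in> {1..n}" "v k \<in> {1..n}"
      using permutes_in_image[OF vp, of k] permutes_in_image[OF vp, of "Suc k"] k(1) by auto
    then have "(v (Suc k), v k) \<in> inversions n w" "(v (Suc k), v k) \<notin> inversions n (adj_transp k \<circ> w)"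
      using k by (auto simp: inversions_def vw adj_transp_apply)
    then show "inversions n (adj_transp k \<circ> w) \<noteq> inversions n w" by blast
  qed
  then have "card (inversions n (adj_transp k \<circ> w)) < card (inversions n w)"
    by (rule psubset_card_mono[OF finite_inversions])
  with kK show ?thesis by (rule that)
qed

private lemma block_perm_word:
  "block_perm d n w \<Longrightarrow> \<exists>ks. set ks \<subseteq> K \<and> length ks \<le> card (inversions n w) \<and> w = word_perm ks"
proof (induction "card (inversions n w)" arbitrary: w rule: less_induct)
  case less
  show ?case
  proof (cases "inversions n w = {}")
    case True
    have p: "w permutes {1..n}" using less.prems by (simp add: block_perm_def)
    have "w i = i" for i
    proof (cases "i \<in> {1..n}")
      case i: True
      show ?thesis
      proof (rule strict_mono_on_endo_eq[OF _ _ i])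
        fix i j assume ij: "i \<in> {1..n}" "j \<in> {1..n}" "i < j"
        then have "\<not> w j < w i" using True by (auto simp: inversions_def)
        moreover have "w i \<noteq> w j" using ij(3) permutes_inj[OF p] by (auto dest: injD)
        ultimately show "w i < w j" by simp
      next
        fix i assume "i \<in> {1..n}" then show "w i \<in> {1..n}" using permutes_in_image[OF p] by simp
      qed
    next
      case False
      then show ?thesis using p by (auto simp: permutes_def)
    qed
    then have "w = word_perm []" by (auto simp: fun_eq_iff)
    then show ?thesis by (intro exI[of _ "[]"]) auto
  next
    case False
    then obtain k where k: "k \<in> K" "card (inversions n (adj_transp k \<circ> w)) < card (inversions n w)"
      using block_perm_descent[OF less.prems] by blast
    have "block_perm d n (adj_transp k \<circ> w)"
      by (rule block_perm_comp[OF block_perm_adj_transp[OF k(1)] less.prems])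
    from less.hyps[OF k(2) this] obtain ks where ks: "set ks \<subseteq> K"
      "length ks \<le> card (inversions n (adj_transp k \<circ> w))" "adj_transp k \<circ> w = word_perm ks" by blast
    have "w = word_perm (k # ks)"
      unfolding word_perm_Cons ks(3)[symmetric] by (simp add: fun_eq_iff)
    then show ?thesis using ks k by (intro exI[of _ "k # ks"]) auto
  qed
qed

text \<open>The word found for a block permutation uses only generators from \<open>K\<close>, yet
  it has as many letters as there are inversions, so it is shortest even among words in all adjacent
  transpositions.\<close>

lemma coxeter_length_block_perm:
  assumes "block_perm d n w"
  shows "coxeter_length n w = card (inversions n w)"
  unfolding coxeter_length_def
proof (rule Least_equality)
  obtain ks where "set ks \<subseteq> K" "length ks \<le> card (inversions n w)" "w = word_perm ks"
    using block_perm_word[OF assms] by blast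
  then show "\<exists>ks. set ks \<subseteq> {1..n - 1} \<and> length ks = card (inversions n w) \<and> w = word_perm ks"
    using card_inversions_word_perm[of n ks] by (intro exI[of _ ks]) (auto simp: K_iff subset_iff)
qed (use card_inversions_word_perm in auto)

private lemma generate_adj_transp: "generate (sym_group n) (adj_transp ` K) = {w. block_perm d n w}"
proof (intro equalityI subsetI)
  fix w assume "w \<in> generate (sym_group n) (adj_transp ` K)"
  then show "w \<in> {w. block_perm d n w}"
  proof (induction rule: generate.induct)
    case one
    then show ?case unfolding sym_group_one block_perm_def mem_Collect_eq by (simp only: permutes_id) simp
  next
    case (incl h)
    then show ?case using block_perm_adj_transp by auto
  next
    case (inv h)
    then obtain k where k: "k \<in> K" "h = adj_transp k" by auto
    interpret G: group "sym_group n" by (rule sym_group_is_group)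
    have "h permutes {1..n}" using k adj_transp_permutes[of k n] by (auto simp: K_iff)
    then have "inv\<^bsub>sym_group n\<^esub> h = h"
      by (intro G.inv_equality) (simp_all only: sym_group_mult sym_group_one sym_group_carrier k adj_transp_comp)
    then show ?case using k block_perm_adj_transp by simp
  next
    case (eng h1 h2)
    then show ?case using block_perm_comp[of h1 h2] by (simp only: sym_group_mult mem_Collect_eq)
  qed
next
  fix w assume "w \<in> {w. block_perm d n w}"
  then obtain ks where ks: "set ks \<subseteq> K" "w = word_perm ks" using block_perm_word by blast
  have "set ks \<subseteq> K \<Longrightarrow> word_perm ks \<in> generate (sym_group n) (adj_transp ` K)"
  proof (induction ks)
    case Nil
    then show ?case using generate.one[of "sym_group n"] by (simp only: sym_group_one word_perm_Nil)
  next
    case (Cons k ks)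
    then have "adj_transp k \<in> generate (sym_group n) (adj_transp ` K)"
      "word_perm ks \<in> generate (sym_group n) (adj_transp ` K)"
      by (auto intro: generate.incl)
    then show ?case
      using generate.eng[of "adj_transp k" "sym_group n" "adj_transp ` K" "word_perm ks"]
      by (simp only: sym_group_mult word_perm_Cons)
  qed
  then show "w \<in> generate (sym_group n) (adj_transp ` K)" using ks by simp
qed

lemma block_perm_block_reversal: "block_perm d n (block_reversal d n)"
proof -
  have "block_reversal d n permutes {1..n}"
  proof (rule bij_imp_permutes)
    show "bij_betw (block_reversal d n) {1..n} {1..n}"
      by (rule bij_betw_byWitness[where f' = "block_reversal d n"])
        (use d in \<open>auto simp: block_reversal_def\<close>)
  qed (use d in \<open>auto simp: block_reversal_def\<close>)
  then show ?thesis by (auto simp: block_perm_def block_reversal_def)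
qed

lemma inversions_block_perm_subset:
  assumes w: "block_perm d n w"
  shows "inversions n w \<subseteq> inversions n (block_reversal d n)"
proof (rule subsetI, clarify)
  fix i j assume ij: "(i, j) \<in> inversions n w"
  have "\<not> (i \<le> d \<and> d < j)"
  proof
    assume "i \<le> d \<and> d < j"
    then have "w i \<le> d" "d < w j"
      using ij w block_perm_upper[OF w, of j] by (auto simp: inversions_def block_perm_def)
    then show False using ij by (auto simp: inversions_def)
  qed
  then show "(i, j) \<in> inversions n (block_reversal d n)"
    using ij by (auto simp: inversions_def block_reversal_def)
qed

text \<open>Uniqueness matters because \<open>longest_elt\<close> is an \<open>arg_max\<close>,
  which selects some maximiser by choice.\<close>

lemma block_perm_max_inversions:
  assumes w: "block_perm d n w" and eq: "inversions n w = inversions n (block_reversal d n)"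
  shows "w = block_reversal d n"
proof
  fix i
  have p: "w permutes {1..n}" using w by (simp add: block_perm_def)
  have low: "w i \<in> {1..d}" if "i \<in> {1..d}" for i using w that by (auto simp: block_perm_def)
  have dec: "w j < w i" if "i < j" "i \<in> {1..d} \<and> j \<in> {1..d} \<or> i \<in> {d<..n} \<and> j \<in> {d<..n}" for i j
  proof -
    have "(i, j) \<in> inversions n (block_reversal d n)"
      using that d by (auto simp: inversions_def block_reversal_def)
    then show ?thesis unfolding eq[symmetric] by (simp add: inversions_def)
  qed
  consider "i \<in> {1..d}" | "i \<in> {d<..n}" | "i \<notin> {1..n}" by force
  then show "w i = block_reversal d n i"
  proof cases
    case 1
    \<comment> \<open>Complementing the values turns the decreasing map on the block into an
      increasing self-map, which must be the identity.\<close>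
    have "d + 1 - w i = i"
    proof (rule strict_mono_on_endo_eq[OF _ _ 1])
      fix i j assume "i \<in> {1..d}" "j \<in> {1..d}" "i < j"
      then show "d + 1 - w i < d + 1 - w j" using dec[of i j] low[of i] by (auto intro: diff_less_mono2)
    next
      fix i assume "i \<in> {1..d}"
      then show "d + 1 - w i \<in> {1..d}" using low[of i] by auto
    qed
    then show ?thesis using 1 low[of i] by (auto simp: block_reversal_def)
  next
    case 2
    have up: "w i \<in> {d<..n}" if "i \<in> {d<..n}" for i using block_perm_upper[OF w that] .
    have "n + 1 - w (d + (i - d)) = i - d"
    proof (rule strict_mono_on_endo_eq[of "n - d" "\<lambda>i. n + 1 - w (d + i)"])
      fix i j assume "i \<in> {1..n - d}" "j \<in> {1..n - d}" "i < j"
      then show "n + 1 - w (d + i) < n + 1 - w (d + j)"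
        using dec[of "d + i" "d + j"] up[of "d + i"] by (intro diff_less_mono2) (auto simp: le_diff_conv2 d less_imp_le)
    next
      fix i assume "i \<in> {1..n - d}"
      then show "n + 1 - w (d + i) \<in> {1..n - d}" using up[of "d + i"] d by simp arith
    qed (use 2 in auto)
    then show ?thesis using 2 up[OF 2] by (auto simp: block_reversal_def)
  next
    case 3
    then show ?thesis using p d by (auto simp: permutes_def block_reversal_def)
  qed
qed

private lemma longest_elt_eq: "longest_elt n K = block_reversal d n"
  unfolding longest_elt_def arg_max_def generate_adj_transp
proof (rule some_equality)
  have le: "coxeter_length n w \<le> coxeter_length n (block_reversal d n)" if "block_perm d n w" for w
    using that inversions_block_perm_subset[OF that]
    by (simp add: coxeter_length_block_perm block_perm_block_reversal card_mono)
  then show "is_arg_max (coxeter_length n) (\<lambda>w. w \<in> {w. block_perm d n w}) (block_reversal d n)"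
    using block_perm_block_reversal by (auto simp: is_arg_max_def not_less)
  fix w assume w: "is_arg_max (coxeter_length n) (\<lambda>w. w \<in> {w. block_perm d n w}) w"
  then have bw: "block_perm d n w" by (simp add: is_arg_max_def)
  have "\<not> coxeter_length n w < coxeter_length n (block_reversal d n)"
    using w block_perm_block_reversal by (auto simp: is_arg_max_def)
  then have "card (inversions n (block_reversal d n)) \<le> card (inversions n w)"
    using bw by (simp add: coxeter_length_block_perm block_perm_block_reversal)
  then have "inversions n w = inversions n (block_reversal d n)"
    by (intro card_seteq finite_inversions inversions_block_perm_subset[OF bw])
  then show "w = block_reversal d n" by (rule block_perm_max_inversions[OF bw])
qed

private lemma w_upper_eq:
  assumes "j < n"
  shows "w_upper n K (Suc j) = (if j < d then Suc (j + (n - d)) else Suc (j - d))"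
proof (cases "j < d")
  case True
  then have "block_reversal d n (Suc j) = d - j" "d - j \<in> {1..n}"
    using d by (auto simp: block_reversal_def)
  then show ?thesis using True d by (auto simp: w_upper_def longest_elt_eq w0_def)
next
  case False
  then have "block_reversal d n (Suc j) = n + d - j" "n + d - j \<in> {1..n}"
    using d assms by (auto simp: block_reversal_def)
  then show ?thesis using False d assms by (auto simp: w_upper_def longest_elt_eq w0_def)
qed

text \<open>Reversing each block and then everything is increasing on each block: the first
  \<open>d\<close> indices move up by \<open>n - d\<close>, the others down by
  \<open>d\<close>.\<close>

lemma perm_mat_w_upper:
  "perm_mat n (w_upper n ({1..n - 1} - {d})) =
     mat n n (\<lambda>(i,j). if i = (if j < d then j + (n - d) else j - d) then 1 else 0)"
  unfolding K_def[symmetric]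
  by (rule eq_matI) (auto simp: perm_mat_def w_upper_eq)

end

section \<open>The Bruhat cell and its closure\<close>

lemma index_mult_mat_sum:
  "A \<in> carrier_mat m k \<Longrightarrow> B \<in> carrier_mat k l \<Longrightarrow> i < m \<Longrightarrow> j < l \<Longrightarrow>
   (A * B) $$ (i,j) = (\<Sum>x<k. A $$ (i,x) * B $$ (x,j))"
  by (simp add: scalar_prod_def atLeast0LessThan)

section \<open>Inverses and lower triangular matrices\<close>

lemma adj_mat_inverse:
  fixes A :: "'a :: field mat"
  assumes A: "A \<in> carrier_mat n n" and nz: "det A \<noteq> 0"
  shows "A * ((1 / det A) \<cdot>\<^sub>m adj_mat A) = 1\<^sub>m n" "((1 / det A) \<cdot>\<^sub>m adj_mat A) * A = 1\<^sub>m n"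
  using A adj_mat[OF A] nz
  by (auto simp: mult_smult_distrib[OF A adj_mat(1)[OF A]] mult_smult_assoc_mat[OF adj_mat(1)[OF A] A]
      intro!: eq_matI)

lemma invertible_mat_iff_det:
  fixes A :: "'a :: field mat"
  assumes A: "A \<in> carrier_mat n n"
  shows "invertible_mat A \<longleftrightarrow> det A \<noteq> 0"
proof
  assume "invertible_mat A"
  then obtain B where AB: "A * B = 1\<^sub>m n" and BA: "B * A = 1\<^sub>m (dim_row B)"
    using A by (auto simp: invertible_mat_def inverts_mat_def)
  have "dim_row B = n" "dim_col B = n"
    using arg_cong[OF AB, of dim_col] arg_cong[OF BA, of dim_col] A by auto
  then have "B \<in> carrier_mat n n" by auto
  then have "det A * det B = 1"
    using det_mult[OF A, of B] AB by simp
  then show "det A \<noteq> 0" by auto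
next
  assume nz: "det A \<noteq> 0"
  define B where "B = (1 / det A) \<cdot>\<^sub>m adj_mat A"
  have "B \<in> carrier_mat n n" using adj_mat(1)[OF A] by (simp add: B_def)
  moreover have "A * B = 1\<^sub>m n" "B * A = 1\<^sub>m n"
    using adj_mat_inverse[OF A nz] by (simp_all add: B_def)
  ultimately show "invertible_mat A"
    using A by (auto simp: invertible_mat_def inverts_mat_def)
qed

lemma lower_triangular_det_nonzero_iff:
  fixes A :: "'a :: field mat"
  assumes "A \<in> carrier_mat n n" "\<And>i j. i < j \<Longrightarrow> j < n \<Longrightarrow> A $$ (i,j) = 0"
  shows "det A \<noteq> 0 \<longleftrightarrow> (\<forall>i<n. A $$ (i,i) \<noteq> 0)"
  using assms det_lower_triangular[of n A]
  by (auto simp: diag_mat_def prod_list_zero_iff)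

lemma Bminus_iff:
  "b \<in> Bminus n \<longleftrightarrow> b \<in> carrier_mat n n \<and> (\<forall>i<n. \<forall>j<n. i < j \<longrightarrow> b $$ (i,j) = 0) \<and> (\<forall>i<n. b $$ (i,i) \<noteq> 0)"
proof -
  have "invertible_mat b \<longleftrightarrow> (\<forall>i<n. b $$ (i,i) \<noteq> 0)"
    if "b \<in> carrier_mat n n" "\<forall>i<n. \<forall>j<n. i < j \<longrightarrow> b $$ (i,j) = 0"
    using that invertible_mat_iff_det[of b n] lower_triangular_det_nonzero_iff[of b n]
    by (metis (no_types, lifting) less_trans)
  then show ?thesis by (auto simp: Bminus_def GL_def)
qed

text \<open>At the largest index \<open>J\<close> with \<open>y J\<close> nonzero, the sum would
  reduce to \<open>y J\<close> times a diagonal entry. The lemma carries vanishing of the trailing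
  entries of a row vector back through right multiplication by \<open>Bminus\<close>.\<close>

lemma lower_triangular_solve:
  fixes b :: "complex mat"
  assumes b: "b \<in> Bminus n" and z: "\<And>j. m \<le> j \<Longrightarrow> j < n \<Longrightarrow> (\<Sum>k<n. y k * b $$ (k,j)) = 0"
    and j: "m \<le> j" "j < n"
  shows "y j = 0"
proof (rule ccontr)
  assume nz: "y j \<noteq> 0"
  define J where "J = Max {j. m \<le> j \<and> j < n \<and> y j \<noteq> 0}"
  have fin: "finite {j. m \<le> j \<and> j < n \<and> y j \<noteq> 0}" by simp
  have J: "m \<le> J" "J < n" "y J \<noteq> 0" using Max_in[OF fin] j nz unfolding J_def by blast+
  have above: "y k = 0" if "J < k" "k < n" for k
  proof (rule ccontr)
    assume "y k \<noteq> 0"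
    then have "k \<le> J" unfolding J_def using that J by (intro Max_ge[OF fin]) auto
    then show False using that by simp
  qed
  have "(\<Sum>k<n. y k * b $$ (k,J)) = (\<Sum>k<n. if k = J then y J * b $$ (J,J) else 0)"
  proof (rule sum.cong[OF refl])
    fix k assume k: "k \<in> {..<n}"
    consider "k < J" | "k = J" | "J < k" by linarith
    then show "y k * b $$ (k,J) = (if k = J then y J * b $$ (J,J) else 0)"
      using k b J above by cases (auto simp: Bminus_iff)
  qed
  also have "\<dots> = y J * b $$ (J,J)" using J by simp
  finally show False using z[of J] J b by (simp add: Bminus_iff)
qed

lemma Bminus_inverse:
  assumes b: "b \<in> Bminus n"
  obtains b' where "b' \<in> Bminus n" "b * b' = 1\<^sub>m n" "b' * b = 1\<^sub>m n"
proof -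
  have bc: "b \<in> carrier_mat n n" using b by (simp add: Bminus_iff)
  have nz: "det b \<noteq> 0"
    using b invertible_mat_iff_det[OF bc] by (simp add: Bminus_def GL_def)
  define b' where "b' = (1 / det b) \<cdot>\<^sub>m adj_mat b"
  have c: "b' \<in> carrier_mat n n" using adj_mat(1)[OF bc] by (simp add: b'_def)
  have inv: "b * b' = 1\<^sub>m n" "b' * b = 1\<^sub>m n"
    using adj_mat_inverse[OF bc nz] by (simp_all add: b'_def)
  have low: "b' $$ (i,j) = 0" if "i < j" "j < n" for i j
  proof (rule lower_triangular_solve[OF b, of "Suc i" "\<lambda>k. b' $$ (i,k)"])
    fix j assume "Suc i \<le> j" "j < n"
    have "(\<Sum>k<n. b' $$ (i,k) * b $$ (k,j)) = (b' * b) $$ (i,j)"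
      using \<open>j < n\<close> that c bc \<open>Suc i \<le> j\<close> by (simp add: scalar_prod_def atLeast0LessThan)
    then show "(\<Sum>k<n. b' $$ (i,k) * b $$ (k,j)) = 0"
      using \<open>j < n\<close> \<open>Suc i \<le> j\<close> inv(2) by simp
  qed (use that in auto)
  have "det b * det b' = 1" using det_mult[OF bc c] inv by simp
  then have "det b' \<noteq> 0" by auto
  then have "b' \<in> Bminus n"
    using c low invertible_mat_iff_det[OF c] by (auto simp: Bminus_def GL_def)
  then show ?thesis using that inv by blast
qed

section \<open>Polynomial functions of the matrix entries\<close>

lemma poly_fun_sum: "(\<And>x. x \<in> S \<Longrightarrow> f x \<in> poly_fun n) \<Longrightarrow> (\<lambda>A. \<Sum>x\<in>S. f x A) \<in> poly_fun n"
proof (induction S rule: infinite_finite_induct)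
  case (insert x F)
  then show ?case by (simp add: poly_fun.add)
qed (auto intro: poly_fun.const)

lemma poly_fun_prod: "(\<And>x. x \<in> S \<Longrightarrow> f x \<in> poly_fun n) \<Longrightarrow> (\<lambda>A. \<Prod>x\<in>S. f x A) \<in> poly_fun n"
proof (induction S rule: infinite_finite_induct)
  case (insert x F)
  then show ?case by (simp add: poly_fun.mult)
qed (auto intro: poly_fun.const)

lemma poly_fun_det:
  assumes "\<And>i j. i < k \<Longrightarrow> j < k \<Longrightarrow> (\<lambda>A. M A i j) \<in> poly_fun n"
  shows "(\<lambda>A. det (mat k k (\<lambda>(i,j). M A i j))) \<in> poly_fun n"
proof -
  have "det (mat k k (\<lambda>(i,j). M A i j)) =
      (\<Sum>p | p permutes {0..<k}. signof p * (\<Prod>i=0..<k. M A i (p i)))" for A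
    by (subst det_def'[of _ k]) (auto intro!: sum.cong prod.cong simp: permutes_in_image)
  moreover have "(\<lambda>A. \<Sum>p | p permutes {0..<k}. signof p * (\<Prod>i=0..<k. M A i (p i))) \<in> poly_fun n"
  proof (intro poly_fun_sum poly_fun.mult poly_fun_prod poly_fun.const)
    fix p i assume "p \<in> {p. p permutes {0..<k}}" "i \<in> {0..<k}"
    then show "(\<lambda>A. M A i (p i)) \<in> poly_fun n"
      using permutes_in_image[of p "{0..<k}" i] by (intro assms) auto
  qed
  ultimately show ?thesis by simp
qed

text \<open>The inverse is handled through the adjugate, whose entries are polynomials in the
  entries of the matrix; equations for them that hold on the cell thus extend to its
  closure.\<close>

lemma adj_mat_top_row:
  assumes "A \<in> carrier_mat n n" "k < n"
  shows "adj_mat A $$ (0,k) =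
    (- 1) ^ k * det (mat (n - 1) (n - 1) (\<lambda>(i,j). A $$ (if i < k then i else Suc i, Suc j)))"
  using assms by (simp add: adj_mat_def cofactor_def mat_delete_def)

lemma adj_mat_top_row_poly_fun:
  assumes "k < n"
  shows "(\<lambda>A. (- 1) ^ k * det (mat (n - 1) (n - 1) (\<lambda>(i,j). A $$ (if i < k then i else Suc i, Suc j)))) \<in> poly_fun n"
  by (intro poly_fun.mult poly_fun.const poly_fun_det poly_fun.entry) auto

section \<open>Upper triangular Toeplitz matrices as truncated polynomials\<close>

definition toeplitz :: "nat \<Rightarrow> complex poly \<Rightarrow> complex mat" where
  "toeplitz n p = mat n n (\<lambda>(i,j). if i \<le> j then coeff p (j - i) else 0)"

lemma toeplitz_carrier [simp]: "toeplitz n p \<in> carrier_mat n n"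
  by (simp add: toeplitz_def)

lemma toeplitz_index: "i < n \<Longrightarrow> j < n \<Longrightarrow> toeplitz n p $$ (i,j) = (if i \<le> j then coeff p (j - i) else 0)"
  by (simp add: toeplitz_def)

lemma toeplitz_mult: "toeplitz n p * toeplitz n q = toeplitz n (p * q)"
proof (rule eq_matI)
  fix i j assume "i < dim_row (toeplitz n (p * q))" "j < dim_col (toeplitz n (p * q))"
  then have ij: "i < n" "j < n" by (auto simp: toeplitz_def)
  have "(toeplitz n p * toeplitz n q) $$ (i,j) =
      (\<Sum>l<n. (if i \<le> l then coeff p (l - i) else 0) * (if l \<le> j then coeff q (j - l) else 0))"
    using ij by (simp add: toeplitz_def scalar_prod_def atLeast0LessThan)
  also have "\<dots> = (\<Sum>l\<in>{i..j}. coeff p (l - i) * coeff q (j - l))"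
    by (rule sum.mono_neutral_cong_right) (use ij in auto)
  also have "\<dots> = (if i \<le> j then coeff (p * q) (j - i) else 0)"
  proof (cases "i \<le> j")
    case True
    have "(\<Sum>l\<in>{i..j}. coeff p (l - i) * coeff q (j - l)) = (\<Sum>a\<le>j - i. coeff p a * coeff q (j - i - a))"
      by (rule sum.reindex_bij_witness[of _ "\<lambda>a. a + i" "\<lambda>l. l - i"]) (use True in auto)
    then show ?thesis using True by (simp add: coeff_mult)
  qed simp
  finally show "(toeplitz n p * toeplitz n q) $$ (i,j) = toeplitz n (p * q) $$ (i,j)"
    using ij by (simp add: toeplitz_index)
qed (auto simp: toeplitz_def)

lemma e_mat_eq_toeplitz: "e_mat n = toeplitz n (monom 1 1)"
  by (rule eq_matI) (auto simp: e_mat_def toeplitz_def)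

lemma toeplitz_eq_one:
  assumes "\<And>j. j < n \<Longrightarrow> coeff p j = (if j = 0 then 1 else 0)"
  shows "toeplitz n p = 1\<^sub>m n"
  by (rule eq_matI) (auto simp: toeplitz_def assms)

text \<open>\<open>e_mat n\<close> is the Toeplitz matrix of X, so commuting with it is
  commutativity of polynomials, and the inverse is the Toeplitz matrix of \<open>r\<close>.\<close>

lemma toeplitz_Uplus_e:
  assumes inv: "\<And>j. j < n \<Longrightarrow> coeff (p * r) j = (if j = 0 then 1 else 0)" and p0: "coeff p 0 = 1"
  shows "toeplitz n p \<in> Uplus_e n"
proof -
  have 1: "toeplitz n p * toeplitz n r = 1\<^sub>m n" "toeplitz n r * toeplitz n p = 1\<^sub>m n"
    using toeplitz_eq_one[OF inv] by (simp_all add: toeplitz_mult mult.commute)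
  have "toeplitz n p * e_mat n * toeplitz n r = e_mat n * (toeplitz n p * toeplitz n r)"
    by (simp add: e_mat_eq_toeplitz toeplitz_mult mult_ac)
  also have "\<dots> = e_mat n" unfolding 1 by (simp add: e_mat_def)
  finally have "toeplitz n p * e_mat n * toeplitz n r = e_mat n" .
  moreover have "toeplitz n p \<in> Uplus n"
    using p0 by (auto simp: Uplus_def toeplitz_def)
  ultimately show ?thesis using 1
    by (auto simp: Uplus_e_def inverts_mat_def toeplitz_def[of n p] toeplitz_def[of n r]
        intro!: bexI[of _ "toeplitz n r"])
qed

lemma Uplus_det: "u \<in> Uplus n \<Longrightarrow> det u = 1"
proof -
  assume u: "u \<in> Uplus n"
  then have "det u = prod_list (diag_mat u)"
    by (intro det_upper_triangular) (auto simp: Uplus_def)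
  also have "diag_mat u = replicate n 1"
    using u by (auto simp: Uplus_def diag_mat_def intro!: nth_equalityI)
  finally show ?thesis by simp
qed

text \<open>The condition amounts to u e = e u; comparing the entries at (i, j + 1) shows that
  \<open>u\<close> is constant along diagonals.\<close>

lemma Uplus_e_index:
  assumes u: "u \<in> Uplus_e n" and ij: "i < n" "j < n"
  shows "u $$ (i,j) = (if i \<le> j then u $$ (0,j - i) else 0)"
proof -
  have U: "u \<in> carrier_mat n n" "upper_triangular u" using u by (auto simp: Uplus_e_def Uplus_def)
  obtain v where v: "v \<in> carrier_mat n n" "inverts_mat v u" "u * e_mat n * v = e_mat n"
    using u by (auto simp: Uplus_e_def)
  have E: "e_mat n \<in> carrier_mat n n" by (simp add: e_mat_def)
  have "u * e_mat n = u * e_mat n * (v * u)" using v U E by (simp add: inverts_mat_def)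
  also have "\<dots> = u * e_mat n * v * u"
    by (rule assoc_mult_mat[symmetric, of _ n n]) (use v U E in auto)
  finally have comm: "u * e_mat n = e_mat n * u" using v(3) by simp
  have step: "u $$ (Suc i, Suc j) = u $$ (i,j)" if "Suc i < n" "Suc j < n" for i j
  proof -
    have "(u * e_mat n) $$ (i, Suc j) = (\<Sum>k<n. u $$ (i,k) * (if Suc j = Suc k then 1 else 0))"
      using that U by (simp add: e_mat_def scalar_prod_def atLeast0LessThan)
    also have "\<dots> = (\<Sum>k<n. if k = j then u $$ (i,j) else 0)" by (rule sum.cong) auto
    also have "\<dots> = u $$ (i,j)" using that by simp
    finally have l: "(u * e_mat n) $$ (i, Suc j) = u $$ (i,j)" .
    have "(e_mat n * u) $$ (i, Suc j) = (\<Sum>k<n. (if k = Suc i then 1 else 0) * u $$ (k, Suc j))"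
      using that U by (simp add: e_mat_def scalar_prod_def atLeast0LessThan)
    also have "\<dots> = (\<Sum>k<n. if k = Suc i then u $$ (Suc i, Suc j) else 0)" by (rule sum.cong) auto
    also have "\<dots> = u $$ (Suc i, Suc j)" using that by simp
    finally show ?thesis using l comm by simp
  qed
  have shift: "i + l < n \<Longrightarrow> u $$ (i, i + l) = u $$ (0, l)" for i l
    by (induction i) (use step in auto)
  show ?thesis
  proof (cases "i \<le> j")
    case True
    then show ?thesis using shift[of i "j - i"] ij by simp
  next
    case False
    then show ?thesis using U ij by (auto simp: upper_triangular_def)
  qed
qed

section \<open>Vanishing conditions on the cell and the converse factorisation\<close>

context
  fixes d c n :: nat
  assumes d: "1 \<le> d" and c: "1 \<le> c" and n: "n = d + c"
begin

private definition P :: "complex mat" where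
  "P = mat n n (\<lambda>(i,j). if i = (if j < d then j + c else j - d) then 1 else 0)"

private lemma cell_P: "cell d n = {b * P * b' | b b'. b \<in> Bminus n \<and> b' \<in> Bminus n}"
proof -
  have "perm_mat n (w_upper n ({1..n - 1} - {d})) = P"
  proof -
    have nd: "n - d = c" "d < n" using c n by auto
    show ?thesis using perm_mat_w_upper[OF d nd(2)] unfolding P_def nd(1) .
  qed
  then show ?thesis by (simp only: cell_def Bruhat_cell_def)
qed

private lemma mult_P:
  assumes "A \<in> carrier_mat m n" "i < m" "j < n"
  shows "(A * P) $$ (i,j) = A $$ (i, if j < d then j + c else j - d)"
proof -
  have "(A * P) $$ (i,j) = (\<Sum>k<n. A $$ (i,k) * (if k = (if j < d then j + c else j - d) then 1 else 0))"
    using assms by (simp add: P_def scalar_prod_def atLeast0LessThan)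
  also have "\<dots> = (\<Sum>k<n. if k = (if j < d then j + c else j - d) then A $$ (i, if j < d then j + c else j - d) else 0)"
    by (rule sum.cong) auto
  also have "\<dots> = A $$ (i, if j < d then j + c else j - d)"
    using assms(3) n by (subst sum.delta) auto
  finally show ?thesis .
qed

text \<open>The top row of \<open>b\<close> has only its first entry, which \<open>P\<close> moves
  to position \<open>d\<close>. Hence the top row of \<open>A\<close> is a nonzero multiple of row
  \<open>d\<close> of the lower triangular \<open>b'\<close>, at least from column \<open>d\<close>
  on.\<close>

lemma cell_top_row:
  assumes A: "A \<in> cell d n"
  shows "A $$ (0,d) \<noteq> 0" and "\<And>j. d < j \<Longrightarrow> j < n \<Longrightarrow> A $$ (0,j) = 0"
proof -
  obtain b b' where b: "A = b * P * b'" "b \<in> Bminus n" "b' \<in> Bminus n"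
    using A by (auto simp: cell_P)
  then have bc: "b \<in> carrier_mat n n" "b' \<in> carrier_mat n n" by (auto simp: Bminus_iff)
  have entry: "A $$ (0,j) = b $$ (0,0) * b' $$ (d,j)" if "d \<le> j" "j < n" for j
  proof -
    have "A $$ (0,j) = (\<Sum>k<n. (b * P) $$ (0,k) * b' $$ (k,j))"
      using that bc by (simp add: b(1) P_def scalar_prod_def atLeast0LessThan)
    also have "\<dots> = (\<Sum>k<n. if k = d then b $$ (0,0) * b' $$ (d,j) else 0)"
    proof (rule sum.cong[OF refl])
      fix k assume "k \<in> {..<n}"
      then have k: "k < n" by simp
      have "b $$ (0, if k < d then k + c else k - d) = (if k = d then b $$ (0,0) else 0)"
      proof (cases "k = d")
        case False
        then have "0 < (if k < d then k + c else k - d)" "(if k < d then k + c else k - d) < n"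
          using k c n by auto
        then show ?thesis using b(2) False unfolding Bminus_iff by (metis less_trans)
      qed simp
      then show "(b * P) $$ (0,k) * b' $$ (k,j) = (if k = d then b $$ (0,0) * b' $$ (d,j) else 0)"
        using mult_P[OF bc(1), of 0 k] k by simp
    qed
    also have "\<dots> = b $$ (0,0) * b' $$ (d,j)" using n c by simp
    finally show ?thesis .
  qed
  show "A $$ (0,d) \<noteq> 0" using entry[of d] b n c by (simp add: Bminus_iff)
  show "A $$ (0,j) = 0" if "d < j" "j < n" for j
    using entry[of j] b that n by (simp add: Bminus_iff)
qed

text \<open>In adj(A) b P b' = det(A) 1 the factors on the right are peeled off one by one: removing
  \<open>b'\<close> leaves a top row supported at column 0, removing \<open>P\<close> moves this to
  column \<open>c\<close>, and removing \<open>b\<close> keeps the entries beyond \<open>c\<close>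
  equal to 0.\<close>

lemma cell_adj_top_row:
  assumes A: "A \<in> cell d n" and k: "c < k" "k < n"
  shows "adj_mat A $$ (0,k) = 0"
proof -
  obtain b b' where b: "A = b * P * b'" "b \<in> Bminus n" "b' \<in> Bminus n"
    using A by (auto simp: cell_P)
  then have bc: "b \<in> carrier_mat n n" "b' \<in> carrier_mat n n" by (auto simp: Bminus_iff)
  have Pc: "P \<in> carrier_mat n n" by (simp add: P_def)
  have Ac: "A \<in> carrier_mat n n" using bc Pc by (simp add: b(1))
  have jc: "adj_mat A \<in> carrier_mat n n" using adj_mat(1)[OF Ac] .
  define Y where "Y = adj_mat A * b"
  have Yc: "Y \<in> carrier_mat n n" using jc bc by (simp add: Y_def)
  have "Y * P * b' = adj_mat A * (b * P * b')"
    unfolding Y_def using jc bc Pc by (simp add: assoc_mult_mat[of _ n n _ n _ n])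
  then have "Y * P * b' = adj_mat A * A" by (simp only: b(1))
  then have YPb: "Y * P * b' = det A \<cdot>\<^sub>m 1\<^sub>m n" using adj_mat(3)[OF Ac] by simp
  have "(Y * P) $$ (0,j) = 0" if "1 \<le> j" "j < n" for j
  proof (rule lower_triangular_solve[OF b(3), of 1 "\<lambda>j. (Y * P) $$ (0,j)"])
    fix j assume j: "1 \<le> j" "j < n"
    have "(\<Sum>k<n. (Y * P) $$ (0,k) * b' $$ (k,j)) = (Y * P * b') $$ (0,j)"
      by (rule index_mult_mat_sum[symmetric, of _ n n _ n]) (use j Yc Pc bc in auto)
    then show "(\<Sum>k<n. (Y * P) $$ (0,k) * b' $$ (k,j)) = 0" using j by (simp add: YPb)
  qed (use that in auto)
  then have Y0: "Y $$ (0,j) = 0" if "c < j" "j < n" for j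
    using that mult_P[OF Yc, of 0 "j - c"] by (simp add: n less_diff_conv2)
  show ?thesis
  proof (rule lower_triangular_solve[OF b(2), of "Suc c" "\<lambda>k. adj_mat A $$ (0,k)"])
    fix j assume j: "Suc c \<le> j" "j < n"
    have "(\<Sum>k<n. adj_mat A $$ (0,k) * b $$ (k,j)) = Y $$ (0,j)"
      using j jc bc by (simp add: Y_def scalar_prod_def atLeast0LessThan)
    then show "(\<Sum>k<n. adj_mat A $$ (0,k) * b $$ (k,j)) = 0" using Y0[of j] j by simp
  qed (use k in auto)
qed

lemma V_top_row: "u \<in> V d n \<Longrightarrow> d < j \<Longrightarrow> j < n \<Longrightarrow> u $$ (0,j) = 0"
  using cell_top_row(2)[of _ j] poly_fun.entry[of 0 n j] by (auto simp: V_def closure_GL_def)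

lemma V_adj_top_row:
  assumes u: "u \<in> V d n" and k: "c < k" "k < n"
  shows "adj_mat u $$ (0,k) = 0"
proof -
  define f where "f A = (- 1) ^ k * det (mat (n - 1) (n - 1) (\<lambda>(i,j). A $$ (if i < k then i else Suc i, Suc j)))"
    for A :: "complex mat"
  have f: "f \<in> poly_fun n" using adj_mat_top_row_poly_fun[OF k(2)] by (simp add: f_def[abs_def])
  have "f A = 0" if "A \<in> cell d n" for A
  proof -
    have "A \<in> carrier_mat n n" using that by (auto simp: cell_P Bminus_iff P_def)
    then show ?thesis using cell_adj_top_row[OF that k] adj_mat_top_row[of A n k] k by (simp add: f_def)
  qed
  then have "f u = 0" using u f by (auto simp: V_def closure_GL_def)
  moreover have "u \<in> carrier_mat n n" using u by (auto simp: V_def Uplus_e_def Uplus_def)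
  ultimately show ?thesis using adj_mat_top_row[of u n k] k by (simp add: f_def)
qed

text \<open>\<open>p\<close> and \<open>r\<close> are read off the top rows of \<open>u\<close> and
  of its adjugate, which is the inverse as det u = 1. So \<open>p * r\<close> is 1 below degree
  \<open>n\<close>, and the degree bounds add up to \<open>n\<close>, which leaves only the
  coefficient at X^n.\<close>

lemma V_polys:
  assumes u: "u \<in> V d n"
  obtains p r where "u = toeplitz n p" "degree p \<le> d" "degree r \<le> c" "coeff p 0 = 1"
    "p * r = 1 + monom (coeff p d * coeff r c) n"
proof -
  have ue: "u \<in> Uplus_e n" using u by (simp add: V_def)
  then have uU: "u \<in> Uplus n" by (simp add: Uplus_e_def)
  then have uc: "u \<in> carrier_mat n n" by (simp add: Uplus_def)
  define p where "p = (\<Sum>k\<le>d. monom (u $$ (0,k)) k)"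
  define r where "r = (\<Sum>k\<le>c. monom (adj_mat u $$ (0,k)) k)"
  have cp: "coeff p k = (if k \<le> d then u $$ (0,k) else 0)" for k
    by (simp add: p_def coeff_sum)
  have cr: "coeff r k = (if k \<le> c then adj_mat u $$ (0,k) else 0)" for k
    by (simp add: r_def coeff_sum)
  have dp: "degree p \<le> d" and dr: "degree r \<le> c" by (auto intro!: degree_le simp: cp cr)
  have cpn: "coeff p k = u $$ (0,k)" if "k < n" for k
    using V_top_row[OF u, of k] that by (auto simp: cp)
  have crn: "coeff r k = adj_mat u $$ (0,k)" if "k < n" for k
    using V_adj_top_row[OF u, of k] that by (auto simp: cr)
  have uT: "u = toeplitz n p"
  proof (rule eq_matI)
    fix i j assume "i < dim_row (toeplitz n p)" "j < dim_col (toeplitz n p)"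
    then have "i < n" "j < n" by (auto simp: toeplitz_def)
    then show "u $$ (i,j) = toeplitz n p $$ (i,j)"
      using Uplus_e_index[OF ue, of i j] by (simp add: toeplitz_index cpn)
  qed (use uc in \<open>auto simp: toeplitz_def\<close>)
  have low: "coeff (p * r) j = (if j = 0 then 1 else 0)" if "j < n" for j
  proof -
    have "(adj_mat u * u) $$ (0,j) = (\<Sum>k<n. adj_mat u $$ (0,k) * u $$ (k,j))"
      by (rule index_mult_mat_sum[of _ n n _ n]) (use that uc adj_mat(1)[OF uc] in auto)
    also have "\<dots> = (\<Sum>k<n. if k \<le> j then coeff r k * coeff p (j - k) else 0)"
    proof (rule sum.cong[OF refl])
      fix k assume "k \<in> {..<n}"
      then show "adj_mat u $$ (0,k) * u $$ (k,j) = (if k \<le> j then coeff r k * coeff p (j - k) else 0)"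
        using Uplus_e_index[OF ue, of k j] that by (simp add: crn cpn)
    qed
    also have "\<dots> = (\<Sum>k\<le>j. coeff r k * coeff p (j - k))"
      by (rule sum.mono_neutral_cong_right) (use that in auto)
    also have "\<dots> = coeff (p * r) j" by (simp add: coeff_mult mult.commute[of p r])
    finally show ?thesis using that adj_mat(3)[OF uc] Uplus_det[OF uU] by auto
  qed
  have "p * r = 1 + monom (coeff p d * coeff r c) n"
  proof (rule poly_eqI)
    fix j
    consider "j < n" | "j = n" | "n < j" by linarith
    then show "coeff (p * r) j = coeff (1 + monom (coeff p d * coeff r c) n) j"
    proof cases
      case 1
      then show ?thesis by (simp add: low coeff_1)
    next
      case 2
      have "coeff (p * r) (d + c) = coeff p d * coeff r c"
      proof -
        have "coeff (p * r) (d + c) = (\<Sum>i\<le>d + c. coeff p i * coeff r (d + c - i))"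
          by (simp add: coeff_mult)
        also have "\<dots> = (\<Sum>i\<le>d + c. if i = d then coeff p d * coeff r c else 0)"
          by (rule sum.cong) (auto simp: cp cr)
        finally show ?thesis by simp
      qed
      then show ?thesis using 2 d n by (simp add: coeff_1)
    next
      case 3
      then have "degree (p * r) < j" using degree_mult_le[of p r] dp dr n by linarith
      then show ?thesis using 3 by (simp add: coeff_eq_0 coeff_1)
    qed
  qed
  moreover have "coeff p 0 = 1" using uU d c n by (simp add: cp Uplus_def)
  ultimately show ?thesis using that uT dp dr by blast
qed

text \<open>A nonzero \<kappa> forces both degree bounds to be attained, and the two leading
  coefficients are the diagonal entries that make \<open>b\<close> and \<open>N\<close>
  invertible.\<close>

lemma toeplitz_in_cell:
  assumes p: "degree p \<le> d" and r: "degree r \<le> c" and inv: "p * r = 1 + monom \<kappa> n" and nz: "\<kappa> \<noteq> 0"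
  shows "toeplitz n p \<in> cell d n"
proof -
  have prn: "coeff (p * r) j = (if j = 0 then 1 else 0)" if "j < n" for j
    using that by (simp add: inv coeff_1)
  have "coeff (p * r) n = \<kappa>" using d n by (simp add: inv coeff_1)
  then have "n \<le> degree (p * r)" using nz by (intro le_degree) auto
  then have "n \<le> degree p + degree r" using degree_mult_le order_trans by blast
  then have deg: "degree p = d" "degree r = c" using p r n by auto
  then have lead: "coeff p d \<noteq> 0" "coeff r c \<noteq> 0"
    using d c by (metis leading_coeff_0_iff degree_0 not_one_le_zero)+
  define u v where "u = toeplitz n p" and "v = toeplitz n r"
  have uv: "u * v = 1\<^sub>m n" unfolding u_def v_def toeplitz_mult by (rule toeplitz_eq_one[OF prn])
  have uc: "u \<in> carrier_mat n n" and vc: "v \<in> carrier_mat n n" by (auto simp: u_def v_def)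
  \<comment> \<open>In block form, the last \<open>d\<close> columns of \<open>v\<close> fill the first \<open>d\<close> columns of \<open>N\<close>, and the last \<open>c\<close> columns
    of \<open>u\<close> fill the first \<open>c\<close> columns of \<open>b\<close>; the degree bounds make both lower triangular.\<close>
  define N where "N = mat n n (\<lambda>(i,j). if j < d then v $$ (i, j + c) else if i = j then 1 else 0)"
  define b where "b = mat n n (\<lambda>(i,j). if j < c then u $$ (i, j + d) else if i = j then 1 else 0)"
  have N: "N \<in> Bminus n"
    using lead d c n deg by (auto simp: Bminus_iff N_def v_def toeplitz_index coeff_eq_0)
  have b: "b \<in> Bminus n"
    using lead d c n deg by (auto simp: Bminus_iff b_def u_def toeplitz_index coeff_eq_0)
  have Nc: "N \<in> carrier_mat n n" and bc: "b \<in> carrier_mat n n" by (auto simp: N_def b_def)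
  \<comment> \<open>As \<open>v\<close> is inverse to \<open>u\<close>, the first \<open>d\<close>
    columns of \<open>u * N\<close> are the unit vectors with index \<open>j + c\<close>, which are
    columns of \<open>b\<close>. The remaining columns of \<open>N\<close> are unit vectors and
    select the columns of \<open>u\<close> stored in \<open>b\<close>.\<close>
  have uN: "u * N = b * P"
  proof (rule eq_matI)
    fix i j assume "i < dim_row (b * P)" "j < dim_col (b * P)"
    then have ij: "i < n" "j < n" by (auto simp: b_def P_def)
    have "(u * N) $$ (i,j) = (\<Sum>k<n. u $$ (i,k) * N $$ (k,j))"
      using ij uc Nc by (simp add: scalar_prod_def atLeast0LessThan)
    also have "\<dots> = b $$ (i, if j < d then j + c else j - d)"
    proof (cases "j < d")
      case True
      then have "(\<Sum>k<n. u $$ (i,k) * N $$ (k,j)) = (u * v) $$ (i, j + c)"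
        using ij uc vc n by (simp add: N_def scalar_prod_def atLeast0LessThan)
      then show ?thesis using True ij n by (simp add: uv b_def)
    next
      case False
      then have "(\<Sum>k<n. u $$ (i,k) * N $$ (k,j)) = (\<Sum>k<n. if k = j then u $$ (i,j) else 0)"
        using ij by (intro sum.cong) (auto simp: N_def)
      then show ?thesis using False ij n by (simp add: b_def)
    qed
    finally show "(u * N) $$ (i,j) = (b * P) $$ (i,j)" using mult_P[OF bc] ij by simp
  qed (use uc Nc bc in \<open>auto simp: P_def\<close>)
  obtain N' where N': "N' \<in> Bminus n" "N * N' = 1\<^sub>m n"
    using Bminus_inverse[OF N] by blast
  have "u = u * (N * N')" using uc by (simp add: N')
  also have "\<dots> = u * N * N'"
    by (rule assoc_mult_mat[symmetric, of _ n n]) (use uc Nc N' in \<open>auto simp: Bminus_iff\<close>)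
  finally have "u = b * P * N'" by (simp only: uN)
  then show ?thesis using b N' unfolding cell_P u_def by blast
qed

lemma toeplitz_in_V:
  assumes "degree p \<le> d" "degree r \<le> c" "p * r = 1 + monom \<kappa> n" "\<kappa> \<noteq> 0" "coeff p 0 = 1"
  shows "toeplitz n p \<in> V d n"
proof -
  have "toeplitz n p \<in> Uplus_e n"
    by (rule toeplitz_Uplus_e[of _ _ r]) (use assms in \<open>auto simp: coeff_1\<close>)
  moreover from this have "toeplitz n p \<in> GL n"
    using Uplus_det[of "toeplitz n p" n] invertible_mat_iff_det[of "toeplitz n p" n]
    by (simp add: GL_def Uplus_e_def)
  moreover have "toeplitz n p \<in> cell d n" using assms by (intro toeplitz_in_cell)
  ultimately show ?thesis by (auto simp: V_def closure_GL_def)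
qed

end

lemma poly_fun_isCont:
  assumes "f \<in> poly_fun n" "\<And>i j. i < n \<Longrightarrow> j < n \<Longrightarrow> isCont (\<lambda>t. g t $$ (i,j)) x"
  shows "isCont (\<lambda>t. f (g t)) x"
  using assms by (induction rule: poly_fun.induct) (auto intro!: continuous_intros)

text \<open>A polynomial that vanishes on the cell vanishes along the curve for
  \<open>t \<noteq> 0\<close>, hence at 0 by continuity. This serves the parameter 0, where the
  factorisation needs a nonzero \<kappa>.\<close>

lemma V_limit:
  fixes g :: "real \<Rightarrow> complex mat"
  assumes cont: "\<And>i j. i < n \<Longrightarrow> j < n \<Longrightarrow> isCont (\<lambda>t. g t $$ (i,j)) 0"
    and V: "\<And>t. t \<noteq> 0 \<Longrightarrow> g t \<in> V d n" and U: "g 0 \<in> Uplus_e n"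
  shows "g 0 \<in> V d n"
proof -
  have "f (g 0) = 0" if f: "f \<in> poly_fun n" "\<forall>h\<in>cell d n. f h = 0" for f
  proof -
    have "((\<lambda>t. f (g t)) \<longlongrightarrow> f (g 0)) (at 0)"
      using poly_fun_isCont[OF f(1) cont] by (simp add: isCont_def)
    moreover have "((\<lambda>t. f (g t)) \<longlongrightarrow> 0) (at 0)"
    proof (rule tendsto_eventually)
      show "\<forall>\<^sub>F t in at 0. f (g t) = 0"
        unfolding eventually_at_filter
        by (rule always_eventually) (use V f in \<open>auto simp: V_def closure_GL_def\<close>)
    qed
    ultimately show ?thesis by (rule tendsto_unique[rotated 1]) simp
  qed
  moreover have "g 0 \<in> GL n"
    using U Uplus_det[of "g 0" n] invertible_mat_iff_det[of "g 0" n]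
    by (simp add: GL_def Uplus_e_def Uplus_def)
  ultimately show ?thesis using U by (auto simp: V_def closure_GL_def)
qed

section \<open>The polynomial of a positive element\<close>

lemma esym_0 [simp]: "esym d z 0 = 1"
proof -
  have "{S. S \<subseteq> {..<d} \<and> card S = 0} = {{}}" using finite_subset[of _ "{..<d}"] by auto
  then show ?thesis by (simp add: esym_def)
qed

lemma esym_eq_0: "d < j \<Longrightarrow> esym d z j = 0"
proof -
  assume "d < j"
  moreover have "card S \<le> d" if "S \<subseteq> {..<d}" for S using card_mono[OF _ that] by simp
  ultimately have "{S. S \<subseteq> {..<d} \<and> card S = j} = {}" by (auto dest: leD)
  then show ?thesis by (simp only: esym_def sum.empty)
qed

lemma esym_Suc_Suc: "esym (Suc d) z (Suc j) = esym d z (Suc j) + z d * esym d z j"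
proof -
  define F where "F k = {S. S \<subseteq> {..<d} \<and> card S = k}" for k
  have fin: "finite (F k)" for k unfolding F_def by (rule finite_subset[of _ "Pow {..<d}"]) auto
  have finS: "finite S" "d \<notin> S" if "S \<in> F k" for S k using that finite_subset[of S "{..<d}"] by (auto simp: F_def)
  have split: "{S. S \<subseteq> {..<Suc d} \<and> card S = Suc j} = F (Suc j) \<union> insert d ` F j"
  proof (intro equalityI subsetI)
    fix S assume S: "S \<in> {S. S \<subseteq> {..<Suc d} \<and> card S = Suc j}"
    then have "finite S" using finite_subset by auto
    show "S \<in> F (Suc j) \<union> insert d ` F j"
    proof (cases "d \<in> S")
      case True
      then have "S - {d} \<in> F j" "S = insert d (S - {d})"
        using S \<open>finite S\<close> by (auto simp: F_def lessThan_Suc)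
      then show ?thesis by blast
    next
      case False
      then show ?thesis using S by (auto simp: F_def lessThan_Suc)
    qed
  next
    fix S assume "S \<in> F (Suc j) \<union> insert d ` F j"
    then show "S \<in> {S. S \<subseteq> {..<Suc d} \<and> card S = Suc j}"
    proof
      assume "S \<in> F (Suc j)"
      then show ?thesis by (auto simp: F_def lessThan_Suc)
    next
      assume "S \<in> insert d ` F j"
      then obtain T where T: "T \<in> F j" "S = insert d T" by blast
      then show ?thesis using finS[OF T(1)] by (auto simp: F_def lessThan_Suc)
    qed
  qed
  have "esym (Suc d) z (Suc j) = (\<Sum>S\<in>F (Suc j). \<Prod>k\<in>S. z k) + (\<Sum>S\<in>insert d ` F j. \<Prod>k\<in>S. z k)"
    unfolding esym_def split
  proof (rule sum.union_disjoint)
    show "F (Suc j) \<inter> insert d ` F j = {}" using finS(2)[of _ "Suc j"] by blast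
  qed (use fin in auto)
  also have "(\<Sum>S\<in>insert d ` F j. \<Prod>k\<in>S. z k) = (\<Sum>S\<in>F j. \<Prod>k\<in>insert d S. z k)"
  proof (subst sum.reindex)
    show "inj_on (insert d) (F j)"
      by (rule inj_onI) (use finS in \<open>metis Diff_insert_absorb\<close>)
  qed simp
  also have "\<dots> = (\<Sum>S\<in>F j. z d * (\<Prod>k\<in>S. z k))"
    by (rule sum.cong[OF refl]) (use finS in simp)
  finally show ?thesis by (simp add: esym_def F_def sum_distrib_left)
qed

lemma coeff_prod_linear_esym: "coeff (\<Prod>k<d. [:1, z k:]) j = esym d z j"
proof (induction d arbitrary: j)
  case 0
  show ?case by (cases j) (auto simp: esym_eq_0 coeff_1)
next
  case (Suc d)
  have "coeff (\<Prod>k<Suc d. [:1, z k:]) j = coeff ((\<Prod>k<d. [:1, z k:]) + pCons 0 (smult (z d) (\<Prod>k<d. [:1, z k:]))) j"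
    by (simp add: mult.commute)
  then show ?case
    by (cases j) (simp_all add: Suc.IH esym_Suc_Suc)
qed

lemma degree_prod_linear_le: "finite A \<Longrightarrow> degree (\<Prod>k\<in>A. [:1, z k:]) \<le> card A"
  for z :: "'b \<Rightarrow> 'a :: comm_ring_1"
proof (induction A rule: finite_induct)
  case (insert x F)
  have "degree (\<Prod>k\<in>insert x F. [:1, z k:]) \<le> degree [:1, z x:] + degree (\<Prod>k\<in>F. [:1, z k:])"
    unfolding prod.insert[OF insert(1,2)] by (rule degree_mult_le)
  also have "degree [:1, z x:] \<le> 1" by (simp add: degree_pCons_eq_if)
  finally show ?case using insert by simp
qed simp

lemma poly_prod_linear_root: "finite A \<Longrightarrow> k \<in> A \<Longrightarrow> z k \<noteq> 0 \<Longrightarrow> poly (\<Prod>k\<in>A. [:1, z k:]) (- 1 / z k) = 0"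
  for z :: "nat \<Rightarrow> complex"
  by (auto simp: poly_prod intro!: bexI[of _ k])

lemma zeta_pow_eq_cis: "zeta_pow n a = cis (2 * pi * a / real n)"
  by (simp add: zeta_pow_def cis_conv_exp algebra_simps)

context
  fixes d c n :: nat and \<theta> :: real
  assumes d: "1 \<le> d" and c: "1 \<le> c" and n: "n = d + c" and \<theta>: "\<theta> = pi / real n"
begin

private lemma sin_pos: "0 < x \<Longrightarrow> x < real n \<Longrightarrow> 0 < sin (x * \<theta>)"
  unfolding \<theta> by (rule sin_pi_frac_pos)

text \<open>The q-binomial theorem for q = \<open>cis \<theta> ^ 2\<close>. The true phase is
  \<open>cis \<theta>\<close> to the power (m - 1) j; multiplying both sides by
  \<open>cis \<theta> ^ j\<close> avoids a negative exponent at m = 0. The bound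
  \<open>j < n\<close> keeps the denominators nonzero.\<close>

lemma esym_geometric:
  "j < n \<Longrightarrow> esym m (\<lambda>k. w * cis \<theta> ^ (2 * k)) j * cis \<theta> ^ j = w ^ j * cis \<theta> ^ (m * j) * of_real (sin_binomial \<theta> m j)"
proof (induction m arbitrary: j)
  case 0
  then show ?case by (cases j) (simp_all add: esym_eq_0 sin_binomial_eq_0)
next
  case (Suc m)
  show ?case
  proof (cases j)
    case (Suc i)
    define Q where "Q = cis \<theta>"
    define e where "e j = esym m (\<lambda>k. w * Q ^ (2 * k)) j" for j
    define B where "B k j = complex_of_real (sin_binomial \<theta> k j)" for k j
    define s where "s = complex_of_real (sin ((real i + 1) * \<theta>))"
    have s: "s \<noteq> 0" using sin_pos[of "real i + 1"] Suc.prems Suc by (simp add: s_def)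
    have IH: "e j * Q ^ j = w ^ j * Q ^ (m * j) * B m j" if "j < n" for j
      using Suc.IH[OF that] by (simp add: e_def Q_def B_def)
    have a1: "s * B (Suc m) (Suc i) = of_real (sin ((real m + 1) * \<theta>)) * B m i"
      using sin_binomial_absorb[of i \<theta> m] sin_pos[of "real i + 1"] Suc.prems Suc
      by (simp add: s_def B_def algebra_simps flip: of_real_mult)
    have a2: "s * B m (Suc i) = of_real (sin ((real m - real i) * \<theta>)) * B m i"
      using s by (simp add: s_def B_def sin_binomial_Suc)
    \<comment> \<open>With A = (m + 1) \<theta> and B = (i + 1) \<theta> this is sin (A - B) + exp
      (i A) sin B = exp (i B) sin A, from which Pascal's rule follows.\<close>
    have ang: "of_real (sin ((real m - real i) * \<theta>)) + Q ^ Suc m * s = Q ^ Suc i * of_real (sin ((real m + 1) * \<theta>))"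
    proof -
      have eq: "(real m - real i) * \<theta> = (real m + 1) * \<theta> - (real i + 1) * \<theta>" by (simp add: algebra_simps)
      have Q: "Q ^ Suc k = cis ((real k + 1) * \<theta>)" for k
        unfolding Q_def DeMoivre by (simp add: algebra_simps)
      show ?thesis
        unfolding Q s_def eq by (rule complex_eqI) (simp_all add: sin_diff mult.commute)
    qed
    have key: "B m (Suc i) + Q ^ Suc m * B m i = Q ^ Suc i * B (Suc m) (Suc i)"
    proof -
      have "s * (B m (Suc i) + Q ^ Suc m * B m i) = (of_real (sin ((real m - real i) * \<theta>)) + Q ^ Suc m * s) * B m i"
        by (simp only: distrib_left distrib_right a2) (simp add: mult_ac)
      also have "\<dots> = Q ^ Suc i * (s * B (Suc m) (Suc i))"
        unfolding ang a1 by (simp add: mult_ac)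
      finally have "s * (B m (Suc i) + Q ^ Suc m * B m i) = s * (Q ^ Suc i * B (Suc m) (Suc i))"
        by (simp add: mult_ac)
      then show ?thesis using s by simp
    qed
    have "esym (Suc m) (\<lambda>k. w * Q ^ (2 * k)) (Suc i) * Q ^ Suc i =
       e (Suc i) * Q ^ Suc i + w * Q ^ (2 * m) * Q * (e i * Q ^ i)"
      by (simp add: esym_Suc_Suc e_def algebra_simps)
    also have "\<dots> = w ^ Suc i * Q ^ (m * Suc i) * B m (Suc i) + w * Q ^ (2 * m) * Q * (w ^ i * Q ^ (m * i) * B m i)"
      using Suc Suc.prems by (simp only: IH)
    also have "\<dots> = w ^ Suc i * Q ^ (m * Suc i) * (B m (Suc i) + Q ^ Suc m * B m i)"
      by (simp add: algebra_simps power_add mult_2_right)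
    also have "\<dots> = w ^ Suc i * Q ^ (Suc m * Suc i) * B (Suc m) (Suc i)"
      unfolding key by (simp add: algebra_simps power_add)
    finally show ?thesis unfolding Suc Q_def B_def .
  qed simp
qed

definition z_pos :: "real \<Rightarrow> nat \<Rightarrow> complex" where
  "z_pos t k = of_real t * zeta_pow n (- (real d - 1) / 2 + real k)"

definition p_pos :: "real \<Rightarrow> complex poly" where
  "p_pos t = (\<Prod>k<d. [:1, z_pos t k:])"

text \<open>The indices from \<open>d\<close> on continue the progression of exponents, so
  \<open>p_pos\<close> and \<open>r_pos\<close> together use every residue class modulo
  \<open>n\<close> once.\<close>

definition r_pos :: "real \<Rightarrow> complex poly" where
  "r_pos t = (\<Prod>k\<in>{d..<n}. [:1, z_pos t k:])"

lemma z_pos_eq: "z_pos t k = of_real t * cis (- (real d - 1) * \<theta>) * cis (2 * pi * real k / real n)"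
proof -
  have "real n \<noteq> 0" using d n by simp
  then have "2 * pi * (- (real d - 1) / 2 + real k) / real n = - (real d - 1) * \<theta> + 2 * pi * real k / real n"
    by (simp add: \<theta> field_simps)
  then show ?thesis by (simp only: z_pos_def zeta_pow_eq_cis mult.assoc cis_mult)
qed

text \<open>The exponents are centred around 0, and this shift contributes exactly the phase that
  cancels the one in \<open>esym_geometric\<close>. So the coefficients are real.\<close>

lemma coeff_p_pos: "coeff (p_pos t) j = of_real (t ^ j * sin_binomial \<theta> d j)"
proof (cases "j \<le> d")
  case False
  then show ?thesis by (simp add: p_pos_def coeff_prod_linear_esym esym_eq_0 sin_binomial_eq_0)
next
  case True
  define w where "w = of_real t * cis (- (real d - 1) * \<theta>)"
  have z: "z_pos t = (\<lambda>k. w * cis \<theta> ^ (2 * k))"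
    by (rule ext) (simp add: z_pos_eq w_def DeMoivre \<theta> field_simps)
  have "esym d (z_pos t) j * cis \<theta> ^ j = w ^ j * cis \<theta> ^ (d * j) * of_real (sin_binomial \<theta> d j)"
    unfolding z by (rule esym_geometric) (use True c n in simp)
  also have "w ^ j * cis \<theta> ^ (d * j) = of_real (t ^ j) * cis \<theta> ^ j"
    by (simp add: w_def power_mult_distrib DeMoivre cis_mult algebra_simps)
  finally have "esym d (z_pos t) j * cis \<theta> ^ j = of_real (t ^ j * sin_binomial \<theta> d j) * cis \<theta> ^ j"
    by (simp add: mult_ac)
  then show ?thesis by (simp add: p_pos_def coeff_prod_linear_esym)
qed

lemma degree_p_pos: "degree (p_pos t) \<le> d" and degree_r_pos: "degree (r_pos t) \<le> c"
proof -
  have "card {d..<n} = c" by (simp add: n)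
  then show "degree (p_pos t) \<le> d" "degree (r_pos t) \<le> c"
    unfolding p_pos_def r_pos_def
    using degree_prod_linear_le[of "{..<d}" "z_pos t"] degree_prod_linear_le[of "{d..<n}" "z_pos t"]
    by simp_all
qed

lemma coeff_p_pos_0 [simp]: "coeff (p_pos t) 0 = 1"
  by (simp add: coeff_p_pos)

lemma z_pos_power: "z_pos t k ^ n = (- 1) ^ (d + 1) * of_real t ^ n"
proof -
  have n0: "real n > 0" using d n by simp
  have "cis (- (real d - 1) * \<theta>) ^ n = cis (- (real d - 1) * pi)"
    using n0 by (simp add: DeMoivre \<theta>)
  also have "\<dots> = (- 1) ^ (d + 1)"
  proof -
    have e: "- (real d - 1) * pi = real (d + 1) * pi + 2 * pi * (- real d)" by (simp add: algebra_simps)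
    have "cis (- (real d - 1) * pi) = cis (real (d + 1) * pi) * cis (2 * pi * (- real d))"
      unfolding e cis_mult ..
    also have "cis (2 * pi * (- real d)) = 1" by (rule cis_multiple_2pi) (auto intro: Ints_minus)
    also have "cis (real (d + 1) * pi) = cis pi ^ (d + 1)" by (simp only: DeMoivre)
    finally show ?thesis by simp
  qed
  moreover have "cis (2 * pi * real k / real n) ^ n = 1"
    using n0 by (simp add: DeMoivre)
  ultimately show ?thesis unfolding z_pos_eq power_mult_distrib by simp
qed

lemma z_pos_inj: "t \<noteq> 0 \<Longrightarrow> inj_on (z_pos t) {..<n}"
proof -
  assume t: "t \<noteq> 0"
  have "inj_on (\<lambda>k. cis (2 * pi * real k / real n)) {..<n}"
    using bij_betw_roots_unity[of n] d n by (auto simp: bij_betw_def)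
  then show ?thesis using t by (auto simp: inj_on_def z_pos_eq)
qed

text \<open>Both sides have degree at most \<open>n\<close> and agree at the \<open>n\<close>
  distinct points \<open>- 1 / z_pos t k\<close> and at 0. For t = 0 these points are missing, and
  everything is 1.\<close>

lemma p_pos_mult_r_pos: "p_pos t * r_pos t = 1 + monom ((- 1) ^ c * of_real t ^ n) n"
proof (cases "t = 0")
  case True
  have "p_pos 0 = 1" "r_pos 0 = 1"
    unfolding p_pos_def r_pos_def by (simp_all add: z_pos_eq flip: one_pCons)
  moreover have "n \<noteq> 0" using d n by simp
  ultimately show ?thesis using True by (simp add: power_0_left)
next
  case False
  define f where "f = (\<Prod>k<n. [:1, z_pos t k:])"
  define g where "g = 1 + monom ((- 1) ^ c * complex_of_real t ^ n) n"
  have z0: "z_pos t k \<noteq> 0" for k using False by (simp add: z_pos_eq)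
  define R where "R = (\<lambda>k. - 1 / z_pos t k) ` {..<n}"
  have cardR: "card R = n"
    unfolding R_def using z_pos_inj[OF False] z0
    by (subst card_image) (auto simp: inj_on_def)
  have "0 \<notin> R" using z0 by (auto simp: R_def)
  have "f = g"
  proof (rule poly_eqI_degree)
    fix x assume "x \<in> insert 0 R"
    then consider "x = 0" | k where "k < n" "x = - 1 / z_pos t k" by (auto simp: R_def)
    then show "poly f x = poly g x"
    proof cases
      case 1
      then show ?thesis using d n by (simp add: f_def g_def poly_prod poly_monom)
    next
      case 2
      have "poly f x = 0" unfolding f_def 2(2) by (rule poly_prod_linear_root) (use 2 z0 in auto)
      moreover have "poly g x = 1 + (- 1) ^ c * of_real t ^ n * ((- 1) ^ n / z_pos t k ^ n)"
        unfolding g_def 2(2) poly_add poly_monom power_divide by simp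
      moreover have "(- 1) ^ c * of_real t ^ n * ((- 1) ^ n / z_pos t k ^ n) = - 1"
      proof -
        have "(- 1) ^ c * (- 1) ^ n = - ((- 1 :: complex) ^ (d + 1))"
          by (simp add: n power_add)
        then have "(- 1) ^ c * of_real t ^ n * (- 1) ^ n = - ((- 1) ^ (d + 1) * (of_real t :: complex) ^ n)"
          by (metis (no_types, lifting) mult.assoc mult.commute mult_minus_left)
        then show ?thesis using False by (simp add: z_pos_power)
      qed
      ultimately show ?thesis by simp
    qed
  next
    show "card (insert 0 R) > degree f" "card (insert 0 R) > degree g"
      using degree_prod_linear_le[of "{..<n}" "z_pos t"] cardR \<open>0 \<notin> R\<close>
        degree_add_le[of 1 n "monom ((- 1) ^ c * complex_of_real t ^ n) n"] degree_monom_le[of "(- 1) ^ c * complex_of_real t ^ n" n]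
      by (auto simp: f_def g_def R_def)
  qed
  moreover have "p_pos t * r_pos t = f"
    unfolding p_pos_def r_pos_def f_def using n
    by (subst prod.union_disjoint[symmetric]) (auto simp: ivl_disj_un)
  ultimately show ?thesis by (simp add: g_def)
qed

lemma u_pos_eq_toeplitz: "u_pos d n t = toeplitz n (p_pos t)"
proof (rule eq_matI)
  fix i j assume "i < dim_row (toeplitz n (p_pos t))" "j < dim_col (toeplitz n (p_pos t))"
  then have "i < n" "j < n" by (auto simp: toeplitz_def)
  then show "u_pos d n t $$ (i,j) = toeplitz n (p_pos t) $$ (i,j)"
    using coeff_prod_linear_esym[of "z_pos t" d] esym_eq_0[of d _ "z_pos t"]
    by (auto simp: u_pos_def u_toeplitz_def toeplitz_index p_pos_def z_pos_def[abs_def] not_le)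
qed (auto simp: u_pos_def u_toeplitz_def toeplitz_def)

lemma u_pos_index:
  "i < n \<Longrightarrow> j < n \<Longrightarrow> u_pos d n t $$ (i,j) = (if i \<le> j then of_real (t ^ (j - i) * sin_binomial \<theta> d (j - i)) else 0)"
  by (simp add: u_pos_eq_toeplitz toeplitz_index coeff_p_pos)

lemma u_pos_in_V: "u_pos d n t \<in> V d n"
proof (cases "t = 0")
  case False
  show ?thesis unfolding u_pos_eq_toeplitz
    by (rule toeplitz_in_V[OF d c n degree_p_pos degree_r_pos p_pos_mult_r_pos]) (use False in simp_all)
next
  case True
  have "u_pos d n 0 \<in> V d n"
  proof (rule V_limit)
    fix i j assume "i < n" "j < n"
    then show "isCont (\<lambda>t. u_pos d n t $$ (i,j)) 0"
      by (cases "i \<le> j") (simp_all add: u_pos_index)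
  next
    fix t :: real assume "t \<noteq> 0"
    then show "u_pos d n t \<in> V d n" unfolding u_pos_eq_toeplitz
      by (intro toeplitz_in_V[OF d c n degree_p_pos degree_r_pos p_pos_mult_r_pos]) simp_all
  next
    show "u_pos d n 0 \<in> Uplus_e n"
      unfolding u_pos_eq_toeplitz
      by (rule toeplitz_Uplus_e[of _ _ "r_pos 0"]) (auto simp: p_pos_mult_r_pos coeff_1)
  qed
  then show ?thesis using True by simp
qed

end

text \<open>Deleting the first column and last row of the Toeplitz matrix of \<open>p\<close> of
  size m + 1 leaves this matrix, so its determinant is, up to sign, the last entry in the top row of
  the inverse, the Toeplitz matrix of \<open>r\<close>.\<close>

lemma det_toeplitz_superdiagonal:
  fixes p r :: "complex poly"
  assumes inv: "\<And>j. j \<le> m \<Longrightarrow> coeff (p * r) j = (if j = 0 then 1 else 0)" and p0: "coeff p 0 = 1"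
  shows "det (mat m m (\<lambda>(i,j). if i \<le> Suc j then coeff p (Suc j - i) else 0)) = (- 1) ^ m * coeff r m"
proof -
  define U R where "U = toeplitz (Suc m) p" and "R = toeplitz (Suc m) r"
  have Uc: "U \<in> carrier_mat (Suc m) (Suc m)" and Rc: "R \<in> carrier_mat (Suc m) (Suc m)"
    by (auto simp: U_def R_def)
  have RU: "R * U = 1\<^sub>m (Suc m)"
    unfolding U_def R_def toeplitz_mult mult.commute[of r p] by (rule toeplitz_eq_one) (use inv in auto)
  have "U \<in> Uplus (Suc m)" using p0 by (auto simp: Uplus_def U_def toeplitz_def)
  then have dU: "det U = 1" by (rule Uplus_det)
  have ac: "adj_mat U \<in> carrier_mat (Suc m) (Suc m)" using adj_mat(1)[OF Uc] .
  have "adj_mat U = R * U * adj_mat U" unfolding RU using ac by simp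
  also have "\<dots> = R * (U * adj_mat U)" by (rule assoc_mult_mat) (use Uc Rc ac in auto)
  also have "U * adj_mat U = 1\<^sub>m (Suc m)" unfolding adj_mat(2)[OF Uc] dU by (rule eq_matI) auto
  also have "R * 1\<^sub>m (Suc m) = R" using Rc by simp
  finally have "coeff r m = adj_mat U $$ (0,m)" by (simp add: R_def toeplitz_index)
  also have "\<dots> = (- 1) ^ m * det (mat m m (\<lambda>(i,j). U $$ (if i < m then i else Suc i, Suc j)))"
    using adj_mat_top_row[OF Uc, of m] by simp
  also have "mat m m (\<lambda>(i,j). U $$ (if i < m then i else Suc i, Suc j)) =
      mat m m (\<lambda>(i,j). if i \<le> Suc j then coeff p (Suc j - i) else 0)"
    by (rule eq_matI) (auto simp: U_def toeplitz_index)
  finally show ?thesis by (simp flip: mult.assoc power_add)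
qed

lemma x_coord_toeplitz:
  assumes "degree p \<le> d" "coeff p 0 = 1" "d < n"
  shows "x_coord d (toeplitz n p) k = (if 0 \<le> k then coeff p (nat k) else 0)"
proof -
  have "coeff p (nat k) = 0" if "int d < k" using that assms by (intro coeff_eq_0) linarith
  then show ?thesis using assms by (auto simp: x_coord_def toeplitz_index)
qed

lemma q_fun_toeplitz:
  assumes p: "degree p \<le> d" "coeff p 0 = 1" and r: "degree r < n" and dn: "d < n"
    and inv: "p * r = 1 + monom \<kappa> n"
  shows "q_fun d n (toeplitz n p) = (- 1) ^ (d + n) * \<kappa>"
proof -
  have n0: "0 < n" using dn by simp
  define M where "M = mat n n (\<lambda>(i,j). x_coord d (toeplitz n p) (int i - int j + 1))"
  have "transpose_mat M = mat n n (\<lambda>(i,j). if i \<le> Suc j then coeff p (Suc j - i) else 0)"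
    by (rule eq_matI) (auto simp: M_def x_coord_toeplitz[OF p dn] nat_diff_distrib of_nat_diff
        intro!: arg_cong[of _ _ "coeff p"])
  then have "det M = det (mat n n (\<lambda>(i,j). if i \<le> Suc j then coeff p (Suc j - i) else 0))"
    using det_transpose[of M n] by (simp add: M_def)
  \<comment> \<open>A determinant of size \<open>n\<close> needs an inverse of \<open>p\<close>
    modulo X^(n+1), whereas \<open>r\<close> is one only modulo X^n; subtracting \<kappa> X^n
    corrects it.\<close>
  also have "\<dots> = (- 1) ^ n * coeff (r - monom \<kappa> n) n"
  proof (rule det_toeplitz_superdiagonal[OF _ p(2)])
    fix j assume "j \<le> n"
    have "p * (r - monom \<kappa> n) = 1 + monom \<kappa> n - p * monom \<kappa> n"
      by (simp add: right_diff_distrib inv)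
    moreover have "coeff (p * monom \<kappa> n) j = (if j = n then \<kappa> else 0)"
      using \<open>j \<le> n\<close> p(2) by (auto simp: mult.commute[of p] coeff_monom_mult)
    ultimately show "coeff (p * (r - monom \<kappa> n)) j = (if j = 0 then 1 else 0)"
      using n0 by (auto simp: coeff_1)
  qed
  also have "coeff (r - monom \<kappa> n) n = - \<kappa>" using coeff_eq_0[OF r] by simp
  finally show ?thesis by (simp add: q_fun_def M_def power_add)
qed

section \<open>Evaluation of the Jacobi--Trudi determinant\<close>

lemma det_scale_rows:
  fixes M :: "nat \<Rightarrow> nat \<Rightarrow> 'a :: comm_ring_1"
  shows "det (mat m m (\<lambda>(i,j). s i * M i j)) = (\<Prod>i<m. s i) * det (mat m m (\<lambda>(i,j). M i j))"
proof -
  have "det (mat m m (\<lambda>(i,j). s i * M i j)) =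
      (\<Sum>p | p permutes {0..<m}. signof p * (\<Prod>i=0..<m. s i * M i (p i)))"
    by (subst det_def'[of _ m]) (auto intro!: sum.cong prod.cong simp: permutes_in_image)
  also have "\<dots> = (\<Sum>p | p permutes {0..<m}. (\<Prod>i<m. s i) * (signof p * (\<Prod>i=0..<m. M i (p i))))"
    by (simp add: prod.distrib atLeast0LessThan mult_ac)
  also have "\<dots> = (\<Prod>i<m. s i) * (\<Sum>p | p permutes {0..<m}. signof p * (\<Prod>i=0..<m. M i (p i)))"
    by (simp add: sum_distrib_left)
  also have "(\<Sum>p | p permutes {0..<m}. signof p * (\<Prod>i=0..<m. M i (p i))) = det (mat m m (\<lambda>(i,j). M i j))"
    by (subst det_def'[of _ m]) (auto intro!: sum.cong prod.cong simp: permutes_in_image)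
  finally show ?thesis .
qed

text \<open>Multiplication by \<open>T\<close> subtracts \<open>x m\<close> times the preceding
  column from each column, after which the last row is (1, 0, ..., 0).\<close>

lemma det_vandermonde:
  fixes x :: "nat \<Rightarrow> complex"
  shows "det (mat m m (\<lambda>(i,k). x i ^ k)) = (\<Prod>j<m. \<Prod>i<j. x j - x i)"
proof (induction m)
  case (Suc m)
  define X where "X = mat (Suc m) (Suc m) (\<lambda>(i,k). x i ^ k)"
  define T where "T = bidiag (Suc m) (\<lambda>_. - x m)"
  define Y where "Y = X * T"
  have Xc: "X \<in> carrier_mat (Suc m) (Suc m)" and Tc: "T \<in> carrier_mat (Suc m) (Suc m)"
    by (auto simp: X_def T_def bidiag_def)
  have Yc: "Y \<in> carrier_mat (Suc m) (Suc m)" using Xc Tc by (simp add: Y_def)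
  have "det T = prod_list (diag_mat T)"
    by (rule det_upper_triangular) (auto simp: T_def bidiag_def)
  also have "diag_mat T = replicate (Suc m) 1"
    by (rule nth_equalityI) (auto simp: T_def bidiag_def diag_mat_def simp del: upt_Suc replicate_Suc)
  finally have dT: "det T = 1" by (simp del: replicate_Suc)
  have Y: "Y $$ (i,k) = (if k = 0 then 1 else x i ^ (k - 1) * (x i - x m))" if "i < Suc m" "k < Suc m" for i k
  proof -
    have "Y $$ (i,k) = (\<Sum>l<Suc m. X $$ (i,l) * T $$ (l,k))"
      unfolding Y_def by (rule index_mult_mat_sum[OF Xc Tc that])
    also have "\<dots> = (\<Sum>l<Suc m. (if l = k then x i ^ k else 0) + (if l = k - 1 then if k = 0 then 0 else - (x i ^ (k - 1) * x m) else 0))"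
      by (rule sum.cong) (use that in \<open>auto simp: X_def T_def bidiag_def\<close>)
    also have "\<dots> = x i ^ k + (if k = 0 then 0 else - (x i ^ (k - 1) * x m))"
      unfolding sum.distrib using that by (auto simp: less_Suc_eq)
    also have "\<dots> = (if k = 0 then 1 else x i ^ (k - 1) * (x i - x m))"
      by (cases k) (auto simp: algebra_simps)
    finally show ?thesis .
  qed
  have "det X = det Y" using det_mult[OF Xc Tc] dT by (simp add: Y_def)
  also have "\<dots> = (\<Sum>k<Suc m. Y $$ (m,k) * cofactor Y m k)"
    by (rule laplace_expansion_row[OF Yc]) simp
  also have "\<dots> = (\<Sum>k<Suc m. if k = 0 then cofactor Y m 0 else 0)"
    by (rule sum.cong) (auto simp: Y)
  also have "\<dots> = cofactor Y m 0" by simp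
  also have "\<dots> = (- 1) ^ m * det (mat_delete Y m 0)" by (simp add: cofactor_def)
  also have "mat_delete Y m 0 = mat m m (\<lambda>(i,k). (x i - x m) * x i ^ k)"
    by (rule eq_matI) (use Yc in \<open>auto simp: mat_delete_def Y mult.commute\<close>)
  also have "(- 1) ^ m * det \<dots> = (\<Prod>i<m. - 1) * (\<Prod>i<m. x i - x m) * (\<Prod>j<m. \<Prod>i<j. x j - x i)"
    by (subst det_scale_rows) (simp add: Suc.IH)
  also have "(\<Prod>i<m. - 1) * (\<Prod>i<m. x i - x m) = (\<Prod>i<m. x m - x i)"
    by (subst prod.distrib[symmetric]) simp
  finally show ?case by (simp add: X_def)
qed simp

text \<open>Each index below \<open>m\<close> lies in \<open>m - 1\<close> of the pairs.\<close>

lemma prod_pairs_mult: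
  fixes f :: "nat \<Rightarrow> 'a :: comm_monoid_mult"
  shows "(\<Prod>j<m. \<Prod>i<j. f i * f j) = (\<Prod>i<m. f i ^ (m - 1))"
proof (induction m)
  case (Suc m)
  have "(\<Prod>i<m. f i * f m) = (\<Prod>i<m. f i) * f m ^ m" by (simp add: prod.distrib)
  then have "(\<Prod>j<Suc m. \<Prod>i<j. f i * f j) = (\<Prod>i<m. f i ^ (m - 1)) * ((\<Prod>i<m. f i) * f m ^ m)"
    by (simp only: prod.lessThan_Suc Suc.IH)
  also have "\<dots> = (\<Prod>i<m. f i ^ (m - 1) * f i) * f m ^ m"
    by (simp add: prod.distrib mult_ac)
  also have "(\<Prod>i<m. f i ^ (m - 1) * f i) = (\<Prod>i<m. f i ^ m)"
    by (rule prod.cong) (auto simp: power_eq_if mult.commute)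
  finally show ?case by simp
qed simp

text \<open>In every term of the Leibniz formula the exponents f i + p i - i add up to the sum of
  the \<open>f i\<close>, as \<open>p\<close> is a permutation. The assumption removes the terms in
  which a difference would be negative.\<close>

lemma det_graded:
  fixes f :: "nat \<Rightarrow> nat" and H :: "nat \<Rightarrow> nat \<Rightarrow> complex"
  assumes z: "\<And>i j. i < m \<Longrightarrow> j < m \<Longrightarrow> f i + j < i \<Longrightarrow> H i j = 0"
  shows "det (mat m m (\<lambda>(i,j). if i \<le> f i + j then t ^ (f i + j - i) * H i j else 0)) =
     t ^ (\<Sum>i<m. f i) * det (mat m m (\<lambda>(i,j). H i j))"
proof -
  define M where "M i j = (if i \<le> f i + j then t ^ (f i + j - i) * H i j else 0)" for i j
  have "(\<Prod>i=0..<m. M i (p i)) = t ^ (\<Sum>i<m. f i) * (\<Prod>i=0..<m. H i (p i))" if p: "p permutes {0..<m}" for p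
  proof (cases "\<forall>i<m. i \<le> f i + p i")
    case True
    have "(\<Sum>i=0..<m. f i + p i - i) + (\<Sum>i=0..<m. i) = (\<Sum>i=0..<m. f i + p i)"
      unfolding sum.distrib[symmetric] by (rule sum.cong) (use True in auto)
    also have "\<dots> = (\<Sum>i=0..<m. f i) + (\<Sum>i=0..<m. i)"
      using sum.permute[OF p, of "\<lambda>i. i"] by (simp add: sum.distrib o_def)
    finally have "(\<Sum>i=0..<m. f i + p i - i) = (\<Sum>i<m. f i)" by (simp add: atLeast0LessThan)
    moreover have "(\<Prod>i=0..<m. M i (p i)) = (\<Prod>i=0..<m. t ^ (f i + p i - i) * H i (p i))"
      by (rule prod.cong) (use True in \<open>auto simp: M_def\<close>)
    ultimately show ?thesis by (simp add: prod.distrib power_sum[symmetric])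
  next
    case False
    then obtain i where i: "i < m" "\<not> i \<le> f i + p i" by auto
    then have "p i < m" using permutes_in_image[OF p, of i] by auto
    then have "H i (p i) = 0" "M i (p i) = 0" using z[of i "p i"] i by (auto simp: M_def)
    then have "(\<Prod>i=0..<m. H i (p i)) = 0" "(\<Prod>i=0..<m. M i (p i)) = 0"
      using i by (auto intro!: prod_zero)
    then show ?thesis by (simp only: mult_zero_right)
  qed
  note eq = this
  have "det (mat m m (\<lambda>(i,j). M i j)) = (\<Sum>p | p permutes {0..<m}. signof p * (\<Prod>i=0..<m. M i (p i)))"
    by (subst det_def'[of _ m]) (auto intro!: sum.cong prod.cong simp: permutes_in_image)
  also have "\<dots> = (\<Sum>p | p permutes {0..<m}. t ^ (\<Sum>i<m. f i) * (signof p * (\<Prod>i=0..<m. H i (p i))))"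
    by (rule sum.cong[OF refl]) (simp add: eq)
  also have "\<dots> = t ^ (\<Sum>i<m. f i) * det (mat m m (\<lambda>(i,j). H i j))"
    unfolding sum_distrib_left[symmetric]
    by (subst det_def'[of _ m]) (auto intro!: sum.cong prod.cong simp: permutes_in_image)
  finally show ?thesis by (simp add: M_def)
qed

context
  fixes d c n :: nat and \<theta> :: real
  assumes d: "1 \<le> d" and c: "1 \<le> c" and n: "n = d + c" and \<theta>: "\<theta> = pi / real n"
begin

private lemma sin_frac_pos: "0 < x \<Longrightarrow> x < real n \<Longrightarrow> 0 < sin (x * \<theta>)"
  unfolding \<theta> by (rule sin_pi_frac_pos)

text \<open>
  Up to normalisation, \<open>sin_binomial \<theta> d j\<close> is \<open>sin ((j + 1) * \<theta>) * \<dots> * sin ((j + c - 1) * \<theta>)\<close>, which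
  also vanishes at \<open>j = - 1, \<dots>, - (c - 1)\<close> and is a trigonometric polynomial with only \<open>c\<close> frequencies.
\<close>

private definition h :: "real \<Rightarrow> real" where
  "h y = (\<Prod>s<c - 1. sin ((y + real s + 1) * \<theta>) / sin ((real s + 1) * \<theta>))"

private lemma h_eq_sin_binomial: "j < n \<Longrightarrow> h (real j) = sin_binomial \<theta> d j"
proof (induction j)
  case 0
  have "h 0 = 1" unfolding h_def
  proof (rule prod.neutral, rule ballI)
    fix s assume "s \<in> {..<c - 1}"
    then have "sin ((real s + 1) * \<theta>) > 0" by (intro sin_frac_pos) (auto simp: n)
    then show "sin ((0 + real s + 1) * \<theta>) / sin ((real s + 1) * \<theta>) = 1" by simp
  qed
  then show ?case by simp
next
  case (Suc j)
  define D where "D = (\<Prod>s<c - 1. sin ((real s + 1) * \<theta>))"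
  define N where "N y = (\<Prod>s<c - 1. sin ((y + real s + 1) * \<theta>))" for y
  have h: "h y = N y / D" for y by (simp add: h_def N_def D_def prod_dividef)
  have pos: "sin ((real j + 1) * \<theta>) > 0" using Suc.prems by (intro sin_frac_pos) auto
  have c': "Suc (c - 1) = c" using c by simp
  have "sin ((real j + 1) * \<theta>) * N (real (Suc j)) = (\<Prod>s<Suc (c - 1). sin ((real j + real s + 1) * \<theta>))"
    by (subst prod.lessThan_Suc_shift) (simp add: N_def algebra_simps)
  also have "\<dots> = N (real j) * sin ((real j + real c) * \<theta>)"
  proof -
    have "real j + real (c - 1) + 1 = real j + real c" using c by (simp add: of_nat_diff)
    then show ?thesis unfolding prod.lessThan_Suc N_def by simp
  qed
  \<comment> \<open>The two angles add up to (d + c) \<theta> = \<pi>. This symmetry ties the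
    product with \<open>c - 1\<close> factors to a binomial with parameter \<open>d\<close>.\<close>
  also have "sin ((real j + real c) * \<theta>) = sin ((real d - real j) * \<theta>)"
  proof -
    have "(real j + real c) * \<theta> = pi - (real d - real j) * \<theta>"
      using d by (simp add: \<theta> n field_simps)
    then show ?thesis by simp
  qed
  finally have "N (real (Suc j)) = N (real j) * (sin ((real d - real j) * \<theta>) / sin ((real j + 1) * \<theta>))"
    using pos by (simp add: field_simps)
  then have "h (real (Suc j)) = h (real j) * (sin ((real d - real j) * \<theta>) / sin ((real j + 1) * \<theta>))"
    by (simp only: h) simp
  then show ?case
    using Suc by (simp only: sin_binomial_Suc)
qed

private lemma h_neg: "0 < j \<Longrightarrow> j < c \<Longrightarrow> h (- real j) = 0"
  unfolding h_def by (rule prod_zero) (auto intro!: bexI[of _ "j - 1"] simp: of_nat_diff)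

text \<open>Each of the \<open>c - 1\<close> sines is a phase times a linear polynomial in
  \<open>cis (2 * \<theta> * y)\<close>, so the product is a phase times a polynomial of degree less
  than \<open>c\<close>.\<close>

private lemma h_exponential:
  obtains C :: "nat \<Rightarrow> complex" where
    "\<And>y. of_real (h y) = cis (- (real c - 1) * \<theta> * y) * (\<Sum>k<c. C k * cis (2 * \<theta> * y) ^ k)"
proof -
  define P where "P = (\<Prod>s<c - 1. [:- cis (- (real s + 1) * \<theta>), cis ((real s + 1) * \<theta>):])"
  define K where "K = (\<Prod>s<c - 1. 1 / (2 * \<i> * complex_of_real (sin ((real s + 1) * \<theta>))))"
  have dP: "degree P < c"
  proof -
    have "degree P \<le> (\<Sum>s<c - 1. degree [:- cis (- (real s + 1) * \<theta>), cis ((real s + 1) * \<theta>):])"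
      using degree_prod_sum_le[of "{..<c - 1}" "\<lambda>s. [:- cis (- (real s + 1) * \<theta>), cis ((real s + 1) * \<theta>):]"]
      by (simp add: P_def o_def)
    also have "\<dots> \<le> (\<Sum>s<c - 1. 1)" by (rule sum_mono) simp
    finally show ?thesis using c by simp
  qed
  have "of_real (h y) = cis (- (real c - 1) * \<theta> * y) * (\<Sum>k<c. (K * coeff P k) * cis (2 * \<theta> * y) ^ k)" for y
  proof -
    have "of_real (sin ((y + real s + 1) * \<theta>) / sin ((real s + 1) * \<theta>)) =
      cis (- \<theta> * y) * (poly [:- cis (- (real s + 1) * \<theta>), cis ((real s + 1) * \<theta>):] (cis (2 * \<theta> * y)) *
        (1 / (2 * \<i> * complex_of_real (sin ((real s + 1) * \<theta>)))))" for s
    proof -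
      have "cis (- \<theta> * y) * poly [:- cis (- (real s + 1) * \<theta>), cis ((real s + 1) * \<theta>):] (cis (2 * \<theta> * y)) =
        cis ((y + real s + 1) * \<theta>) - cis (- ((y + real s + 1) * \<theta>))"
        by (simp add: cis_mult algebra_simps)
      also have "\<dots> = 2 * \<i> * of_real (sin ((y + real s + 1) * \<theta>))"
        by (rule complex_eqI) simp_all
      finally show ?thesis by (simp add: field_simps)
    qed
    then have "of_real (h y) = (\<Prod>s<c - 1. cis (- \<theta> * y) *
      (poly [:- cis (- (real s + 1) * \<theta>), cis ((real s + 1) * \<theta>):] (cis (2 * \<theta> * y)) *
        (1 / (2 * \<i> * complex_of_real (sin ((real s + 1) * \<theta>))))))"
      unfolding h_def of_real_prod by (intro prod.cong) auto
    also have "\<dots> = cis (- \<theta> * y) ^ (c - 1) * (poly P (cis (2 * \<theta> * y)) * K)"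
      unfolding prod.distrib by (simp add: P_def K_def poly_prod)
    also have "cis (- \<theta> * y) ^ (c - 1) = cis (- (real c - 1) * \<theta> * y)"
      using c by (simp add: DeMoivre of_nat_diff algebra_simps)
    also have "poly P (cis (2 * \<theta> * y)) = (\<Sum>k<c. coeff P k * cis (2 * \<theta> * y) ^ k)"
    proof -
      have "poly P (cis (2 * \<theta> * y)) = (\<Sum>k\<le>degree P. coeff P k * cis (2 * \<theta> * y) ^ k)"
        by (rule poly_altdef)
      also have "\<dots> = (\<Sum>k<c. coeff P k * cis (2 * \<theta> * y) ^ k)"
        by (rule sum.mono_neutral_left) (use dP in \<open>auto intro: coeff_eq_0 simp: not_le\<close>)
      finally show ?thesis .
    qed
    finally show ?thesis by (simp add: sum_distrib_left mult_ac)
  qed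
  then show ?thesis by (rule that)
qed

text \<open>By the exponential form the matrix is a row scaling of a Vandermonde matrix in the
  \<open>a i\<close>, times a matrix \<open>W\<close> that does not depend on \<open>a\<close>. The
  determinant of \<open>W\<close> is found from one special \<open>a\<close>.\<close>

private lemma det_h:
  "det (mat c c (\<lambda>(i,j). complex_of_real (h (a i + real j)))) =
     of_real (\<Prod>j<c. \<Prod>i<j. sin ((a i - a j) * \<theta>) / sin ((real j - real i) * \<theta>))"
proof -
  define e1 e2 where "e1 y = cis (- (real c - 1) * \<theta> * y)" and "e2 y = cis (2 * \<theta> * y)" for y
  obtain C where C: "\<And>y. of_real (h y) = e1 y * (\<Sum>k<c. C k * e2 y ^ k)"
    using h_exponential unfolding e1_def e2_def by blast
  have p: "e1 (x + y) = e1 x * e1 y" "e2 (x + y) = e2 x * e2 y" for x y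
    by (simp_all add: e1_def e2_def cis_mult algebra_simps)
  define W where "W = mat c c (\<lambda>(k,j). C k * e2 (real j) ^ k * e1 (real j))"
  define V where "V a = mat c c (\<lambda>(i,k). e2 (a i) ^ k)" for a :: "nat \<Rightarrow> real"
  define G where "G a = (\<Prod>j<c. \<Prod>i<j. 2 * \<i> * complex_of_real (sin ((a j - a i) * \<theta>)))" for a :: "nat \<Rightarrow> real"
  have det: "det (mat c c (\<lambda>(i,j). complex_of_real (h (a i + real j)))) = G a * det W" for a
  proof -
    have Wc: "W \<in> carrier_mat c c" and Vc: "V a \<in> carrier_mat c c" by (auto simp: W_def V_def)
    have "mat c c (\<lambda>(i,j). complex_of_real (h (a i + real j))) =
        mat c c (\<lambda>(i,j). e1 (a i) * (V a * W) $$ (i,j))"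
    proof (rule eq_matI)
      fix i j assume "i < dim_row (mat c c (\<lambda>(i,j). e1 (a i) * (V a * W) $$ (i,j)))"
        "j < dim_col (mat c c (\<lambda>(i,j). e1 (a i) * (V a * W) $$ (i,j)))"
      then have ij: "i < c" "j < c" by auto
      have "(V a * W) $$ (i,j) = (\<Sum>k<c. V a $$ (i,k) * W $$ (k,j))"
        by (rule index_mult_mat_sum[OF Vc Wc ij])
      also have "\<dots> = (\<Sum>k<c. C k * e2 (a i + real j) ^ k) * e1 (real j)"
        unfolding sum_distrib_right using ij
        by (intro sum.cong) (auto simp: V_def W_def p(2) power_mult_distrib)
      finally show "mat c c (\<lambda>(i,j). complex_of_real (h (a i + real j))) $$ (i,j) =
        mat c c (\<lambda>(i,j). e1 (a i) * (V a * W) $$ (i,j)) $$ (i,j)"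
        using ij by (simp add: C p(1) mult_ac)
    qed auto
    also have "det \<dots> = (\<Prod>i<c. e1 (a i)) * det (mat c c (\<lambda>(i,j). (V a * W) $$ (i,j)))"
      by (rule det_scale_rows)
    also have "mat c c (\<lambda>(i,j). (V a * W) $$ (i,j)) = V a * W"
      by (rule eq_matI) (auto simp: V_def W_def)
    also have "det \<dots> = det (V a) * det W" by (rule det_mult[OF Vc Wc])
    also have "det (V a) = (\<Prod>j<c. \<Prod>i<j. e2 (a j) - e2 (a i))"
      unfolding V_def by (rule det_vandermonde)
    also have "\<dots> = (\<Prod>j<c. \<Prod>i<j. (cis (\<theta> * a i) * cis (\<theta> * a j)) * (2 * \<i> * complex_of_real (sin ((a j - a i) * \<theta>))))"
    proof (intro prod.cong refl)
      fix i j
      have "e2 (a j) - e2 (a i) = cis (\<theta> * a i) * cis (\<theta> * a j) * (cis ((a j - a i) * \<theta>) - cis (- ((a j - a i) * \<theta>)))"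
        by (simp add: e2_def right_diff_distrib cis_mult algebra_simps)
      also have "cis ((a j - a i) * \<theta>) - cis (- ((a j - a i) * \<theta>)) = 2 * \<i> * complex_of_real (sin ((a j - a i) * \<theta>))"
        by (rule complex_eqI) simp_all
      finally show "e2 (a j) - e2 (a i) =
        (cis (\<theta> * a i) * cis (\<theta> * a j)) * (2 * \<i> * complex_of_real (sin ((a j - a i) * \<theta>)))" .
    qed
    also have "\<dots> = (\<Prod>i<c. cis (\<theta> * a i) ^ (c - 1)) * G a"
      unfolding prod.distrib G_def prod_pairs_mult[symmetric] by (simp add: prod.distrib)
    finally have "det (mat c c (\<lambda>(i,j). complex_of_real (h (a i + real j)))) =
      ((\<Prod>i<c. e1 (a i)) * (\<Prod>i<c. cis (\<theta> * a i) ^ (c - 1))) * G a * det W"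
      by (simp add: mult_ac)
    \<comment> \<open>The Vandermonde differences leave the phase
      \<open>cis (\<theta> * a i)\<close> once for each of the \<open>c - 1\<close> pairs containing
      \<open>i\<close>, which is the inverse of \<open>e1 (a i)\<close>.\<close>
    also have "(\<Prod>i<c. e1 (a i)) * (\<Prod>i<c. cis (\<theta> * a i) ^ (c - 1)) = 1"
      unfolding prod.distrib[symmetric]
      by (rule prod.neutral) (use c in \<open>auto simp: e1_def DeMoivre cis_mult of_nat_diff algebra_simps\<close>)
    finally show ?thesis by simp
  qed
  \<comment> \<open>At a i = - i the matrix is upper unitriangular, since \<open>h\<close> vanishes
    at -1, ..., -(c - 1) and h 0 = 1. This fixes det W without knowing the coefficients
    \<open>C\<close>.\<close>
  define M0 where "M0 = mat c c (\<lambda>(i,j). complex_of_real (h (- real i + real j)))"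
  have "det M0 = prod_list (diag_mat M0)"
  proof (rule det_upper_triangular)
    show "upper_triangular M0"
    proof (rule upper_triangularI)
      fix i j assume "j < i" "i < dim_row M0"
      then show "M0 $$ (i,j) = 0"
        using h_neg[of "i - j"] by (simp add: M0_def of_nat_diff)
    qed
  qed (auto simp: M0_def)
  also have "diag_mat M0 = replicate c 1"
    using h_eq_sin_binomial[of 0] n d
    by (intro nth_equalityI) (auto simp: M0_def diag_mat_def)
  finally have "G (\<lambda>i. - real i) * det W = 1" using det[of "\<lambda>i. - real i"] by (simp add: M0_def)
  then have dW: "det W = 1 / G (\<lambda>i. - real i)" by (metis mult_zero_left nonzero_eq_divide_eq mult.commute zero_neq_one)
  have "G a * det W = (\<Prod>j<c. \<Prod>i<j. of_real (sin ((a i - a j) * \<theta>) / sin ((real j - real i) * \<theta>)))"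
    unfolding dW G_def times_divide_eq_right mult_1_right prod_dividef[symmetric]
  proof (intro prod.cong refl)
    fix i j
    have "(a j - a i) * \<theta> = - ((a i - a j) * \<theta>)" "(- real j - - real i) * \<theta> = - ((real j - real i) * \<theta>)"
      by (simp_all add: algebra_simps)
    then show "2 * \<i> * complex_of_real (sin ((a j - a i) * \<theta>)) / (2 * \<i> * complex_of_real (sin ((- real j - - real i) * \<theta>))) =
      of_real (sin ((a i - a j) * \<theta>) / sin ((real j - real i) * \<theta>))"
      by (simp del: mult_minus_left minus_diff_eq)
  qed
  then show ?thesis using det[of a] by (simp add: of_real_prod)
qed

text \<open>This is \<open>det_h\<close> at a i = \<mu> i - i: the entries replaced by 0 are values
  of \<open>h\<close> at its negative integer zeros, so \<open>det_graded\<close> can extract the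
  power of \<open>t\<close>.\<close>

lemma det_jacobi_trudi_sin:
  fixes \<mu> :: "nat \<Rightarrow> nat"
  assumes \<mu>: "\<And>i. i < c \<Longrightarrow> \<mu> i \<le> d"
  shows "det (mat c c (\<lambda>(i,j). if i \<le> \<mu> i + j then of_real t ^ (\<mu> i + j - i) * complex_of_real (sin_binomial \<theta> d (\<mu> i + j - i)) else 0)) =
    of_real (t ^ (\<Sum>i<c. \<mu> i) *
      (\<Prod>j<c. \<Prod>i<j. sin ((real (\<mu> i) - real (\<mu> j) + real j - real i) * \<theta>) / sin ((real j - real i) * \<theta>)))"
proof -
  define H where "H i j = complex_of_real (h (real (\<mu> i) - real i + real j))" for i j
  have H0: "H i j = 0" if "i < c" "j < c" "\<mu> i + j < i" for i j
  proof -
    have "real (\<mu> i) - real i + real j = - real (i - (\<mu> i + j))" using that by (simp add: of_nat_diff)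
    moreover have "h (- real (i - (\<mu> i + j))) = 0" by (rule h_neg) (use that in auto)
    ultimately show ?thesis by (simp only: H_def of_real_0)
  qed
  have H: "H i j = complex_of_real (sin_binomial \<theta> d (\<mu> i + j - i))" if "i < c" "j < c" "i \<le> \<mu> i + j" for i j
  proof -
    have "real (\<mu> i) - real i + real j = real (\<mu> i + j - i)" using that by (simp add: of_nat_diff)
    moreover have "\<mu> i + j - i < n" using that \<mu>[of i] n by simp
    ultimately show ?thesis unfolding H_def by (simp only: h_eq_sin_binomial)
  qed
  have "mat c c (\<lambda>(i,j). if i \<le> \<mu> i + j then of_real t ^ (\<mu> i + j - i) * complex_of_real (sin_binomial \<theta> d (\<mu> i + j - i)) else 0) =
    mat c c (\<lambda>(i,j). if i \<le> \<mu> i + j then of_real t ^ (\<mu> i + j - i) * H i j else 0)"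
    by (rule eq_matI) (auto simp: H)
  also have "det \<dots> = of_real t ^ (\<Sum>i<c. \<mu> i) * det (mat c c (\<lambda>(i,j). H i j))"
    by (rule det_graded) (rule H0)
  also have "det (mat c c (\<lambda>(i,j). H i j)) =
    of_real (\<Prod>j<c. \<Prod>i<j. sin ((real (\<mu> i) - real i - (real (\<mu> j) - real j)) * \<theta>) / sin ((real j - real i) * \<theta>))"
    unfolding H_def by (rule det_h)
  also have "(\<lambda>j i. real (\<mu> i) - real i - (real (\<mu> j) - real j)) = (\<lambda>j i. real (\<mu> i) - real (\<mu> j) + real j - real i)"
    by (simp add: fun_eq_iff)
  finally show ?thesis by (simp add: algebra_simps)
qed

end

section \<open>Hooks and contents\<close>

context
  fixes d c :: nat and l :: "nat \<Rightarrow> nat"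
  assumes l: "l \<in> Sh d c"
begin

private abbreviation (input) \<mu> :: "nat \<Rightarrow> nat" where "\<mu> \<equiv> conjugate_part d l"

lemma Sh_antimono: "1 \<le> i \<Longrightarrow> i \<le> j \<Longrightarrow> j \<le> d \<Longrightarrow> l j \<le> l i"
  using l by (auto simp: Sh_def)

lemma Sh_le: "l i \<le> c"
proof (cases "i \<in> {1..d}")
  case True
  then have "l i \<le> l 1" using Sh_antimono[of 1 i] by simp
  then show ?thesis using l by (simp add: Sh_def)
qed (use l in \<open>auto simp: Sh_def\<close>)

text \<open>The set counted by \<open>conjugate_part\<close> is an initial segment of {1..d},
  because the parts decrease; being in it is thus the same as being at most its cardinality.\<close>

lemma conjugate_part_iff:
  assumes i: "1 \<le> i" and j: "1 \<le> j"
  shows "i \<le> \<mu> j \<longleftrightarrow> j \<le> l i"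
proof -
  define A where "A = {i\<in>{1..d}. j \<le> l i}"
  have fin: "finite A" by (simp add: A_def)
  have "A \<subseteq> {1..card A}"
  proof
    fix k assume k: "k \<in> A"
    have "{1..k} \<subseteq> A"
    proof
      fix m assume "m \<in> {1..k}"
      then show "m \<in> A" using k Sh_antimono[of m k] by (auto simp: A_def)
    qed
    from card_mono[OF fin this] show "k \<in> {1..card A}" using k by (auto simp: A_def)
  qed
  then have "A = {1..card A}" by (intro card_subset_eq) auto
  then have "i \<in> A \<longleftrightarrow> i \<in> {1..card A}" by (rule arg_cong)
  then have "i \<le> card A \<longleftrightarrow> i \<in> A" using i by simp
  moreover have "i \<in> A \<longleftrightarrow> j \<le> l i"
  proof (cases "i \<in> {1..d}")
    case False
    then have "l i = 0" using l by (simp add: Sh_def)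
    then show ?thesis using False j by (auto simp: A_def)
  qed (simp add: A_def)
  ultimately show ?thesis by (simp add: A_def conjugate_part_def)
qed

lemma conjugate_part_le: "\<mu> j \<le> d"
proof -
  have "{i \<in> {1..d}. j \<le> l i} \<subseteq> {1..d}" by blast
  from card_mono[OF _ this] show ?thesis by (simp add: conjugate_part_def)
qed

lemma conjugate_part_antimono: "j \<le> k \<Longrightarrow> \<mu> k \<le> \<mu> j"
  unfolding conjugate_part_def by (rule card_mono) auto

lemma sum_conjugate_part: "(\<Sum>j<c. \<mu> (Suc j)) = part_size d l"
proof -
  have "(\<Sum>j<c. \<mu> (Suc j)) = (\<Sum>j=1..c. \<mu> j)"
    by (rule sum.reindex_bij_witness[of _ "\<lambda>j. j - 1" Suc]) auto
  also have "\<dots> = (\<Sum>j=1..c. \<Sum>i=1..d. if j \<le> l i then 1 else 0)"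
    by (rule sum.cong[OF refl]) (simp add: conjugate_part_def sum.If_cases Int_def)
  also have "\<dots> = (\<Sum>i=1..d. \<Sum>j=1..c. if j \<le> l i then 1 else 0)"
    by (rule sum.swap)
  also have "\<dots> = (\<Sum>i=1..d. l i)"
  proof (rule sum.cong[OF refl])
    fix i
    have "{1..c} \<inter> {j. j \<le> l i} = {1..l i}" using Sh_le[of i] by auto
    then show "(\<Sum>j=1..c. if j \<le> l i then 1 else 0) = l i"
      by (simp add: sum.If_cases)
  qed
  finally show ?thesis by (simp add: part_size_def)
qed

lemma prod_diagram:
  fixes f :: "nat \<Rightarrow> nat \<Rightarrow> 'a :: comm_monoid_mult"
  shows "(\<Prod>(i,j)\<in>diagram d l. f i j) = (\<Prod>j=1..c. \<Prod>i=1..\<mu> j. f i j)"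
proof -
  have "(\<Prod>j=1..c. \<Prod>i=1..\<mu> j. f i j) = (\<Prod>(j,i)\<in>Sigma {1..c} (\<lambda>j. {1..\<mu> j}). f i j)"
    by (rule prod.Sigma) auto
  also have "\<dots> = (\<Prod>(i,j)\<in>diagram d l. f i j)"
    by (rule prod.reindex_bij_witness[of _ prod.swap prod.swap])
      (auto simp: diagram_def conjugate_part_iff intro: order_trans[OF _ Sh_le])
  finally show ?thesis by simp
qed

text \<open>
  The hook lengths of a row of the conjugate partition are complementary in \<open>{1..\<mu> j + c - j}\<close> to the
  numbers \<open>\<mu> j - \<mu> k + k - j\<close> for \<open>j < k \<le> c\<close>.
\<close>

lemma hook_row:
  fixes f :: "int \<Rightarrow> 'a :: comm_monoid_mult"
  assumes j: "1 \<le> j" "j \<le> c"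
  shows "(\<Prod>i=1..\<mu> j. f (hook_length d l i j)) * (\<Prod>k\<in>{j<..c}. f (int (\<mu> j) - int (\<mu> k) + int k - int j))
    = (\<Prod>v=1..\<mu> j + c - j. f (int v))"
proof -
  define g where "g k = int (\<mu> j) - int (\<mu> k) + int k - int j" for k
  define A where "A = (\<lambda>i. hook_length d l i j) ` {1..\<mu> j}"
  define B where "B = g ` {j<..c}"
  have injA: "inj_on (\<lambda>i. hook_length d l i j) {1..\<mu> j}"
  proof (rule inj_onI, rule ccontr)
    fix i k assume ik: "i \<in> {1..\<mu> j}" "k \<in> {1..\<mu> j}" "hook_length d l i j = hook_length d l k j" "i \<noteq> k"
    have "hook_length d l m j < hook_length d l i j" if "1 \<le> i" "i < m" "m \<le> \<mu> j" for i m
      using Sh_antimono[of i m] conjugate_part_le[of j] that by (simp add: hook_length_def)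
    from this[of i k] this[of k i] show False using ik by (cases i k rule: linorder_cases) auto
  qed
  have injB: "inj_on g {j<..c}"
  proof (rule inj_onI, rule ccontr)
    fix k m assume km: "g k = g m" "k \<noteq> m"
    have "g k < g m" if "k < m" for k m
      using conjugate_part_antimono[of k m] that by (simp add: g_def)
    from this[of k m] this[of m k] show False using km by (cases k m rule: linorder_cases) auto
  qed
  \<comment> \<open>\<open>hook_length d l i j - g k\<close> equals (l i - k) + (\<mu> k - i) + 1.
    By \<open>conjugate_part_iff\<close> both brackets are nonnegative or both are negative, so the
    difference is not 0.\<close>
  have dis: "A \<inter> B = {}"
  proof (rule ccontr)
    assume "A \<inter> B \<noteq> {}"
    then obtain x where "x \<in> A" "x \<in> B" by blast
    then obtain i k where ik: "i \<in> {1..\<mu> j}" "k \<in> {j<..c}" "hook_length d l i j = g k"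
      unfolding A_def B_def by (metis imageE)
    then have "i \<le> \<mu> k \<longleftrightarrow> k \<le> l i" by (intro conjugate_part_iff) auto
    then show False using ik(3) by (cases "k \<le> l i") (auto simp: hook_length_def g_def)
  qed
  have sub: "A \<union> B \<subseteq> {1..int (\<mu> j + c - j)}"
  proof -
    have "hook_length d l i j \<in> {1..int (\<mu> j + c - j)}" if "i \<in> {1..\<mu> j}" for i
      using conjugate_part_iff[of i j] that j Sh_le[of i] by (auto simp: hook_length_def)
    moreover have "g k \<in> {1..int (\<mu> j + c - j)}" if "k \<in> {j<..c}" for k
      using conjugate_part_antimono[of j k] that by (auto simp: g_def)
    ultimately show ?thesis by (auto simp: A_def B_def)
  qed
  have "card (A \<union> B) = card {1..int (\<mu> j + c - j)}"
    using card_Un_disjoint[OF _ _ dis] card_image[OF injA] card_image[OF injB] j by (simp add: A_def B_def)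
  then have AB: "A \<union> B = {1..int (\<mu> j + c - j)}"
    by (intro card_subset_eq sub) auto
  have "(\<Prod>v=1..\<mu> j + c - j. f (int v)) = (\<Prod>v\<in>A \<union> B. f v)"
    unfolding AB by (rule prod.reindex_bij_witness[of _ nat int]) auto
  also have "\<dots> = (\<Prod>v\<in>A. f v) * (\<Prod>v\<in>B. f v)"
    by (rule prod.union_disjoint) (use dis in \<open>auto simp: A_def B_def\<close>)
  also have "(\<Prod>v\<in>A. f v) = (\<Prod>i=1..\<mu> j. f (hook_length d l i j))"
    unfolding A_def by (subst prod.reindex[OF injA]) (simp add: o_def)
  also have "(\<Prod>v\<in>B. f v) = (\<Prod>k\<in>{j<..c}. f (g k))"
    unfolding B_def by (subst prod.reindex[OF injB]) (simp add: o_def)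
  finally show ?thesis by (simp add: g_def)
qed

text \<open>For each \<open>j\<close>, reflection at \<pi> turns the content sines into those of c -
  j + 1, ..., c - j + \<mu> j, so that F (c - j) N = F (\<mu> j + c - j). By \<open>hook_row\<close>
  this is also D R, which gives N / D = R / F (c - j).\<close>

lemma hook_content_sin:
  assumes n: "n = d + c" and \<theta>: "\<theta> = pi / real n" and c: "1 \<le> c" and d: "1 \<le> d"
  shows "(\<Prod>(i,j)\<in>diagram d l. sin ((real d - real i + real j) * \<theta>)) /
      (\<Prod>(i,j)\<in>diagram d l. sin (real_of_int (hook_length d l i j) * \<theta>)) =
    (\<Prod>j<c. \<Prod>i<j. sin ((real (\<mu> (Suc i)) - real (\<mu> (Suc j)) + real j - real i) * \<theta>) / sin ((real j - real i) * \<theta>))"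
proof -
  define f where "f v = sin (real_of_int v * \<theta>)" for v :: int
  define F where "F m = (\<Prod>v=1..m. f (int v))" for m
  define G where "G j k = sin ((real (\<mu> j) - real (\<mu> k) + real k - real j) * \<theta>)" for j k
  have f_pos: "f v > 0" if "0 < v" "v < int n" for v
    unfolding f_def \<theta> by (rule sin_pi_frac_pos) (use that in linarith)+
  have F_pos: "F m > 0" if "m < n" for m
    unfolding F_def by (rule prod_pos) (use that in \<open>auto intro!: f_pos\<close>)
  have row: "(\<Prod>i=1..\<mu> j. sin ((real d - real i + real j) * \<theta>)) / (\<Prod>i=1..\<mu> j. sin (real_of_int (hook_length d l i j) * \<theta>))
      = (\<Prod>k\<in>{j<..c}. G j k / sin ((real k - real j) * \<theta>))" if j: "j \<in> {1..c}" for j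
  proof -
    have m: "\<mu> j \<le> d" by (rule conjugate_part_le)
    define N D R where "N = (\<Prod>i=1..\<mu> j. sin ((real d - real i + real j) * \<theta>))"
      and "D = (\<Prod>i=1..\<mu> j. sin (real_of_int (hook_length d l i j) * \<theta>))"
      and "R = (\<Prod>k\<in>{j<..c}. G j k)"
    have "N = (\<Prod>i=1..\<mu> j. f (int (c - j + i)))"
      unfolding N_def
    proof (rule prod.cong[OF refl])
      fix i assume "i \<in> {1..\<mu> j}"
      have "real_of_int (int (c - j + i)) * \<theta> = pi - (real d - real i + real j) * \<theta>"
        using j d by (simp add: \<theta> n of_nat_diff field_simps)
      then show "sin ((real d - real i + real j) * \<theta>) = f (int (c - j + i))"
        unfolding f_def by (simp only: sin_pi_minus)
    qed
    also have "\<dots> = (\<Prod>v\<in>{c - j + 1..c - j + \<mu> j}. f (int v))"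
      by (rule prod.reindex_bij_witness[of _ "\<lambda>v. v - (c - j)" "\<lambda>i. c - j + i"]) auto
    finally have "F (c - j) * N = F (c - j + \<mu> j)"
      using prod.ub_add_nat[of 1 "c - j" "\<lambda>v. f (int v)" "\<mu> j"] by (simp add: F_def)
    moreover have "c - j + \<mu> j = \<mu> j + c - j" using j by simp
    ultimately have N: "F (c - j) * N = F (\<mu> j + c - j)" by (simp only:)
    have "R = (\<Prod>k\<in>{j<..c}. f (int (\<mu> j) - int (\<mu> k) + int k - int j))"
      by (simp add: R_def G_def f_def)
    then have D: "D * R = F (\<mu> j + c - j)"
      using hook_row[of j f] j by (simp add: D_def F_def f_def)
    have E: "F (c - j) = (\<Prod>k\<in>{j<..c}. sin ((real k - real j) * \<theta>))"
      unfolding F_def f_def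
      by (rule prod.reindex_bij_witness[of _ "\<lambda>k. k - j" "\<lambda>v. v + j"]) (use j in \<open>auto simp: of_nat_diff\<close>)
    have pos: "F (c - j) > 0" "F (\<mu> j + c - j) > 0"
      using j m n d by (auto intro!: F_pos)
    then have "D \<noteq> 0" using D by auto
    then have "N / D = R / F (c - j)"
      using pos N D by (simp add: frac_eq_eq mult.commute)
    then show ?thesis
      unfolding N_def D_def E R_def by (simp add: prod_dividef)
  qed
  have "(\<Prod>(i,j)\<in>diagram d l. sin ((real d - real i + real j) * \<theta>)) /
      (\<Prod>(i,j)\<in>diagram d l. sin (real_of_int (hook_length d l i j) * \<theta>)) =
    (\<Prod>j=1..c. (\<Prod>i=1..\<mu> j. sin ((real d - real i + real j) * \<theta>)) / (\<Prod>i=1..\<mu> j. sin (real_of_int (hook_length d l i j) * \<theta>)))"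
    unfolding prod_diagram by (rule prod_dividef[symmetric])
  also have "\<dots> = (\<Prod>j=1..c. \<Prod>k\<in>{j<..c}. G j k / sin ((real k - real j) * \<theta>))"
    by (rule prod.cong[OF refl row])
  also have "\<dots> = (\<Prod>(j,k)\<in>Sigma {1..c} (\<lambda>j. {j<..c}). G j k / sin ((real k - real j) * \<theta>))"
    by (rule prod.Sigma) auto
  also have "\<dots> = (\<Prod>(j,i)\<in>Sigma {..<c} (\<lambda>j. {..<j}). G (Suc i) (Suc j) / sin ((real j - real i) * \<theta>))"
    by (rule prod.reindex_bij_witness[of _ "\<lambda>(j,i). (Suc i, Suc j)" "\<lambda>(j,k). (k - 1, j - 1)"])
      (auto simp: of_nat_diff)
  also have "\<dots> = (\<Prod>j<c. \<Prod>i<j. G (Suc i) (Suc j) / sin ((real j - real i) * \<theta>))"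
    by (rule prod.Sigma[symmetric]) auto
  also have "(\<lambda>j i. G (Suc i) (Suc j)) =
      (\<lambda>j i. sin ((real (\<mu> (Suc i)) - real (\<mu> (Suc j)) + real j - real i) * \<theta>))"
    by (simp add: G_def fun_eq_iff algebra_simps)
  finally show ?thesis .
qed

end

section \<open>Maximal minors and partitions in a box\<close>

lemma strict_mono_on_le_diff:
  fixes g :: "nat \<Rightarrow> nat"
  assumes g: "strict_mono_on {..<c} g" and "i \<le> j" "j < c"
  shows "g i + (j - i) \<le> g j"
  using assms(2,3)
proof (induction j rule: dec_induct)
  case (step j)
  then have "g j < g (Suc j)" by (intro strict_mono_onD[OF g]) auto
  then show ?case using step by simp
qed simp

text \<open>Subtracting from each chosen column its least possible position, and reading backwards,
  gives a partition \<nu> with \<open>c\<close> parts of size at most \<open>d\<close>. The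
  partition \<open>l\<close> is its conjugate.\<close>

lemma minor_partition:
  assumes c: "1 \<le> c" and g: "strict_mono_on {..<c} g" and im: "g ` {..<c} \<subseteq> {..<d + c}"
  obtains l where "l \<in> Sh d c" "\<And>i. i < c \<Longrightarrow> conjugate_part d l (Suc i) = g (c - 1 - i) - (c - 1 - i)"
proof -
  define \<nu> where "\<nu> i = g (c - 1 - i) - (c - 1 - i)" for i
  have ge: "j \<le> g j" if "j < c" for j
    using strict_mono_on_le_diff[OF g, of 0 j] that by simp
  have anti: "\<nu> j \<le> \<nu> i" if "i \<le> j" "j < c" for i j
  proof -
    have "g x - x \<le> g y - y" if "x \<le> y" "y < c" for x y
      using strict_mono_on_le_diff[OF g that] ge[of x] that by linarith
    from this[of "c - 1 - j" "c - 1 - i"] show ?thesis unfolding \<nu>_def using that c by simp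
  qed
  have le: "\<nu> i \<le> d" if "i < c" for i
  proof -
    have "g (c - 1 - i) + (c - 1 - (c - 1 - i)) \<le> g (c - 1)"
      using that c by (intro strict_mono_on_le_diff[OF g]) auto
    moreover have "c - 1 \<in> {..<c}" using c by simp
    then have "g (c - 1) < d + c" using im by blast
    ultimately show ?thesis using that by (simp add: \<nu>_def)
  qed
  define l where "l a = (if a \<in> {1..d} then card {i\<in>{..<c}. a \<le> \<nu> i} else 0)" for a
  have li: "i < l a \<longleftrightarrow> a \<le> \<nu> i" if "i < c" "a \<in> {1..d}" for i a
  proof -
    define A where "A = {i\<in>{..<c}. a \<le> \<nu> i}"
    have "A \<subseteq> {..<card A}"
    proof
      fix k assume k: "k \<in> A"
      have "{..k} \<subseteq> A"
      proof
        fix m assume "m \<in> {..k}"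
        then show "m \<in> A" using k anti[of m k] by (auto simp: A_def)
      qed
      from card_mono[OF _ this] show "k \<in> {..<card A}" by (simp add: A_def)
    qed
    then have "A = {..<card A}" by (intro card_subset_eq) auto
    then have "i \<in> A \<longleftrightarrow> i \<in> {..<card A}" by (rule arg_cong)
    then have "i < card A \<longleftrightarrow> i \<in> A" by simp
    then show ?thesis using that by (simp add: A_def l_def)
  qed
  have "l \<in> Sh d c"
  proof -
    have "l j \<le> l i" if "1 \<le> i" "i \<le> j" "j \<le> d" for i j
      using that by (auto simp: l_def intro!: card_mono)
    moreover have "l 1 \<le> c" using card_mono[of "{..<c}" "{i\<in>{..<c}. 1 \<le> \<nu> i}"] by (auto simp: l_def)
    ultimately show ?thesis by (auto simp: Sh_def l_def)
  qed
  moreover have "conjugate_part d l (Suc i) = \<nu> i" if "i < c" for i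
  proof -
    have "{a\<in>{1..d}. Suc i \<le> l a} = {1..\<nu> i}"
      using li[OF that] le[OF that] by (auto simp: Suc_le_eq)
    then show ?thesis by (simp add: conjugate_part_def)
  qed
  ultimately show ?thesis using that by (simp add: \<nu>_def)
qed

section \<open>Positivity\<close>

lemma det_permute_both:
  fixes M :: "nat \<Rightarrow> nat \<Rightarrow> 'a :: comm_ring_1"
  assumes p: "p permutes {0..<m}"
  shows "det (mat m m (\<lambda>(i,j). M (p i) (p j))) = det (mat m m (\<lambda>(i,j). M i j))"
proof -
  have lt: "p i < m" if "i < m" for i using permutes_in_image[OF p, of i] that by simp
  define A where "A = mat m m (\<lambda>(i,j). M i j)"
  define B where "B = mat m m (\<lambda>(j,i). A $$ (i, p j))"
  have c: "A \<in> carrier_mat m m" "B \<in> carrier_mat m m" by (auto simp: A_def B_def)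
  have "B = mat m m (\<lambda>(j,i). transpose_mat A $$ (p j, i))"
    by (rule eq_matI) (auto simp: A_def B_def lt)
  then have B: "det B = signof p * det A"
    using det_permute_rows[OF _ p, of "transpose_mat A"] det_transpose[of A m] c by simp
  have "mat m m (\<lambda>(i,j). M (p i) (p j)) = mat m m (\<lambda>(i,j). transpose_mat B $$ (p i, j))"
    by (rule eq_matI) (auto simp: A_def B_def lt)
  then have "det (mat m m (\<lambda>(i,j). M (p i) (p j))) = signof p * (signof p * det A)"
    using det_permute_rows[OF _ p, of "transpose_mat B"] det_transpose[of B m] c B by simp
  also have "\<dots> = det A" by (simp add: sign_def flip: of_int_mult mult.assoc)
  finally show ?thesis by (simp add: A_def)
qed

text \<open>Reflection in the antidiagonal. It matches a minor with increasing columns to the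
  Jacobi-Trudi matrix, whose rows follow the decreasing parts.\<close>

lemma det_reverse_transpose:
  fixes M :: "nat \<Rightarrow> nat \<Rightarrow> 'a :: comm_ring_1"
  shows "det (mat m m (\<lambda>(i,j). M (m - 1 - j) (m - 1 - i))) = det (mat m m (\<lambda>(i,j). M i j))"
proof -
  define p where "p i = (if i < m then m - 1 - i else i)" for i
  have p: "p permutes {0..<m}"
  proof (rule bij_imp_permutes)
    show "bij_betw p {0..<m} {0..<m}"
      by (rule bij_betw_byWitness[where f' = p]) (auto simp: p_def)
  qed (auto simp: p_def)
  have "mat m m (\<lambda>(i,j). M (m - 1 - j) (m - 1 - i)) = transpose_mat (mat m m (\<lambda>(i,j). M (p i) (p j)))"
    by (rule eq_matI) (auto simp: p_def)
  also have "det \<dots> = det (mat m m (\<lambda>(i,j). M (p i) (p j)))"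
    by (rule det_transpose[of _ m]) simp
  finally show ?thesis using det_permute_both[OF p, of M] by simp
qed

lemma schur_toeplitz:
  assumes "degree p \<le> d" "coeff p 0 = 1" "d < n"
  shows "schur d c l (toeplitz n p) = det (mat c c (\<lambda>(i,j).
    if i \<le> conjugate_part d l (Suc i) + j then coeff p (conjugate_part d l (Suc i) + j - i) else 0))"
  unfolding schur_def
  by (intro arg_cong[of _ _ det] eq_matI)
    (auto simp: x_coord_toeplitz[OF assms] nat_diff_distrib nat_add_distrib intro!: arg_cong[of _ _ "coeff p"])

lemma minor_eq_schur:
  assumes c: "1 \<le> c" and n: "n = d + c" and p: "degree p \<le> d" "coeff p 0 = 1"
    and g: "strict_mono_on {..<c} g" "g ` {..<c} \<subseteq> {..<n}"
  obtains l where "l \<in> Sh d c" "det (mat c c (\<lambda>(i,j). toeplitz n p $$ (i, g j))) = schur d c l (toeplitz n p)"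
proof -
  obtain l where l: "l \<in> Sh d c" and \<mu>: "\<And>i. i < c \<Longrightarrow> conjugate_part d l (Suc i) = g (c - 1 - i) - (c - 1 - i)"
    using minor_partition[OF c g(1), of d] g(2) n by auto
  have ge: "j \<le> g j" if "j < c" for j
    using strict_mono_on_le_diff[OF g(1), of 0 j] that by simp
  have "schur d c l (toeplitz n p) = det (mat c c (\<lambda>(i,j). toeplitz n p $$ (c - 1 - j, g (c - 1 - i))))"
  proof -
    have dn: "d < n" using c n by simp
    show ?thesis unfolding schur_toeplitz[OF p dn]
    proof (rule arg_cong[of _ _ det], rule eq_matI)
      fix i j assume "i < dim_row (mat c c (\<lambda>(i,j). toeplitz n p $$ (c - 1 - j, g (c - 1 - i))))"
        "j < dim_col (mat c c (\<lambda>(i,j). toeplitz n p $$ (c - 1 - j, g (c - 1 - i))))"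
      then have ij: "i < c" "j < c" by auto
      define a b where "a = c - 1 - i" and "b = c - 1 - j"
      have ab: "a < c" "b < c" "i + a = j + b" using ij by (auto simp: a_def b_def)
      have gn: "g a < n" "b < n" using g(2) ab n by auto
      have "conjugate_part d l (Suc i) + a = g a" using \<mu>[OF ij(1)] ge[OF ab(1)] by (simp add: a_def)
      then have "i \<le> conjugate_part d l (Suc i) + j \<longleftrightarrow> b \<le> g a" "conjugate_part d l (Suc i) + j - i = g a - b"
        using ab(3) by linarith+
      then have "(if i \<le> conjugate_part d l (Suc i) + j then coeff p (conjugate_part d l (Suc i) + j - i) else 0) = toeplitz n p $$ (b, g a)"
        using toeplitz_index[OF gn(2,1), of p] by simp
      then show "mat c c (\<lambda>(i,j). if i \<le> conjugate_part d l (Suc i) + j then coeff p (conjugate_part d l (Suc i) + j - i) else 0) $$ (i,j) =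
        mat c c (\<lambda>(i,j). toeplitz n p $$ (c - 1 - j, g (c - 1 - i))) $$ (i,j)"
        using ij by (simp add: a_def b_def)
    qed auto
  qed
  also have "\<dots> = det (mat c c (\<lambda>(i,j). toeplitz n p $$ (i, g j)))"
    by (rule det_reverse_transpose)
  finally show ?thesis using that[OF l] by simp
qed

lemma det_mat_upper_triangular:
  fixes M :: "nat \<Rightarrow> nat \<Rightarrow> 'a :: comm_ring_1"
  assumes "\<And>i j. j < i \<Longrightarrow> i < m \<Longrightarrow> M i j = 0"
  shows "det (mat m m (\<lambda>(i,j). M i j)) = (\<Prod>i<m. M i i)"
proof -
  have "det (mat m m (\<lambda>(i,j). M i j)) = prod_list (diag_mat (mat m m (\<lambda>(i,j). M i j)))"
    by (rule det_upper_triangular) (use assms in \<open>auto simp: upper_triangular_def\<close>)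
  also have "diag_mat (mat m m (\<lambda>(i,j). M i j)) = map (\<lambda>i. M i i) [0..<m]"
    by (auto simp: diag_mat_def)
  finally show ?thesis by (simp add: prod.list_conv_set_nth atLeast0LessThan)
qed

context
  fixes d c n :: nat and \<theta> :: real
  assumes d: "1 \<le> d" and c: "1 \<le> c" and n: "n = d + c" and \<theta>: "\<theta> = pi / real n"
begin

private lemma d_less_n: "d < n" using c n by simp

private lemmas ctx = d c n \<theta>

private lemma u_pos_eq: "u_pos d n t = toeplitz n (p_pos d n t)"
  by (rule u_pos_eq_toeplitz[OF ctx])

lemma schur_u_pos:
  assumes l: "l \<in> Sh d c"
  shows "schur d c l (u_pos d n t) = of_real (t ^ part_size d l *
    (\<Prod>j<c. \<Prod>i<j. sin ((real (conjugate_part d l (Suc i)) - real (conjugate_part d l (Suc j)) + real j - real i) * \<theta>) / sin ((real j - real i) * \<theta>)))"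
proof -
  have "schur d c l (u_pos d n t) = det (mat c c (\<lambda>(i,j).
    if i \<le> conjugate_part d l (Suc i) + j then
      of_real t ^ (conjugate_part d l (Suc i) + j - i) * complex_of_real (sin_binomial \<theta> d (conjugate_part d l (Suc i) + j - i)) else 0))"
    unfolding u_pos_eq schur_toeplitz[OF degree_p_pos[OF ctx] coeff_p_pos_0[OF ctx] d_less_n] coeff_p_pos[OF ctx]
    by (simp only: of_real_mult of_real_power)
  also have "\<dots> = of_real (t ^ (\<Sum>i<c. conjugate_part d l (Suc i)) *
    (\<Prod>j<c. \<Prod>i<j. sin ((real (conjugate_part d l (Suc i)) - real (conjugate_part d l (Suc j)) + real j - real i) * \<theta>) / sin ((real j - real i) * \<theta>)))"
    by (rule det_jacobi_trudi_sin[OF ctx]) (rule conjugate_part_le[OF l])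
  finally show ?thesis by (simp only: sum_conjugate_part[OF l])
qed

lemma schur_u_pos_hooks:
  assumes l: "l \<in> Sh d c"
  shows "schur d c l (u_pos d n t) = of_real (t ^ part_size d l *
    ((\<Prod>(i,j)\<in>diagram d l. sin ((real d - real i + real j) * \<theta>)) /
     (\<Prod>(i,j)\<in>diagram d l. sin (real_of_int (hook_length d l i j) * \<theta>))))"
  unfolding schur_u_pos[OF l] hook_content_sin[OF l n \<theta> c d] ..

lemma schur_u_pos_positive:
  assumes l: "l \<in> Sh d c" and t: "0 < t"
  obtains s where "0 < s" "schur d c l (u_pos d n t) = complex_of_real s"
proof -
  have "0 < (\<Prod>j<c. \<Prod>i<j. sin ((real (conjugate_part d l (Suc i)) - real (conjugate_part d l (Suc j)) + real j - real i) * \<theta>) / sin ((real j - real i) * \<theta>))"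
  proof (intro prod_pos divide_pos_pos)
    fix j i assume "j \<in> {..<c}" "i \<in> {..<j}"
    then have ij: "i < j" "j < c" by auto
    have "conjugate_part d l (Suc j) \<le> conjugate_part d l (Suc i)"
      using ij by (intro conjugate_part_antimono[OF l]) simp
    moreover have "conjugate_part d l (Suc i) \<le> d" by (rule conjugate_part_le[OF l])
    ultimately show "0 < sin ((real (conjugate_part d l (Suc i)) - real (conjugate_part d l (Suc j)) + real j - real i) * \<theta>)"
      unfolding \<theta> using ij n by (intro sin_pi_frac_pos) linarith+
    show "0 < sin ((real j - real i) * \<theta>)"
      unfolding \<theta> using ij n by (intro sin_pi_frac_pos) linarith+
  qed
  from that[OF mult_pos_pos[OF zero_less_power[OF t] this] schur_u_pos[OF l]] show ?thesis .
qed

text \<open>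
  If \<open>z\<close> is a root of \<open>p r = 1 + \<kappa> X^n\<close> but not of \<open>p\<close>, then \<open>p r / (X - z)\<close> is a multiple of \<open>p\<close> of degree
  less than \<open>n\<close> with coefficients proportional to \<open>z^(-m)\<close>. So \<open>(z^(-m))\<close> lies in the row space of the
  top \<open>c\<close> rows for \<open>p\<close>. If \<open>z\<close> is a root of the real polynomial \<open>q\<close>, the weights \<open>|z|^(2 m)\<close> turn it into
  \<open>(cnj z ^ m)\<close>, which annihilates the top \<open>c\<close> rows for \<open>q\<close>.
\<close>

private lemma toeplitz_det_zero:
  assumes p: "degree p \<le> d" "coeff p 0 = 1" and q: "degree q \<le> d" "\<And>k. coeff q k \<in> \<real>"
    and r: "degree r \<le> c" and inv: "p * r = 1 + monom \<kappa> n"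
    and z: "1 + \<kappa> * z ^ n = 0" "poly p z \<noteq> 0" "poly q z = 0"
  shows "det (mat c c (\<lambda>(i,j). \<Sum>m<n. toeplitz n p $$ (i,m) * (of_real (cmod z ^ 2) ^ m * toeplitz n q $$ (j,m)))) = 0"
proof -
  have n0: "0 < n" using d n by simp
  have z0: "z \<noteq> 0" using z(1) n0 by (auto simp: power_0_left)
  have "poly (p * r) z = 0" using z(1) by (simp only: inv poly_add poly_monom) simp
  then have "poly r z = 0" using z(2) by simp
  then obtain s where s: "r = [:- z, 1:] * s" by (auto simp: poly_eq_0_iff_dvd elim: dvdE)
  define g where "g = p * s"
  have gz: "[:- z, 1:] * g = 1 + monom \<kappa> n"
    using inv by (simp only: g_def s mult_ac)
  have gS: "coeff g k - z * coeff g (Suc k) = coeff (1 + monom \<kappa> n) (Suc k)" for k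
    unfolding gz[symmetric] by simp
  have g0: "- z * coeff g 0 = 1" using arg_cong[OF gz, of "\<lambda>f. coeff f 0"] n0 by simp
  have gm: "coeff g m = - ((1 / z) ^ Suc m)" if "m < n" for m
    using that
  proof (induction m)
    case 0
    have "z * coeff g 0 = - 1" using g0 by (metis minus_minus minus_mult_left)
    then show ?case using z0 by (simp add: field_simps)
  next
    case (Suc m)
    then show ?case using gS[of m] z0 by (simp add: coeff_1 field_simps)
  qed
  have s0: "s \<noteq> 0"
  proof
    assume "s = 0"
    then have "g = 0" by (simp add: g_def)
    then show False using g0 by simp
  qed
  then have "degree r = Suc (degree s)" unfolding s by (subst degree_mult_eq) auto
  then have ds: "degree s < c" using r by simp
  define y where "y = vec c (\<lambda>i. coeff s i)"
  have y0: "y \<noteq> 0\<^sub>v c"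
  proof
    assume "y = 0\<^sub>v c"
    then have "coeff s (degree s) = 0" using ds by (metis index_vec index_zero_vec(1) y_def)
    then show False using s0 by simp
  qed
  define \<rho> where "\<rho> = complex_of_real (cmod z ^ 2)"
  have \<rho>: "\<rho> = z * cnj z" unfolding \<rho>_def by (rule complex_norm_square)
  have row: "(\<Sum>i<c. coeff s i * toeplitz n p $$ (i,m)) = - ((1 / z) ^ Suc m)" if m: "m < n" for m
  proof -
    have "(\<Sum>i<c. coeff s i * toeplitz n p $$ (i,m)) = (\<Sum>i<c. if i \<le> m then coeff s i * coeff p (m - i) else 0)"
      using m n by (intro sum.cong) (auto simp: toeplitz_index)
    also have "\<dots> = (\<Sum>i\<in>{..m} \<inter> {..<c}. coeff s i * coeff p (m - i))"
      by (rule sum.mono_neutral_cong_right) auto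
    also have "\<dots> = (\<Sum>i\<le>m. coeff s i * coeff p (m - i))"
      by (rule sum.mono_neutral_left) (use ds in \<open>auto dest: le_degree\<close>)
    also have "\<dots> = coeff g m" by (simp add: g_def coeff_mult mult.commute[of p s])
    finally show ?thesis using gm[OF m] by simp
  qed
  have col: "(\<Sum>m<n. cnj z ^ m * toeplitz n q $$ (j,m)) = 0" if j: "j < c" for j
  proof -
    have "(\<Sum>m<n. cnj z ^ m * toeplitz n q $$ (j,m)) = (\<Sum>m<n. if j \<le> m then cnj z ^ m * coeff q (m - j) else 0)"
      using j n by (intro sum.cong) (auto simp: toeplitz_index)
    also have "\<dots> = (\<Sum>m\<in>{j..<n}. cnj z ^ m * coeff q (m - j))"
      by (rule sum.mono_neutral_cong_right) auto
    also have "\<dots> = (\<Sum>a<n - j. cnj z ^ j * (coeff q a * cnj z ^ a))"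
      by (rule sum.reindex_bij_witness[of _ "\<lambda>a. a + j" "\<lambda>m. m - j"]) (auto simp: power_add[symmetric])
    also have "\<dots> = cnj z ^ j * (\<Sum>a<n - j. coeff q a * cnj z ^ a)"
      by (simp add: sum_distrib_left)
    also have "(\<Sum>a<n - j. coeff q a * cnj z ^ a) = (\<Sum>a\<le>degree q. coeff q a * cnj z ^ a)"
      by (rule sum.mono_neutral_right) (use q(1) j n in \<open>auto simp: coeff_eq_0 not_le\<close>)
    also have "\<dots> = cnj (poly q z)"
    proof -
      have "cnj (coeff q a) = coeff q a" for a using q(2)[of a] by (simp add: Reals_cnj_iff)
      then show ?thesis unfolding poly_altdef cnj_sum by simp
    qed
    finally show ?thesis using z(3) by simp
  qed
  define G where "G = mat c c (\<lambda>(i,j). \<Sum>m<n. toeplitz n p $$ (i,m) * (\<rho> ^ m * toeplitz n q $$ (j,m)))"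
  \<comment> \<open>The transpose appears because the coefficients of \<open>s\<close> combine the
    rows of \<open>G\<close>.\<close>
  have "transpose_mat G *\<^sub>v y = 0\<^sub>v c"
  proof (rule eq_vecI)
    fix j assume "j < dim_vec (0\<^sub>v c :: complex vec)"
    then have j: "j < c" by simp
    have "(transpose_mat G *\<^sub>v y) $ j = (\<Sum>i<c. (\<Sum>m<n. toeplitz n p $$ (i,m) * (\<rho> ^ m * toeplitz n q $$ (j,m))) * coeff s i)"
      using j by (simp add: G_def y_def scalar_prod_def atLeast0LessThan)
    also have "\<dots> = (\<Sum>m<n. (\<Sum>i<c. coeff s i * toeplitz n p $$ (i,m)) * (\<rho> ^ m * toeplitz n q $$ (j,m)))"
      unfolding sum_distrib_right by (subst sum.swap) (simp add: mult_ac)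
    \<comment> \<open>With \<rho> = z * cnj z, the product of \<rho>^m and z^(-m-1) is cnj z ^ m /
      z.\<close>
    also have "\<dots> = (\<Sum>m<n. - (1 / z) * (cnj z ^ m * toeplitz n q $$ (j,m)))"
      by (rule sum.cong) (use z0 in \<open>auto simp: row \<rho> power_mult_distrib field_simps\<close>)
    also have "\<dots> = 0" unfolding sum_distrib_left[symmetric] col[OF j] by simp
    finally show "(transpose_mat G *\<^sub>v y) $ j = 0\<^sub>v c $ j" using j by simp
  qed (simp add: G_def)
  moreover have "transpose_mat G \<in> carrier_mat c c" "y \<in> carrier_vec c" by (auto simp: G_def y_def)
  ultimately have "det (transpose_mat G) = 0" using y0 det_0_iff_vec_prod_zero by blast
  then show ?thesis using det_transpose[of G c] by (simp add: G_def \<rho>_def)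
qed

text \<open>The common consequence of total nonnegativity and of nonnegativity of all
  \<open>s_\<lambda>\<close>; the classification is carried out from it once for both.\<close>

definition pluecker_nonneg :: "complex mat \<Rightarrow> bool" where
  "pluecker_nonneg u \<longleftrightarrow> (\<forall>g. strict_mono_on {..<c} g \<and> g ` {..<c} \<subseteq> {..<n} \<longrightarrow>
     det (mat c c (\<lambda>(i,j). u $$ (i, g j))) \<in> \<real>\<^sub>\<ge>\<^sub>0)"

private lemma u_pos_minor_positive:
  assumes t: "0 < t" and g: "strict_mono_on {..<c} g" "g ` {..<c} \<subseteq> {..<n}"
  obtains s where "0 < s" "det (mat c c (\<lambda>(i,j). u_pos d n t $$ (i, g j))) = complex_of_real s"
proof -
  obtain l where "l \<in> Sh d c" "det (mat c c (\<lambda>(i,j). u_pos d n t $$ (i, g j))) = schur d c l (u_pos d n t)"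
    unfolding u_pos_eq
    using minor_eq_schur[OF c n degree_p_pos[OF ctx] coeff_p_pos_0[OF ctx] g] by blast
  then show ?thesis using that schur_u_pos_positive[OF _ t, of l] by metis
qed

private lemma gram_det_nonzero:
  assumes pn: "pluecker_nonneg (toeplitz n p)" and p0: "coeff p 0 = 1" and t: "0 < t" and z: "z \<noteq> 0"
  shows "det (mat c c (\<lambda>(i,j). \<Sum>m<n. toeplitz n p $$ (i,m) * (of_real (cmod z ^ 2) ^ m * u_pos d n t $$ (j,m)))) \<noteq> 0"
proof -
  define \<rho> where "\<rho> = cmod z ^ 2"
  have \<rho>: "0 < \<rho>" using z by (simp add: \<rho>_def)
  define T where "T K = det (mat c c (\<lambda>(i,j). toeplitz n p $$ (i, pick K j))) *
       det (mat c c (\<lambda>(i,j). of_real \<rho> ^ pick K i * u_pos d n t $$ (j, pick K i)))" for K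
  define KS where "KS = {K. K \<subseteq> {..<n} \<and> card K = c}"
  have det: "det (mat c c (\<lambda>(i,j). \<Sum>m<n. toeplitz n p $$ (i,m) * (of_real \<rho> ^ m * u_pos d n t $$ (j,m)))) = (\<Sum>K\<in>KS. T K)"
    unfolding T_def KS_def by (rule cauchy_binet)
  have pick: "strict_mono_on {..<c} (pick K)" "pick K ` {..<c} \<subseteq> {..<n}" if "K \<in> KS" for K
    using that pick_strict_mono_on[of K] pick_image[of K] finite_subset[of K "{..<n}"] by (auto simp: KS_def)
  have second: "\<exists>s>0. det (mat c c (\<lambda>(i,j). of_real \<rho> ^ pick K i * u_pos d n t $$ (j, pick K i))) = complex_of_real s"
    if K: "K \<in> KS" for K
  proof -
    obtain s where s: "0 < s" "det (mat c c (\<lambda>(i,j). u_pos d n t $$ (i, pick K j))) = complex_of_real s"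
      using u_pos_minor_positive[OF t pick[OF K]] by blast
    have "det (mat c c (\<lambda>(i,j). of_real \<rho> ^ pick K i * u_pos d n t $$ (j, pick K i))) =
        (\<Prod>i<c. of_real \<rho> ^ pick K i) * det (mat c c (\<lambda>(i,j). u_pos d n t $$ (j, pick K i)))"
      by (rule det_scale_rows)
    also have "mat c c (\<lambda>(i,j). u_pos d n t $$ (j, pick K i)) = transpose_mat (mat c c (\<lambda>(i,j). u_pos d n t $$ (i, pick K j)))"
      by (rule eq_matI) auto
    also have "det \<dots> = complex_of_real s" using s(2) by (subst det_transpose[of _ c]) auto
    finally show ?thesis using s(1) \<rho>
      by (intro exI[of _ "(\<Prod>i<c. \<rho> ^ pick K i) * s"]) (auto intro!: mult_pos_pos prod_pos)
  qed
  have nonneg: "0 \<le> Re (T K)" if K: "K \<in> KS" for K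
  proof -
    have "det (mat c c (\<lambda>(i,j). toeplitz n p $$ (i, pick K j))) \<in> \<real>\<^sub>\<ge>\<^sub>0"
      using pn pick[OF K] by (simp add: pluecker_nonneg_def)
    then show ?thesis using second[OF K] by (auto simp: T_def complex_nonneg_Reals_iff)
  qed
  \<comment> \<open>The leading columns form an upper unitriangular matrix for \<open>p\<close>, so
    this term is positive whatever the other minors are.\<close>
  have K0: "{..<c} \<in> KS" using n by (auto simp: KS_def)
  have pick0: "pick {..<c} j = j" if "j < c" for j
    using pick_strict_mono_image[of c "\<lambda>j. j" j] that by (simp add: strict_mono_on_def)
  have "mat c c (\<lambda>(i,j). toeplitz n p $$ (i, pick {..<c} j)) = mat c c (\<lambda>(i,j). toeplitz n p $$ (i, j))"
    by (rule eq_matI) (auto simp: pick0)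
  moreover have "det (mat c c (\<lambda>(i,j). toeplitz n p $$ (i, j))) = (\<Prod>i<c. toeplitz n p $$ (i, i))"
    by (rule det_mat_upper_triangular) (use n in \<open>auto simp: toeplitz_index\<close>)
  moreover have "(\<Prod>i<c. toeplitz n p $$ (i, i)) = 1"
    by (rule prod.neutral) (use n p0 in \<open>auto simp: toeplitz_index\<close>)
  ultimately have "0 < Re (T {..<c})" using second[OF K0] by (auto simp: T_def)
  moreover have "finite KS" unfolding KS_def by (rule finite_subset[of _ "Pow {..<n}"]) auto
  ultimately have "0 < (\<Sum>K\<in>KS. Re (T K))"
    using nonneg K0 by (intro sum_pos2[of KS "{..<c}"]) auto
  then have "Re (\<Sum>K\<in>KS. T K) \<noteq> 0" by simp
  then show ?thesis unfolding det[symmetric] \<rho>_def by auto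
qed

lemma pluecker_nonneg_imp_u_pos:
  assumes u: "u \<in> V d n" and pn: "pluecker_nonneg u"
  obtains t where "0 \<le> t" "u = u_pos d n t"
proof -
  obtain p r where pr: "u = toeplitz n p" "degree p \<le> d" "degree r \<le> c" "coeff p 0 = 1"
    "p * r = 1 + monom (coeff p d * coeff r c) n"
    using V_polys[OF d c n u] by blast
  have "coeff p d \<in> \<real>\<^sub>\<ge>\<^sub>0"
  proof -
    \<comment> \<open>With columns 0, ..., c - 2 and n - 1 the submatrix is triangular, and its only
      diagonal entry other than 1 is the one at (c - 1, n - 1).\<close>
    define g where "g j = (if j = c - 1 then n - 1 else j)" for j
    have "det (mat c c (\<lambda>(i,j). u $$ (i, g j))) = (\<Prod>i<c. u $$ (i, g i))"
      by (rule det_mat_upper_triangular) (use n in \<open>auto simp: pr(1) g_def toeplitz_index\<close>)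
    also have "\<dots> = (\<Prod>i\<in>{..<c} - {c - 1}. u $$ (i, g i)) * u $$ (c - 1, g (c - 1))"
      using c by (subst prod.remove[of _ "c - 1"]) (auto simp: mult.commute)
    also have "(\<Prod>i\<in>{..<c} - {c - 1}. u $$ (i, g i)) = 1"
      by (rule prod.neutral) (use n pr(4) in \<open>auto simp: pr(1) g_def toeplitz_index\<close>)
    also have "u $$ (c - 1, g (c - 1)) = coeff p d"
      using n d c by (auto simp: pr(1) g_def toeplitz_index)
    finally have "det (mat c c (\<lambda>(i,j). u $$ (i, g j))) = coeff p d" by simp
    moreover have "strict_mono_on {..<c} g" "g ` {..<c} \<subseteq> {..<n}"
      using d n by (auto simp: g_def strict_mono_on_def)
    ultimately show ?thesis using pn[unfolded pluecker_nonneg_def, rule_format, of g] by simp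
  qed
  moreover have "(- 1) ^ c * coeff r c \<in> \<real>\<^sub>\<ge>\<^sub>0"
  proof -
    \<comment> \<open>Columns 1, ..., c: this minor gives the leading coefficient of
      \<open>r\<close>, so that both factors of \<kappa> are under control.\<close>
    have "det (mat c c (\<lambda>(i,j). if i \<le> Suc j then coeff p (Suc j - i) else 0)) = (- 1) ^ c * coeff r c"
      by (rule det_toeplitz_superdiagonal) (use pr d_less_n n d in \<open>auto simp: coeff_1\<close>)
    moreover have "mat c c (\<lambda>(i,j). u $$ (i, Suc j)) = mat c c (\<lambda>(i,j). if i \<le> Suc j then coeff p (Suc j - i) else 0)"
      by (rule eq_matI) (use n d in \<open>auto simp: pr(1) toeplitz_index\<close>)
    moreover have "strict_mono_on {..<c} Suc" "Suc ` {..<c} \<subseteq> {..<n}"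
      using d n by (auto simp: strict_mono_on_def)
    ultimately show ?thesis using pn[unfolded pluecker_nonneg_def, rule_format, of Suc] by simp
  qed
  ultimately have "coeff p d * ((- 1) ^ c * coeff r c) \<in> \<real>\<^sub>\<ge>\<^sub>0" by (rule nonneg_Reals_mult_I)
  then obtain \<tau> where \<tau>: "0 \<le> \<tau>" "coeff p d * ((- 1) ^ c * coeff r c) = complex_of_real \<tau>"
    by (auto elim: nonneg_Reals_cases)
  define t where "t = root n \<tau>"
  have n0: "0 < n" using d n by simp
  have t: "0 \<le> t" "t ^ n = \<tau>" using \<tau>(1) n0 by (simp_all add: t_def)
  have "coeff p d * coeff r c = (- 1) ^ c * ((- 1) ^ c * (coeff p d * coeff r c))"
    by (simp flip: mult.assoc power_add)
  also have "\<dots> = (- 1) ^ c * of_real t ^ n"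
    using \<tau>(2) t(2) by (simp add: mult_ac flip: of_real_power)
  finally have \<kappa>: "coeff p d * coeff r c = (- 1) ^ c * of_real t ^ n" .
  have "p = p_pos d n t"
  proof (cases "t = 0")
    case True
    then have "p * r = 1" using pr(5) n0 by (simp add: \<kappa> power_0_left)
    then have "is_unit p" by (metis dvd_triv_left)
    then have "degree p = 0" by (simp add: is_unit_poly_iff) auto
    then have "coeff p k = (if k = 0 then 1 else 0)" for k using pr(4) by (simp add: coeff_eq_0)
    moreover have "coeff (p_pos d n 0) k = (if k = 0 then 1 else 0)" for k
      unfolding coeff_p_pos[OF ctx] by (simp add: power_0_left)
    ultimately show ?thesis using True by (simp add: poly_eq_iff)
  next
    case False
    then have t0: "0 < t" using t by simp
    let ?z = "z_pos d n t"
    have z0: "?z k \<noteq> 0" for k using False by (simp add: z_pos_eq[OF ctx])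
    have root_pos: "poly (p_pos d n t) (- 1 / ?z k) = 0" if "k < d" for k
      unfolding p_pos_def[OF ctx] using that z0 by (intro poly_prod_linear_root) auto
    \<comment> \<open>The point is a root of \<open>p * r\<close>, which coincides with
      \<open>p_pos d n t * r_pos d n t\<close>. If \<open>p\<close> missed it, the Gram determinant
      would be zero by \<open>toeplitz_det_zero\<close> and nonzero by
      \<open>gram_det_nonzero\<close>.\<close>
    have root: "poly p (- 1 / ?z k) = 0" if k: "k < d" for k
    proof (rule ccontr)
      assume np: "poly p (- 1 / ?z k) \<noteq> 0"
      define z where "z = - 1 / ?z k"
      have "poly (p_pos d n t * r_pos d n t) z = 0" using root_pos[OF k] by (simp add: z_def)
      then have "1 + (- 1) ^ c * of_real t ^ n * z ^ n = 0"
        unfolding p_pos_mult_r_pos[OF ctx] by (simp add: poly_monom)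
      then have "det (mat c c (\<lambda>(i,j). \<Sum>m<n. toeplitz n p $$ (i,m) * (of_real (cmod z ^ 2) ^ m * toeplitz n (p_pos d n t) $$ (j,m)))) = 0"
        using np root_pos[OF k]
        by (intro toeplitz_det_zero[OF pr(2,4) degree_p_pos[OF ctx] _ pr(3,5)])
          (auto simp: \<kappa> z_def coeff_p_pos[OF ctx])
      moreover have "z \<noteq> 0" using z0 by (simp add: z_def)
      ultimately show False
        using gram_det_nonzero[of p t z] pn pr t0 by (simp add: u_pos_eq)
    qed
    \<comment> \<open>Together with 0, where both polynomials are 1, these are d + 1 points of
      agreement, enough for degree at most \<open>d\<close>.\<close>
    define R where "R = (\<lambda>k. - 1 / ?z k) ` {..<d}"
    have "inj_on ?z {..<d}" by (rule inj_on_subset[OF z_pos_inj[OF ctx False]]) (use n in auto)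
    then have "card R = d" unfolding R_def using z0 by (subst card_image) (auto simp: inj_on_def)
    moreover have "0 \<notin> R" using z0 by (auto simp: R_def)
    ultimately have "card (insert 0 R) = Suc d" by (simp add: R_def)
    then show ?thesis
      using pr(2) degree_p_pos[OF ctx, of t] pr(4) coeff_p_pos_0[OF ctx, of t] root root_pos
      by (intro poly_eqI_degree[of "insert 0 R"]) (auto simp: R_def poly_0_coeff_0)
  qed
  then show ?thesis using that[of t] t(1) pr(1) by (simp add: u_pos_eq)
qed

lemma u_pos_totally_nonneg: "0 \<le> t \<Longrightarrow> totally_nonneg n (u_pos d n t)"
proof -
  assume t: "0 \<le> t"
  have "u_pos d n t = mat n n (\<lambda>(i,m). if i \<le> m then complex_of_real (t ^ (m - i) * sin_binomial \<theta> d (m - i)) else 0)"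
    unfolding u_pos_eq toeplitz_def coeff_p_pos[OF ctx] ..
  then show ?thesis
    using sin_binomial_toeplitz_minors_nonneg[OF ctx t] totally_nonneg_iff_minors[of "u_pos d n t" n]
    by (simp add: u_pos_eq)
qed

lemma totally_nonneg_imp_pluecker_nonneg:
  assumes "u \<in> carrier_mat n n" "totally_nonneg n u"
  shows "pluecker_nonneg u"
  unfolding pluecker_nonneg_def
proof (intro allI impI, elim conjE)
  fix g :: "nat \<Rightarrow> nat" assume "strict_mono_on {..<c} g" "g ` {..<c} \<subseteq> {..<n}"
  moreover have "minors_nonneg n u" using assms totally_nonneg_iff_minors by blast
  ultimately show "det (mat c c (\<lambda>(i,j). u $$ (i, g j))) \<in> \<real>\<^sub>\<ge>\<^sub>0"
    using n minors_nonneg_def[THEN iffD1, rule_format, of n u c "\<lambda>i. i" g]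
    by (auto simp: strict_mono_on_def)
qed

lemma schur_nonneg_imp_pluecker_nonneg:
  assumes u: "u \<in> V d n" and s: "\<And>l. l \<in> Sh d c \<Longrightarrow> schur d c l u \<in> \<real>\<^sub>\<ge>\<^sub>0"
  shows "pluecker_nonneg u"
  unfolding pluecker_nonneg_def
proof (intro allI impI, elim conjE)
  fix g :: "nat \<Rightarrow> nat" assume g: "strict_mono_on {..<c} g" "g ` {..<c} \<subseteq> {..<n}"
  obtain p where p: "u = toeplitz n p" "degree p \<le> d" "coeff p 0 = 1"
    using V_polys[OF d c n u] by metis
  obtain l where "l \<in> Sh d c" "det (mat c c (\<lambda>(i,j). toeplitz n p $$ (i, g j))) = schur d c l (toeplitz n p)"
    by (rule minor_eq_schur[OF c n p(2,3) g])
  then show "det (mat c c (\<lambda>(i,j). u $$ (i, g j))) \<in> \<real>\<^sub>\<ge>\<^sub>0"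
    using s[of l] p(1) by simp
qed

end

section \<open>The homeomorphisms\<close>

lemma continuous_map_mat_topology_index:
  "i < n \<Longrightarrow> j < n \<Longrightarrow> continuous_map (mat_topology n) euclidean (\<lambda>A. A $$ (i,j))"
proof -
  assume ij: "i < n" "j < n"
  have "continuous_map (mat_topology n) euclidean
      ((\<lambda>x. x (i,j)) \<circ> (\<lambda>A. restrict (\<lambda>ij. A $$ ij) ({..<n} \<times> {..<n})))"
    unfolding mat_topology_def
    by (rule continuous_map_pullback)
      (use ij continuous_map_product_projection[of "(i,j)" "{..<n} \<times> {..<n}" "\<lambda>_. euclidean"] in simp)
  then show ?thesis using ij by (simp add: o_def)
qed

lemma continuous_map_into_mat_topology:
  assumes "\<And>x. x \<in> topspace X \<Longrightarrow> f x \<in> carrier_mat n n"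
    and "\<And>i j. i < n \<Longrightarrow> j < n \<Longrightarrow> continuous_map X euclidean (\<lambda>x. f x $$ (i,j))"
  shows "continuous_map X (mat_topology n) f"
  unfolding mat_topology_def
proof (rule continuous_map_pullback')
  show "continuous_map X (product_topology (\<lambda>_. euclidean) ({..<n} \<times> {..<n}))
      ((\<lambda>A. restrict (\<lambda>ij. A $$ ij) ({..<n} \<times> {..<n})) \<circ> f)"
    unfolding continuous_map_componentwise using assms(2) by (auto simp: o_def)
qed (use assms(1) in auto)

context
  fixes d c n :: nat and \<theta> :: real
  assumes d: "1 \<le> d" and c: "1 \<le> c" and n: "n = d + c" and \<theta>: "\<theta> = pi / real n"
begin

private lemmas params = d c n \<theta>

text \<open>The parameter can be recovered continuously from the entry next to the diagonal, which
  is \<open>t\<close> times the positive constant sin (d * \<theta>) / sin \<theta>.\<close>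

lemma homeomorphic_map_u_pos:
  "homeomorphic_map (top_of_set S) (subtopology (mat_topology n) (u_pos d n ` S)) (u_pos d n)"
proof -
  define B where "B = sin_binomial \<theta> d 1"
  have B: "0 < B"
    unfolding B_def sin_binomial_def \<theta> using sin_pi_frac_pos[of "real d" n] sin_pi_frac_pos[of 1 n] n d c by simp
  define g where "g A = Re (A $$ (0,1)) / B" for A :: "complex mat"
  have n1: "0 < n" "1 < n" using d c n by auto
  have gu: "g (u_pos d n t) = t" for t
    using B n1 by (simp add: g_def u_pos_index[OF params] B_def)
  have carrier: "u_pos d n t \<in> carrier_mat n n" for t
    by (simp add: u_pos_def u_toeplitz_def)
  have "continuous_map (top_of_set S) (mat_topology n) (u_pos d n)"
  proof (rule continuous_map_into_mat_topology[OF carrier])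
    fix i j assume "i < n" "j < n"
    then show "continuous_map (top_of_set S) euclidean (\<lambda>t. u_pos d n t $$ (i,j))"
      by (cases "i \<le> j") (auto simp: u_pos_index[OF params] intro!: continuous_intros)
  qed
  then have 1: "continuous_map (top_of_set S) (subtopology (mat_topology n) (u_pos d n ` S)) (u_pos d n)"
    by (auto simp: continuous_map_in_subtopology)
  have "continuous_map (mat_topology n) euclidean ((\<lambda>z. Re z / B) \<circ> (\<lambda>A. A $$ (0,1)))"
  proof (rule continuous_map_compose)
    show "continuous_map (mat_topology n) euclidean (\<lambda>A. A $$ (0,1))"
      by (rule continuous_map_mat_topology_index) (use n d c in auto)
    show "continuous_map euclidean euclidean (\<lambda>z. Re z / B)"
      using B by (auto intro!: continuous_intros)
  qed
  then have "continuous_map (mat_topology n) euclidean g"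
    by (simp add: o_def g_def[abs_def])
  then have 2: "continuous_map (subtopology (mat_topology n) (u_pos d n ` S)) (top_of_set S) g"
    by (auto simp: continuous_map_in_subtopology gu intro: continuous_map_from_subtopology)
  have "homeomorphic_maps (top_of_set S) (subtopology (mat_topology n) (u_pos d n ` S)) (u_pos d n) g"
    unfolding homeomorphic_maps_def using 1 2 by (auto simp: gu)
  then show ?thesis by (auto simp: homeomorphic_map_maps)
qed

lemma u_pos_in_V_real: "u_pos d n t \<in> V_real d n"
  using u_pos_in_V[OF params, of t] by (simp add: V_real_def u_pos_index[OF params])

lemma V_carrier: "u \<in> V d n \<Longrightarrow> u \<in> carrier_mat n n"
  by (simp add: V_def Uplus_e_def Uplus_def)

lemma V_totally_nonneg: "{u \<in> V d n. totally_nonneg n u} = u_pos d n ` {0..}"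
proof (intro equalityI subsetI)
  fix u assume u: "u \<in> {u \<in> V d n. totally_nonneg n u}"
  then have "pluecker_nonneg c n u"
    using totally_nonneg_imp_pluecker_nonneg[OF params] V_carrier by auto
  then show "u \<in> u_pos d n ` {0..}"
    using u pluecker_nonneg_imp_u_pos[OF params, of u] by auto
qed (use u_pos_totally_nonneg[OF params] u_pos_in_V[OF params] in auto)

lemma V_nonneg_eq: "V_nonneg d n = u_pos d n ` {0..}"
proof -
  have "V_nonneg d n \<subseteq> {u \<in> V d n. totally_nonneg n u}"
    by (auto simp: V_nonneg_def V_real_def Uplus_nonneg_def)
  moreover have "u_pos d n t \<in> V_nonneg d n" if "0 \<le> t" for t
    using u_pos_in_V_real[of t] u_pos_totally_nonneg[OF params that] u_pos_in_V[OF params, of t]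
    by (simp add: V_nonneg_def Uplus_nonneg_def V_def Uplus_e_def)
  ultimately show ?thesis unfolding V_totally_nonneg by auto
qed

lemma V_pos_eq: "V_pos d n = u_pos d n ` {0<..}"
proof -
  \<comment> \<open>The corner entry at (0, d), nonzero on the cell, distinguishes the open part
    from the identity matrix.\<close>
  have "t \<noteq> 0" if "u_pos d n t \<in> cell d n" for t
  proof
    assume "t = 0"
    moreover have "0 < n" "d < n" using c n by auto
    ultimately have "u_pos d n t $$ (0,d) = 0"
      using d by (simp add: u_pos_index[OF params])
    then show False using cell_top_row(1)[OF d c n that] by simp
  qed
  moreover have "u_pos d n t \<in> cell d n" if "0 < t" for t
    unfolding u_pos_eq_toeplitz[OF params]
    by (rule toeplitz_in_cell[OF d c n degree_p_pos[OF params] degree_r_pos[OF params] p_pos_mult_r_pos[OF params]])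
      (use that in simp)
  ultimately show ?thesis unfolding V_pos_def V_nonneg_eq by force
qed

lemma V_nonneg_iff_schur:
  assumes u: "u \<in> V d n"
  shows "u \<in> V_nonneg d n \<longleftrightarrow> (\<forall>l\<in>Sh d c. schur d c l u \<in> \<real>\<^sub>\<ge>\<^sub>0)"
proof
  assume "u \<in> V_nonneg d n"
  then obtain t where t: "0 \<le> t" "u = u_pos d n t" by (auto simp: V_nonneg_eq)
  show "\<forall>l\<in>Sh d c. schur d c l u \<in> \<real>\<^sub>\<ge>\<^sub>0"
  proof
    fix l assume l: "l \<in> Sh d c"
    \<comment> \<open>Strict positivity is known only for positive parameters; homogeneity in
      \<open>t\<close> reduces every \<open>t \<ge> 0\<close> to the parameter 1.\<close>
    obtain s where s: "0 < s" "schur d c l (u_pos d n 1) = complex_of_real s"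
      using schur_u_pos_positive[OF params l, of 1] by auto
    have "schur d c l u = of_real (t ^ part_size d l) * schur d c l (u_pos d n 1)"
      unfolding t(2) schur_u_pos[OF params l] by simp
    then show "schur d c l u \<in> \<real>\<^sub>\<ge>\<^sub>0" using s t by (simp flip: of_real_mult of_real_power)
  qed
next
  assume "\<forall>l\<in>Sh d c. schur d c l u \<in> \<real>\<^sub>\<ge>\<^sub>0"
  then have "pluecker_nonneg c n u" using schur_nonneg_imp_pluecker_nonneg[OF params u] by blast
  then show "u \<in> V_nonneg d n"
    using pluecker_nonneg_imp_u_pos[OF params u] by (auto simp: V_nonneg_eq)
qed

lemma V_pos_iff_schur:
  assumes u: "u \<in> V d n"
  shows "u \<in> V_pos d n \<longleftrightarrow> (\<forall>l\<in>Sh d c. schur d c l u \<in> complex_of_real ` {0<..})"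
proof
  assume "u \<in> V_pos d n"
  then obtain t where t: "0 < t" "u = u_pos d n t" by (auto simp: V_pos_eq)
  show "\<forall>l\<in>Sh d c. schur d c l u \<in> complex_of_real ` {0<..}"
    unfolding t(2) using schur_u_pos_positive[OF params _ t(1)] by (metis greaterThan_iff image_eqI)
next
  assume pos: "\<forall>l\<in>Sh d c. schur d c l u \<in> complex_of_real ` {0<..}"
  then have "u \<in> V_nonneg d n" unfolding V_nonneg_iff_schur[OF u] by force
  then obtain t where t: "0 \<le> t" "u = u_pos d n t" by (auto simp: V_nonneg_eq)
  \<comment> \<open>A single column of height \<open>d\<close>: any nonempty partition would do,
    since its function vanishes at t = 0.\<close>
  define l where "l i = (if i \<in> {1..d} then 1 else 0 :: nat)" for i
  have l: "l \<in> Sh d c" using c by (auto simp: Sh_def l_def)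
  have "part_size d l = d" by (simp add: part_size_def l_def)
  then have "schur d c l u = 0" if "t = 0"
    unfolding t(2) schur_u_pos[OF params l] using that d by simp
  then have "t \<noteq> 0" using pos l by force
  then show "u \<in> V_pos d n" using t by (auto simp: V_pos_eq)
qed

end

theorem theorem8p4:
  fixes n d c :: nat
  assumes "2 \<le> n" and "1 \<le> d" and "d \<le> n - 1" and "c = n - d"
  shows
    "(\<forall>l \<in> Sh d c. \<forall>t :: real.
        schur d c l (u_pos d n t) = complex_of_real (t ^ part_size d l *
          ((\<Prod>(i, j) \<in> diagram d l. sin ((real d - real i + real j) * (pi / real n))) /
           (\<Prod>(i, j) \<in> diagram d l. sin (real_of_int (hook_length d l i j) * (pi / real n))))))
     \<and> (\<forall>t :: real. q_fun d n (u_pos d n t) = complex_of_real (t ^ n))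
     \<and>
     u_pos d n \<in> UNIV \<rightarrow> V_real d n
     \<and> homeomorphic_map (top_of_set {0..}) (subtopology (mat_topology n) (V_nonneg d n)) (u_pos d n)
     \<and> homeomorphic_map (top_of_set {0<..}) (subtopology (mat_topology n) (V_pos d n)) (u_pos d n)
     \<and> u_pos d n ` {0..} = {u \<in> V d n. totally_nonneg n u}
     \<and>
     (\<forall>u \<in> V d n.
       (u \<in> V_nonneg d n \<longleftrightarrow> (\<forall>l \<in> Sh d c. schur d c l u \<in> \<real>\<^sub>\<ge>\<^sub>0))
     \<and> (u \<in> V_pos d n \<longleftrightarrow> (\<forall>l \<in> Sh d c. schur d c l u \<in> complex_of_real ` {0<..})))"
proof -
  have c: "1 \<le> c" and n: "n = d + c" using assms by auto
  note params = assms(2) c n refl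
  have "q_fun d n (u_pos d n t) = complex_of_real (t ^ n)" for t
  proof -
    have "degree (r_pos d n t) < n"
      using degree_r_pos[OF params, of t] n assms(2) by simp
    then have "q_fun d n (u_pos d n t) = (- 1) ^ (d + n) * ((- 1) ^ c * of_real t ^ n)"
      unfolding u_pos_eq_toeplitz[OF params]
      by (intro q_fun_toeplitz[OF degree_p_pos[OF params] coeff_p_pos_0[OF params] _ _ p_pos_mult_r_pos[OF params]])
        (use n c in auto)
    also have "(- 1) ^ (d + n) * ((- 1) ^ c * of_real t ^ n) = (- 1) ^ (2 * n) * complex_of_real t ^ n"
      by (simp add: n mult_2 power_add mult_ac)
    finally show ?thesis by simp
  qed
  then show ?thesis
    using schur_u_pos_hooks[OF params] u_pos_in_V_real[OF params]
      homeomorphic_map_u_pos[OF params, of "{0..}"] homeomorphic_map_u_pos[OF params, of "{0<..}"]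
      V_totally_nonneg[OF params] V_nonneg_iff_schur[OF params] V_pos_iff_schur[OF params]
    unfolding V_nonneg_eq[OF params, symmetric] V_pos_eq[OF params, symmetric]
    by (intro conjI ballI allI) (auto simp: V_nonneg_eq[OF params])
qed

end
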